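(* Let $n\ge2$ and let $K$ be a convex body in $\mathbb{R}^n$ whose Santal\'o point is the origin, such that $\partial K$ is of class $C^2$ and has strictly positive Gaussian curvature everywhere. Then $$\lim_{\delta\to0}c_n\,\frac{|(K_{\delta|K|})^0|-|K^0|}{(\delta|K|)^{\frac{2}{n+1}}}=\int_{S^{n-1}}\frac{d\sigma(u)}{f_K(u)^{\frac{1}{n+1}}\,h_K(u)^{n+1}},$$ where $c_n=2\big(\frac{v_{n-1}}{n+1}\big)^{\frac{2}{n+1}}$.
   Context: For a convex body $K$, its Santal\'o point is the unique interior point $x$ minimizing the volume of $\{y:\langle y,z-x\rangle\le1\ \forall z\in K\}$; for a convex body $L$ containing the origin in its interior, $L^0=\{y:\langle y,z\rangle\le1\ \forall z\in L\}$ is its polar body. Floating body: for $u\in S^{n-1}$ and $\delta'>0$ small, let $a^u_{\delta'}$ be defined by $|\{x\in K:\langle x,u\rangle\ge a^u_{\delta'}\}|=\delta'$, and $K_{\delta'}=\bigcap_{u\in S^{n-1}}\{x\in K:\langle x,u\rangle\le a^u_{\delta'}\}$. $|\cdot|$ is $n$-dimensional volume, $v_{n-1}$ is the volume of the $(n-1)$-dimensional Euclidean unit ball, $\sigma$ is spherical Lebesgue measure, $h_K$ the support function of $K$, and $f_K(u)$ the reciprocal of the Gauss curvature of $\partial K$ at the point with outer normal $u$. *)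

theory Defs
  imports "HOL-Analysis.Analysis"
begin

type_synonym 'n vec = "real ^ 'n"

definition convex_body :: "'n::finite vec set \<Rightarrow> bool" where
  "convex_body K \<longleftrightarrow> compact K \<and> convex K \<and> interior K \<noteq> {}"

definition vol :: "'n::finite vec set \<Rightarrow> real" where
  "vol S = measure lebesgue S"

definition polar :: "'n::finite vec set \<Rightarrow> 'n vec set" where
  "polar L = {y. \<forall>z\<in>L. y \<bullet> z \<le> 1}"

definition supp :: "'n::finite vec set \<Rightarrow> 'n vec \<Rightarrow> real" where
  "supp K u = (SUP x\<in>K. x \<bullet> u)"

definition is_santalo_point :: "'n::finite vec set \<Rightarrow> 'n vec \<Rightarrow> bool" where
  "is_santalo_point K x \<longleftrightarrow> x \<in> interior K \<and>
     (\<forall>x'\<in>interior K. vol {y. \<forall>z\<in>K. y \<bullet> (z - x) \<le> 1} \<le> vol {y. \<forall>z\<in>K. y \<bullet> (z - x') \<le> 1})"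

definition float_level :: "'n::finite vec set \<Rightarrow> real \<Rightarrow> 'n vec \<Rightarrow> real" where
  "float_level K d u = (THE a. vol {x\<in>K. x \<bullet> u \<ge> a} = d)"

definition floating_body :: "'n::finite vec set \<Rightarrow> real \<Rightarrow> 'n vec set" where
  "floating_body K d = (\<Inter>u\<in>sphere 0 1. {x\<in>K. x \<bullet> u \<le> float_level K d u})"

definition local_C2_defining :: "'n::finite vec set \<Rightarrow> 'n vec \<Rightarrow> 'n vec set \<Rightarrow>
    ('n vec \<Rightarrow> real) \<Rightarrow> ('n vec \<Rightarrow> 'n vec) \<Rightarrow> ('n vec \<Rightarrow> 'n vec \<Rightarrow>\<^sub>L 'n vec) \<Rightarrow> bool" where
  "local_C2_defining K x U g G H \<longleftrightarrow> open U \<and> x \<in> U \<and>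
     (\<forall>y\<in>U. (g has_derivative (\<lambda>v. G y \<bullet> v)) (at y) \<and>
             (G has_derivative blinfun_apply (H y)) (at y) \<and> G y \<noteq> 0) \<and>
     continuous_on U H \<and> K \<inter> U = {y\<in>U. g y \<le> 0}"

definition C2_boundary :: "'n::finite vec set \<Rightarrow> bool" where
  "C2_boundary K \<longleftrightarrow> (\<forall>x\<in>frontier K. \<exists>U g G H. local_C2_defining K x U g G H)"

definition outer_normal :: "'n::finite vec set \<Rightarrow> 'n vec \<Rightarrow> 'n vec" where
  "outer_normal K x = (SOME \<nu>. \<exists>U g G H. local_C2_defining K x U g G H \<and> \<nu> = G x /\<^sub>R norm (G x))"

text \<open>Shape operator (differential of the Gauss map G/|G|) on the tangent space
  \<nu>^\<perp>, extended by the identity on the normal line, so that its determinant is the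
  determinant of the shape operator on the tangent space, i.e. the Gauss curvature.\<close>
definition shape_ext :: "'n::finite vec \<Rightarrow> ('n vec \<Rightarrow> 'n vec) \<Rightarrow> 'n vec \<Rightarrow> 'n vec" where
  "shape_ext a B v =
     (let \<nu> = a /\<^sub>R norm a; P = (\<lambda>w. w - (w \<bullet> \<nu>) *\<^sub>R \<nu>)
      in (1 / norm a) *\<^sub>R P (B (P v)) + (v \<bullet> \<nu>) *\<^sub>R \<nu>)"

definition gauss_curvature :: "'n::finite vec set \<Rightarrow> 'n vec \<Rightarrow> real" where
  "gauss_curvature K x = (SOME \<kappa>. \<exists>U g G H. local_C2_defining K x U g G H \<and>
       \<kappa> = det (matrix (shape_ext (G x) (blinfun_apply (H x)))))"

definition fK :: "'n::finite vec set \<Rightarrow> 'n vec \<Rightarrow> real" where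
  "fK K u = 1 / gauss_curvature K (THE x. x \<in> frontier K \<and> outer_normal K x = u)"

text \<open>Spherical Lebesgue measure on S^{n-1}, via the cone construction:
  sigma(A) = n * |{t u. u \<in> A, 0 < t \<le> 1}|.\<close>
definition sphere_measure :: "'n::finite vec measure" where
  "sphere_measure = density
     (distr (restrict_space lborel (cball 0 1 - {0})) (restrict_space borel (sphere 0 1))
        (\<lambda>x. x /\<^sub>R norm x))
     (\<lambda>_. ennreal (real CARD('n)))"

end

theory Submission
  imports Defs
begin

text \<open>
  In polar coordinates the volume of the polar body of \<open>L\<close> is \<open>1 / n\<close> times the integral
  of \<open>1 / supp L u ^ n\<close> over the sphere,
  so everything reduces to the rate at which \<open>supp (floating_body K d) u\<close> tends to \<open>supp K u\<close>.
  At the boundary point with normal \<open>u\<close> choose linear coordinates in which \<open>K\<close> osculates a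
  paraboloid. An osculating ellipsoid inside \<open>K\<close>, whose caps of a given relative depth all have the
  same volume, exhibits a point of the floating body near the boundary; a slightly larger paraboloid
  bounds the cap in direction \<open>u\<close>, hence the level of the floating body, from the other side.
  Both give the depth \<open>(\<kappa> d\<^sup>2) ^ (1 / (n + 1)) / cap_const n\<close> to first order. Balls of a fixed radius inscribed at every
  boundary point bound the depth uniformly in \<open>u\<close>, and
  dominated convergence applies.
\<close>

text \<open>The floating body is an intersection over all directions, so exhibiting a point of it
  means controlling every half-space through that point, not only the one with normal
  \<open>u\<close>. This is why the inner comparison body is an ellipsoid: linear coordinates turn
  its caps in all directions into caps of one ball. The outer comparison concerns the single
  direction \<open>u\<close>. The curvature enters through
  \<open>(det (matrix B))\<^sup>2 * \<kappa> = 1\<close> for coordinates \<open>B\<close> that turn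
  the extended shape operator into the identity.

  The paraboloids are valid on a neighbourhood whose size depends on the boundary point, hence they
  yield a pointwise limit only; the cruder bound from balls also keeps the support function of the
  floating body away from 0. With \<open>k\<close> and \<open>h\<close> the two support functions,
  \<open>1 / k ^ n - 1 / h ^ n\<close> is \<open>n * (h - k) / h ^ (n + 1)\<close> to first order,
  and this \<open>n\<close> cancels the \<open>1 / n\<close> of polar coordinates.

  \<open>outer_normal\<close> and \<open>gauss_curvature\<close> choose local defining functions
  independently of each other, so the local analysis is carried out for an arbitrary one.\<close>

section \<open>Linear images and Lebesgue measure\<close>

text \<open>Uniqueness of Haar measure, by evaluating the double integral of
  \<open>indicator B y * indicator A (y + x)\<close> in both orders: integrating over
  \<open>x\<close> first gives the left side; substituting \<open>y - x\<close> for \<open>y\<close>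
  and then integrating over \<open>x\<close> gives the right side. For a symmetric \<open>B\<close>
  of positive finite volume it says that \<open>\<nu>\<close> is a multiple of
  \<open>lborel\<close>.\<close>

lemma translation_invariant_measure_unique:
  fixes \<nu> :: "'a::euclidean_space measure"
  assumes sets_\<nu> [measurable_cong]: "sets \<nu> = sets borel" and "sigma_finite_measure \<nu>"
    and inv: "\<And>a. distr \<nu> borel ((+) a) = \<nu>"
    and [measurable]: "A \<in> sets borel" "B \<in> sets borel"
  shows "emeasure \<nu> A * emeasure lborel B = emeasure lborel A * emeasure \<nu> (uminus -` B)"
proof -
  interpret N: sigma_finite_measure \<nu> by fact
  interpret P: pair_sigma_finite \<nu> "lborel :: 'a measure" by standard
  have shift: "(\<integral>\<^sup>+x. f (a + x) \<partial>\<nu>) = (\<integral>\<^sup>+x. f x \<partial>\<nu>)"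
    if [measurable]: "f \<in> borel_measurable borel" for f and a :: 'a
  proof -
    have "(\<integral>\<^sup>+x. f x \<partial>\<nu>) = (\<integral>\<^sup>+x. f x \<partial>distr \<nu> borel ((+) a))" by (simp add: inv)
    also have "\<dots> = (\<integral>\<^sup>+x. f (a + x) \<partial>\<nu>)" by (rule nn_integral_distr) measurable
    finally show ?thesis by simp
  qed
  have shiftl: "(\<integral>\<^sup>+x. f (a + x) \<partial>lborel) = (\<integral>\<^sup>+x. f x \<partial>lborel)"
    if [measurable]: "f \<in> borel_measurable borel" for f and a :: 'a
  proof -
    have "(\<integral>\<^sup>+x. f x \<partial>lborel) = (\<integral>\<^sup>+x. f x \<partial>distr lborel borel ((+) a))"
      by (simp add: lborel_distr_plus)
    also have "\<dots> = (\<integral>\<^sup>+x. f (a + x) \<partial>lborel)" by (rule nn_integral_distr) measurable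
    finally show ?thesis by simp
  qed
  have "emeasure \<nu> A * emeasure lborel B = (\<integral>\<^sup>+y. indicator B y * emeasure \<nu> A \<partial>lborel)"
    by (simp add: nn_integral_multc mult.commute)
  also have "\<dots> = (\<integral>\<^sup>+y. \<integral>\<^sup>+x. indicator B y * indicator A (y + x) \<partial>\<nu> \<partial>lborel)"
    by (intro nn_integral_cong, subst nn_integral_cmult, simp)
       (simp add: shift[of "indicator A"] sets_\<nu>)
  also have "\<dots> = (\<integral>\<^sup>+x. \<integral>\<^sup>+y. indicator B y * indicator A (y + x) \<partial>lborel \<partial>\<nu>)"
    by (rule P.Fubini') measurable
  also have "\<dots> = (\<integral>\<^sup>+x. \<integral>\<^sup>+y. indicator B (y - x) * indicator A y \<partial>lborel \<partial>\<nu>)"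
  proof (rule nn_integral_cong)
    fix x :: 'a
    show "(\<integral>\<^sup>+y. indicator B y * indicator A (y + x) \<partial>lborel)
        = (\<integral>\<^sup>+y. indicator B (y - x) * indicator A y \<partial>lborel)"
      using shiftl[of "\<lambda>y. indicator B (y - x) * indicator A y" x]
      by (simp add: add.commute)
  qed
  also have "\<dots> = (\<integral>\<^sup>+y. \<integral>\<^sup>+x. indicator B (y - x) * indicator A y \<partial>\<nu> \<partial>lborel)"
    by (rule P.Fubini'[symmetric]) measurable
  also have "\<dots> = (\<integral>\<^sup>+y. indicator A y * emeasure \<nu> (uminus -` B) \<partial>lborel)"
  proof (intro nn_integral_cong)
    fix y :: 'a
    have m: "uminus -` B \<in> sets borel"
      using measurable_sets[of uminus borel borel B] by (simp add: borel_measurable_uminus_eq)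
    have "(\<integral>\<^sup>+x. indicator B (y - x) * indicator A y \<partial>\<nu>)
        = indicator A y * (\<integral>\<^sup>+x. indicator (uminus -` B) (- y + x) \<partial>\<nu>)"
      by (subst nn_integral_cmult[symmetric], use m in measurable)
         (auto intro!: nn_integral_cong split: split_indicator)
    also have "(\<integral>\<^sup>+x. indicator (uminus -` B) (- y + x) \<partial>\<nu>) = emeasure \<nu> (uminus -` B)"
      using m by (subst shift) (auto simp: sets_\<nu>)
    finally show "(\<integral>\<^sup>+x. indicator B (y - x) * indicator A y \<partial>\<nu>)
        = indicator A y * emeasure \<nu> (uminus -` B)" .
  qed
  also have "\<dots> = emeasure lborel A * emeasure \<nu> (uminus -` B)"
    by (simp add: nn_integral_multc)
  finally show ?thesis .
qed

text \<open>The pushforward of \<open>lborel\<close> under the inverse \<open>g\<close> is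
  translation invariant, because \<open>f\<close> turns a shift by \<open>a\<close> into a shift by
  \<open>f a\<close>; uniqueness makes it a constant multiple of \<open>lborel\<close>. The constant
  is identified in the next lemma.\<close>

lemma linear_image_measure_factor:
  fixes f :: "'a::euclidean_space \<Rightarrow> 'a"
  assumes "linear f" "inj f"
  obtains c where "\<And>S. S \<in> lmeasurable \<Longrightarrow> f ` S \<in> lmeasurable \<and> measure lebesgue (f ` S) = c * measure lebesgue S"
proof -
  obtain g where g: "linear g" "g \<circ> f = id" "f \<circ> g = id"
    using assms linear_injective_isomorphism by (metis comp_def fun_eq_iff id_apply)
  have gf[simp]: "g (f x) = x" and fg[simp]: "f (g x) = x" for x
    using g by (auto simp: fun_eq_iff)
  have im: "f ` S = g -` S" for S by (force simp: image_iff)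
  have [measurable]: "g \<in> borel_measurable borel"
    by (intro borel_measurable_continuous_onI linear_continuous_on linear_conv_bounded_linear[THEN iffD1] g(1))
  define \<nu> where "\<nu> = distr lborel borel g"
  have \<nu>: "emeasure \<nu> S = emeasure lborel (f ` S)" if "S \<in> sets borel" for S
    using that by (simp add: \<nu>_def emeasure_distr im)
  have bnd: "emeasure \<nu> (ball 0 r) < \<infinity>" for r
  proof -
    have "bounded (f ` ball 0 r)"
      using assms by (intro bounded_linear_image) (auto simp: linear_conv_bounded_linear)
    then show ?thesis using emeasure_bounded_finite by (simp add: \<nu>)
  qed
  have "sigma_finite_measure \<nu>"
  proof
    show "\<exists>A. countable A \<and> A \<subseteq> sets \<nu> \<and> \<Union> A = space \<nu> \<and> (\<forall>a\<in>A. emeasure \<nu> a \<noteq> \<infinity>)"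
      using bnd by (intro exI[of _ "range (\<lambda>n::nat. ball 0 (real n))"])
        (auto simp: \<nu>_def less_top intro: reals_Archimedean2)
  qed
  have inv: "distr \<nu> borel ((+) a) = \<nu>" for a
  proof -
    have "distr \<nu> borel ((+) a) = distr lborel borel (\<lambda>x. g (f a + x))"
      unfolding \<nu>_def by (subst distr_distr) (auto simp: o_def linear_add[OF g(1)])
    also have "\<dots> = distr (distr lborel borel ((+) (f a))) borel g"
      by (subst distr_distr) (auto simp: o_def)
    finally show ?thesis by (simp add: lborel_distr_plus \<nu>_def)
  qed
  \<comment> \<open>Testing against the unit ball, which is symmetric about 0, removes the
    reflection from the uniqueness identity.\<close>
  have eq: "emeasure lborel (f ` S) * emeasure lborel (ball 0 1 :: 'a set)
      = emeasure lborel S * emeasure \<nu> (ball 0 1)" if "S \<in> sets borel" for S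
  proof -
    have *: "uminus -` ball 0 1 = (ball 0 1 :: 'a set)" by auto
    show ?thesis
      using translation_invariant_measure_unique[OF _ \<open>sigma_finite_measure \<nu>\<close> inv that, of "ball 0 1"]
      by (simp add: \<nu> that * \<nu>_def[THEN arg_cong, of sets])
  qed
  define c where "c = measure \<nu> (ball 0 1) / measure lborel (ball 0 1 :: 'a set)"
  have box: "measure lebesgue (f ` cbox a b) = c * measure lebesgue (cbox a b)" for a b
  proof -
    have bb: "0 < measure lborel (ball 0 1 :: 'a set)" by (simp add: content_ball_gt_0_iff)
    have "f ` cbox a b \<in> sets borel"
      using assms(1)
      by (intro borel_compact compact_continuous_image linear_continuous_on)
        (auto simp: linear_conv_bounded_linear)
    then have "measure lebesgue (f ` cbox a b) = measure lborel (f ` cbox a b)" by simp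
    moreover have "measure lborel (f ` cbox a b) * measure lborel (ball 0 1 :: 'a set)
      = measure lborel (cbox a b) * measure \<nu> (ball 0 1)"
      using arg_cong[OF eq[of "cbox a b"], of enn2real] by (simp add: enn2real_mult measure_def)
    ultimately show ?thesis using bb by (simp add: c_def field_simps)
  qed
  show ?thesis
  proof (rule that)
    fix S :: "'a set" assume "S \<in> lmeasurable"
    then show "f ` S \<in> lmeasurable \<and> measure lebesgue (f ` S) = c * measure lebesgue S"
      using measure_linear_sufficient[OF assms(1), of S c] box by auto
  qed
qed

text \<open>The map is decomposed into elementary ones. Every injective map has some volume factor,
  so \<open>fix_cube\<close> can read it off from one set, the unit cube: a transposition of
  coordinates maps the cube onto itself, and a shear preserves its volume. Singular maps and
  stretches are treated directly.\<close>

lemma measure_linear_image_cart: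
  fixes f :: "real^'n \<Rightarrow> real^'n"
  assumes "linear f" "S \<in> lmeasurable"
  shows "f ` S \<in> lmeasurable \<and> measure lebesgue (f ` S) = \<bar>det (matrix f)\<bar> * measure lebesgue S"
proof -
  let ?P = "\<lambda>f::real^'n \<Rightarrow> real^'n. \<forall>S\<in>lmeasurable. f ` S \<in> lmeasurable \<and>
     measure lebesgue (f ` S) = \<bar>det (matrix f)\<bar> * measure lebesgue S"
  have cube: "measure lebesgue (cbox 0 (1::real^'n)) = 1"
    by (simp add: content_cbox_cart interval_eq_empty_cart)
  have fix_cube: "?P f" if f: "linear f" "\<bar>det (matrix f)\<bar> = 1"
    and m: "measure lebesgue (f ` cbox 0 1) = 1" for f
  proof -
    have "inj f" using f det_nz_iff_inj by fastforce
    then obtain c where c: "\<And>S. S \<in> lmeasurable \<Longrightarrow> f ` S \<in> lmeasurable \<and> measure lebesgue (f ` S) = c * measure lebesgue S"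
      using linear_image_measure_factor f by metis
    from c[of "cbox 0 1"] m cube have "c = 1" by simp
    then show ?thesis using c f by simp
  qed
  have "?P f"
  proof (rule induct_linear_elementary[OF assms(1)])
    fix f g :: "real^'n \<Rightarrow> real^'n" assume "linear f" "linear g" "?P f" "?P g"
    then show "?P (f \<circ> g)"
      unfolding image_comp[symmetric] matrix_compose[OF \<open>linear g\<close> \<open>linear f\<close>]
      by (simp add: det_mul abs_mult)
  next
    fix f :: "real^'n \<Rightarrow> real^'n" and i assume f: "linear f" "\<And>x. f x $ i = 0"
    have ni: "\<not> inj f"
      using f by (metis linear_injective_imp_surjective one_neq_zero surjE vec_component)
    then have "det (matrix f) = 0" using det_nz_iff_inj f(1) by blast
    moreover have "negligible (f ` S)" for S
      using negligible_linear_singular_image ni f(1) by blast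
    ultimately show "?P f"
      by (auto simp: negligible_imp_measure0 negligible_imp_measurable)
  next
    fix c :: "'n \<Rightarrow> real"
    have "det (matrix (\<lambda>x::real^'n. \<chi> i. c i * x $ i)) = prod c UNIV"
      by (subst det_diagonal) (auto simp: matrix_def axis_def)
    then show "?P (\<lambda>x. \<chi> i. c i * x $ i)"
      by (simp add: measurable_stretch measure_stretch)
  next
    fix m n :: 'n assume mn: "m \<noteq> n"
    let ?s = "\<lambda>x::real^'n. \<chi> i. x $ Transposition.transpose m n i"
    have lin: "linear ?s" by (rule linearI) (auto simp: vec_eq_iff)
    have ss: "?s \<circ> ?s = id" by (auto simp: vec_eq_iff fun_eq_iff)
    have "det (matrix ?s) * det (matrix ?s) = 1"
      using matrix_compose[OF lin lin]
      by (simp add: ss det_mul[symmetric] matrix_id_mat_1 del: det_mul)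
        (metis det_I)
    then have "\<bar>det (matrix ?s)\<bar> = 1" by (metis abs_mult_self_eq abs_one abs_square_eq_1 power2_eq_square)
    moreover have "?s x \<in> cbox 0 1" if "x \<in> cbox 0 1" for x
      using that by (simp add: mem_box_cart)
    then have "?s ` cbox 0 1 = cbox 0 1"
      using ss by (force simp: image_iff fun_eq_iff)
    ultimately show "?P ?s" using fix_cube[OF lin] cube by simp
  next
    fix m n :: 'n assume mn: "m \<noteq> n"
    let ?s = "\<lambda>x::real^'n. \<chi> i. if i = m then x $ m + x $ n else x $ i"
    have lin: "linear ?s" by (rule linearI) (auto simp: vec_eq_iff algebra_simps)
    have "matrix ?s = (\<chi> k. if k = m then row m (mat 1) + 1 *s row n (mat 1) else row k (mat 1))"
      using mn by (auto simp: matrix_def row_def mat_def axis_def vec_eq_iff)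
    then have "det (matrix ?s) = 1" using det_row_operation[OF mn, of "mat 1 :: real^'n^'n" 1] by simp
    moreover have "measure lebesgue (?s ` cbox 0 1) = 1"
      using cube measure_shear_interval[OF mn, of 0 1]
      by (simp add: interval_ne_empty_cart)
    ultimately show "?P ?s" using fix_cube[OF lin] by simp
  qed
  then show ?thesis using assms(2) by blast
qed

section \<open>Volumes of caps\<close>

abbreviation hsum :: "'a::euclidean_space \<Rightarrow> 'a \<Rightarrow> real" where
  "hsum b0 z \<equiv> (\<Sum>b\<in>Basis-{b0}. (z \<bullet> b)\<^sup>2)"

lemma nn_integral_affine_powr:
  fixes t p :: real
  assumes "0 \<le> t" "0 \<le> p"
  shows "(\<integral>\<^sup>+y. indicator {-t..0} y * ennreal ((-y) powr p) \<partial>lborel) = ennreal (t powr (p + 1) / (p + 1))"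
proof -
  have "(\<integral>\<^sup>+y. ennreal (indicator {-t..0} y * (-y) powr p) \<partial>lborel)
      = (\<integral>\<^sup>+y. ennreal (indicator {0..t} y * y powr p) \<partial>lborel)"
    by (subst nn_integral_real_affine[of _ "-1" 0])
       (auto simp: indicator_def intro!: nn_integral_cong)
  also have "\<dots> = ennreal (t powr (p + 1) / (p + 1))"
  proof -
    have "((\<lambda>x. x powr p) has_integral (t powr (p + 1) / (p + 1))) {0..t}"
      using has_integral_powr_from_0[of p t] assms by simp
    from nn_integral_has_integral_lebesgue[OF _ this] show ?thesis
      by (simp add: mult.commute ennreal_indicator ennreal_mult')
  qed
  finally show ?thesis by (simp add: ennreal_mult' ennreal_indicator)
qed

text \<open>The slices are kept in the product measure over \<open>Basis - {b0}\<close>, where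
  \<open>emeasure_cball_aux\<close> gives the volume of a ball directly; a Euclidean type of
  dimension one less is thereby avoided.\<close>

lemma emeasure_lborel_slice:
  fixes b0 :: "'a::euclidean_space"
  assumes b0: "b0 \<in> Basis" and [measurable]: "S \<in> sets borel"
  shows "emeasure lborel S = (\<integral>\<^sup>+y. emeasure (Pi\<^sub>M (Basis - {b0}) (\<lambda>_. lborel))
     {f \<in> space (Pi\<^sub>M (Basis - {b0}) (\<lambda>_. lborel)). y *\<^sub>R b0 + (\<Sum>b\<in>Basis-{b0}. f b *\<^sub>R b) \<in> S} \<partial>lborel)"
proof -
  interpret product_sigma_finite "\<lambda>_::'a. lborel :: real measure" by standard
  let ?B = "Basis - {b0}"
  have ins: "insert b0 ?B = Basis" using b0 by auto
  have "emeasure lborel S = (\<integral>\<^sup>+z. indicator S z \<partial>lborel)" by simp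
  also have "\<dots> = (\<integral>\<^sup>+f. indicator S (\<Sum>b\<in>Basis. f b *\<^sub>R b) \<partial>Pi\<^sub>M Basis (\<lambda>_. lborel))"
    by (subst lborel_eq, subst nn_integral_distr) auto
  also have "\<dots> = (\<integral>\<^sup>+f. indicator S (\<Sum>b\<in>Basis. f b *\<^sub>R b) \<partial>Pi\<^sub>M (insert b0 ?B) (\<lambda>_. lborel))"
    by (simp only: ins)
  also have "\<dots> = (\<integral>\<^sup>+y. \<integral>\<^sup>+f. indicator S (\<Sum>b\<in>Basis. (f(b0 := y)) b *\<^sub>R b) \<partial>Pi\<^sub>M ?B (\<lambda>_. lborel) \<partial>lborel)"
    by (subst product_nn_integral_insert_rev) (auto simp: ins)
  also have "\<dots> = (\<integral>\<^sup>+y. emeasure (Pi\<^sub>M ?B (\<lambda>_. lborel))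
     {f \<in> space (Pi\<^sub>M ?B (\<lambda>_. lborel)). y *\<^sub>R b0 + (\<Sum>b\<in>?B. f b *\<^sub>R b) \<in> S} \<partial>lborel)"
  proof (rule nn_integral_cong)
    fix y :: real
    have s: "(\<Sum>b\<in>Basis. (f(b0 := y)) b *\<^sub>R b) = y *\<^sub>R b0 + (\<Sum>b\<in>?B. f b *\<^sub>R b)" for f :: "'a \<Rightarrow> real"
      using b0 by (subst sum.remove[of _ b0]) (auto intro!: sum.cong)
    have "(\<integral>\<^sup>+f. indicator S (\<Sum>b\<in>Basis. (f(b0 := y)) b *\<^sub>R b) \<partial>Pi\<^sub>M ?B (\<lambda>_. lborel))
        = (\<integral>\<^sup>+f. indicator {f \<in> space (Pi\<^sub>M ?B (\<lambda>_. lborel)). y *\<^sub>R b0 + (\<Sum>b\<in>?B. f b *\<^sub>R b) \<in> S} f \<partial>Pi\<^sub>M ?B (\<lambda>_. lborel))"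
      unfolding s by (rule nn_integral_cong) (auto simp: indicator_def)
    also have "\<dots> = emeasure (Pi\<^sub>M ?B (\<lambda>_. lborel))
       {f \<in> space (Pi\<^sub>M ?B (\<lambda>_. lborel)). y *\<^sub>R b0 + (\<Sum>b\<in>?B. f b *\<^sub>R b) \<in> S}"
      by (rule nn_integral_indicator) measurable
    finally show "(\<integral>\<^sup>+f. indicator S (\<Sum>b\<in>Basis. (f(b0 := y)) b *\<^sub>R b) \<partial>Pi\<^sub>M ?B (\<lambda>_. lborel)) = \<dots>" .
  qed
  finally show ?thesis .
qed

text \<open>The \<open>c_n\<close> of the theorem. It is normalised so that the cap of height
  \<open>t\<close> of the paraboloid with \<open>M = 1\<close> has volume
  \<open>(cap_const n * t) powr ((n + 1) / 2)\<close>.\<close>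

definition cap_const :: "nat \<Rightarrow> real" where
  "cap_const n = 2 * (unit_ball_vol (real n - 1) / (real n + 1)) powr (2 / (real n + 1))"

lemma cap_const_pos: "1 \<le> n \<Longrightarrow> 0 < cap_const n"
  unfolding cap_const_def by (simp add: add_nonneg_pos less_imp_neq[symmetric] unit_ball_vol_pos)

text \<open>The slice at height \<open>y\<close> is a ball of radius
  \<open>sqrt (- (2 * y / M))\<close> in \<open>n - 1\<close> dimensions; integrating its volume
  over the heights from \<open>- t\<close> to 0 produces the exponent \<open>(n + 1) / 2\<close> of
  \<open>t\<close>.\<close>

lemma emeasure_paraboloid_cap:
  fixes b0 :: "'a::euclidean_space"
  assumes b0: "b0 \<in> Basis" and t: "0 \<le> t" and M: "0 < M"
  shows "emeasure lborel {z. - t \<le> z \<bullet> b0 \<and> z \<bullet> b0 \<le> - (M / 2) * hsum b0 z}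
    = ennreal ((cap_const DIM('a) * t) powr ((real DIM('a) + 1) / 2) * M powr (- (real DIM('a) - 1) / 2))"
proof -
  let ?B = "Basis - {b0}" and ?n = "real DIM('a)"
  let ?S = "{z. - t \<le> z \<bullet> b0 \<and> z \<bullet> b0 \<le> - (M / 2) * hsum b0 z}"
  let ?P = "Pi\<^sub>M ?B (\<lambda>_. lborel :: real measure)"
  have cB: "real (card ?B) = ?n - 1" "card ?B = DIM('a) - 1" using b0 by (auto simp: card_Diff_singleton of_nat_diff Suc_leI)
  have n1: "1 \<le> ?n" by (simp add: Suc_leI)
  have [measurable]: "?S \<in> sets borel" by measurable
  define p where "p = (?n - 1) / 2"
  have p0: "0 \<le> p" using n1 by (simp add: p_def)
  define v where "v = unit_ball_vol (?n - 1)"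
  have v0: "0 < v" using n1 by (simp add: v_def unit_ball_vol_pos)
  have slice: "{f \<in> space ?P. y *\<^sub>R b0 + (\<Sum>b\<in>?B. f b *\<^sub>R b) \<in> ?S}
     = (if -t \<le> y \<and> y \<le> 0 then {f. sqrt (\<Sum>b\<in>?B. (f b)\<^sup>2) \<le> sqrt (- (2 * y / M))} \<inter> space ?P else {})" for y
  proof -
    have i0: "(y *\<^sub>R b0 + (\<Sum>b\<in>?B. f b *\<^sub>R b)) \<bullet> b0 = y" for f :: "'a \<Rightarrow> real"
      using b0 by (simp add: inner_add_left inner_sum_left inner_Basis)
    have ib: "(y *\<^sub>R b0 + (\<Sum>b\<in>?B. f b *\<^sub>R b)) \<bullet> b = f b" if "b \<in> ?B" for f :: "'a \<Rightarrow> real" and b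
    proof -
      have "(\<Sum>b'\<in>?B. f b' * (b' \<bullet> b)) = (\<Sum>b'\<in>?B. if b' = b then f b else 0)"
        using that by (intro sum.cong) (auto simp: inner_Basis)
      then show ?thesis
        using that b0 by (auto simp: inner_add_left inner_sum_left inner_Basis)
    qed
    have h: "hsum b0 (y *\<^sub>R b0 + (\<Sum>b\<in>?B. f b *\<^sub>R b)) = (\<Sum>b\<in>?B. (f b)\<^sup>2)" for f :: "'a \<Rightarrow> real"
      by (intro sum.cong) (auto simp: ib)
    have "(y \<le> - (M / 2) * c) \<longleftrightarrow> y \<le> 0 \<and> sqrt c \<le> sqrt (- (2 * y / M))" if "0 \<le> c" for c
    proof -
      have "(y \<le> - (M / 2) * c) \<longleftrightarrow> c \<le> - (2 * y / M)" using M by (auto simp: field_simps)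
      moreover have "y \<le> 0" if "c \<le> - (2 * y / M)"
      proof -
        have "0 \<le> - (2 * y / M)" using that \<open>0 \<le> c\<close> by linarith
        then show ?thesis using M by (simp add: field_simps zero_le_mult_iff)
      qed
      ultimately show ?thesis by auto
    qed
    then show ?thesis using i0 h by (auto simp: sum_nonneg)
  qed
  have "emeasure lborel ?S = (\<integral>\<^sup>+y. emeasure ?P {f \<in> space ?P. y *\<^sub>R b0 + (\<Sum>b\<in>?B. f b *\<^sub>R b) \<in> ?S} \<partial>lborel)"
    by (rule emeasure_lborel_slice[OF b0]) measurable
  also have "\<dots> = (\<integral>\<^sup>+y. ennreal (v * (2 / M) powr p) * (indicator {-t..0} y * ennreal ((-y) powr p)) \<partial>lborel)"
  \<comment> \<open>\<open>emeasure_cball_aux\<close> asks for a positive radius, which fails at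
    height 0; a single height is a null set.\<close>
  proof (rule nn_integral_cong_AE)
    have "AE y in lborel. y \<noteq> (0::real)" using AE_lborel_singleton .
    then show "AE y in lborel. emeasure ?P {f \<in> space ?P. y *\<^sub>R b0 + (\<Sum>b\<in>?B. f b *\<^sub>R b) \<in> ?S}
       = ennreal (v * (2 / M) powr p) * (indicator {-t..0} y * ennreal ((-y) powr p))"
    proof eventually_elim
      fix y :: real assume y: "y \<noteq> 0"
      show "emeasure ?P {f \<in> space ?P. y *\<^sub>R b0 + (\<Sum>b\<in>?B. f b *\<^sub>R b) \<in> ?S}
       = ennreal (v * (2 / M) powr p) * (indicator {-t..0} y * ennreal ((-y) powr p))"
      proof (cases "-t \<le> y \<and> y \<le> 0")
        case True
        then have pos: "0 < - (2 * y / M)" using y M by (simp add: field_simps)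
        have "emeasure ?P ({f. sqrt (\<Sum>b\<in>?B. (f b)\<^sup>2) \<le> sqrt (- (2 * y / M))} \<inter> space ?P)
           = ennreal (unit_ball_vol (real (card ?B)) * sqrt (- (2 * y / M)) ^ card ?B)"
          using pos by (intro emeasure_cball_aux) auto
        also have "sqrt (- (2 * y / M)) ^ card ?B = (- (2 * y / M)) powr p"
        proof -
          have "sqrt (- (2 * y / M)) ^ card ?B = ((- (2 * y / M)) powr (1/2)) powr real (card ?B)"
            using pos by (simp add: powr_realpow powr_half_sqrt)
          then show ?thesis by (simp add: powr_powr cB p_def)
        qed
        also have "(- (2 * y / M)) powr p = (2 / M) powr p * (-y) powr p"
          using M True y by (subst powr_mult[symmetric]) auto
        finally show ?thesis using True v0
          unfolding slice by (simp add: cB v_def ennreal_mult' mult.assoc)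
      next
        case False then show ?thesis unfolding slice by auto
      qed
    qed
  qed
  also have "\<dots> = ennreal (v * (2 / M) powr p) * ennreal (t powr (p + 1) / (p + 1))"
    using nn_integral_affine_powr[OF t p0] by (subst nn_integral_cmult) auto
  also have "\<dots> = ennreal (v * (2 / M) powr p * (t powr (p + 1) / (p + 1)))"
    using p0 v0 by (subst ennreal_mult'[symmetric]) auto
  also have "v * (2 / M) powr p * (t powr (p + 1) / (p + 1))
      = (cap_const DIM('a) * t) powr ((?n + 1) / 2) * M powr (- (?n - 1) / 2)"
  \<comment> \<open>Since \<open>2 * (p + 1) = n + 1\<close>, the factor \<open>1 / (p + 1)\<close>
    of the integral becomes the denominator \<open>n + 1\<close> inside \<open>cap_const\<close> at
    the price of one more factor 2.\<close>
  proof -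
    have "(cap_const DIM('a) * t) powr ((?n + 1) / 2)
       = 2 powr ((?n + 1) / 2) * ((v / (?n + 1)) powr (2 / (?n + 1))) powr ((?n + 1) / 2) * t powr ((?n + 1) / 2)"
      using t v0 by (simp add: cap_const_def powr_mult v_def)
    also have "((v / (?n + 1)) powr (2 / (?n + 1))) powr ((?n + 1) / 2) = v / (?n + 1)"
    proof -
      have "2 / m * (m / 2) = 1" if "m \<noteq> 0" for m :: real using that by simp
      from this[of "?n + 1"] show ?thesis using v0 n1 by (simp only: powr_powr) simp
    qed
    finally have 1: "(cap_const DIM('a) * t) powr ((?n + 1) / 2) = 2 powr (p + 1) * (v / (?n + 1)) * t powr (p + 1)"
      by (simp add: p_def field_simps)
    have 2: "M powr (- (?n - 1) / 2) = 1 / M powr p"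
      by (simp add: p_def powr_minus_divide[symmetric] minus_divide_left)
    have 3: "?n + 1 = 2 * (p + 1)" by (simp add: p_def field_simps)
    have 4: "v * (a / b) * (e / q) = (a * 2) * (v / (2 * q)) * e * (1 / b)" for a b e q :: real
      by (simp add: mult_ac)
    have 5: "2 powr (p + 1) = 2 powr p * (2::real)" by (simp add: powr_add)
    have 6: "(2 / M) powr p = 2 powr p / M powr p" using M by (simp add: powr_divide)
    show ?thesis unfolding 1 2 unfolding 3 5 6 by (rule 4)
  qed
  finally show ?thesis .
qed

lemma norm_sq_hsum:
  fixes z :: "'a::euclidean_space"
  assumes "b0 \<in> Basis"
  shows "(norm z)\<^sup>2 = (z \<bullet> b0)\<^sup>2 + hsum b0 z"
  using assms unfolding power2_norm_eq_inner
  by (subst euclidean_inner) (simp add: sum.remove power2_eq_square)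

text \<open>The spherical cap contains the cap of the paraboloid with the same pole and the same
  rim; a rotation carries the basis vector \<open>b0\<close> to \<open>e\<close>.\<close>

lemma measure_ball_cap_ge:
  fixes e :: "real^'n"
  assumes e: "norm e = 1" and s: "0 \<le> s" "s \<le> 1"
  shows "(cap_const CARD('n) * s) powr ((real CARD('n) + 1) / 2) * (1 - s / 2) powr ((real CARD('n) - 1) / 2)
     \<le> measure lebesgue {z \<in> cball 0 1. 1 - s \<le> z \<bullet> e}" (is "?v \<le> _")
proof -
  obtain b0 :: "real^'n" where b0: "b0 \<in> Basis" using nonempty_Basis by blast
  obtain f where f: "orthogonal_transformation f" "f b0 = e"
    using orthogonal_transformation_exists[of b0 e] b0 e by auto
  \<comment> \<open>At depth \<open>s\<close> the ball has squared radius \<open>s * (2 - s)\<close>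
    and the paraboloid has \<open>2 * s / M\<close>; this \<open>M\<close> makes the rims agree. It
    is also the source of the factor \<open>1 - s / 2\<close>.\<close>
  let ?M = "2 / (2 - s)"
  let ?P = "{z::real^'n. - s \<le> z \<bullet> b0 \<and> z \<bullet> b0 \<le> - (?M / 2) * hsum b0 z}"
  let ?C = "{z::real^'n. z \<in> cball 0 1 \<and> 1 - s \<le> z \<bullet> b0}"
  have M: "0 < ?M" using s by simp
  have "?v = (cap_const CARD('n) * s) powr ((real CARD('n) + 1) / 2) * ?M powr (- (real CARD('n) - 1) / 2)"
  proof -
    have i: "inverse ?M = 1 - s / 2" using s by (simp add: field_simps)
    have "?M powr (- (real CARD('n) - 1) / 2) = inverse ?M powr ((real CARD('n) - 1) / 2)"
      using M unfolding minus_divide_left[symmetric] powr_minus by (simp add: inverse_powr del: inverse_divide)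
    then show ?thesis unfolding i by (simp only:)
  qed
  then have em: "emeasure lborel ?P = ennreal ?v"
    using emeasure_paraboloid_cap[OF b0 s(1) M] unfolding \<open>?v = _\<close> by simp
  have sub: "(+) b0 ` ?P \<subseteq> ?C"
  proof (rule image_subsetI)
    fix z assume "z \<in> ?P"
    then have z: "- s \<le> z \<bullet> b0" "z \<bullet> b0 \<le> - (hsum b0 z / (2 - s))"
      using s by (auto simp: field_simps)
    have h: "hsum b0 z \<le> - (z \<bullet> b0) * (2 - s)" using z s by (simp add: field_simps)
    have h0: "0 \<le> hsum b0 z" by (intro sum_nonneg) auto
    have "z \<bullet> b0 \<le> 0" using z h0 s by (smt (verit) divide_nonneg_pos)
    have "- (z \<bullet> b0) * (2 - s) \<le> - (z \<bullet> b0) * (2 + z \<bullet> b0)"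
      using z \<open>z \<bullet> b0 \<le> 0\<close> by (intro mult_left_mono) auto
    with h have h2: "hsum b0 z + 2 * (z \<bullet> b0) + (z \<bullet> b0)\<^sup>2 \<le> 0"
      by (simp add: algebra_simps power2_eq_square)
    have "(norm (b0 + z))\<^sup>2 = 1 + 2 * (z \<bullet> b0) + (norm z)\<^sup>2"
      using b0 unfolding power2_norm_eq_inner by (simp add: inner_add_left inner_add_right inner_commute)
    then have "(norm (b0 + z))\<^sup>2 \<le> 1\<^sup>2" using norm_sq_hsum[OF b0, of z] h2 by simp
    then have "norm (b0 + z) \<le> 1" by (rule power2_le_imp_le) simp
    then show "b0 + z \<in> ?C"
      using z b0 by (simp add: inner_add_left)
  qed
  have Ccl: "compact ?C"
  proof -
    have "?C = cball 0 1 \<inter> {z. 1 - s \<le> b0 \<bullet> z}" by (auto simp: inner_commute)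
    then show ?thesis by (auto intro: compact_Int_closed closed_halfspace_ge)
  qed
  then have Cm: "?C \<in> lmeasurable" by (rule lmeasurable_compact)
  have "?P \<in> sets borel" by measurable
  then have Pm: "?P \<in> lmeasurable" using em
    by (auto simp: fmeasurable_def)
  have v0: "0 \<le> ?v" by simp
  have "?v = measure lebesgue ?P"
    using em v0 \<open>?P \<in> sets borel\<close> by (simp add: measure_def)
  also have "\<dots> = measure lebesgue ((+) b0 ` ?P)" by (rule measure_translation[symmetric])
  also have "\<dots> \<le> measure lebesgue ?C"
    using sub Cm measurable_translation[OF Pm] by (intro measure_mono_fmeasurable) (auto simp: fmeasurableD)
  also have "\<dots> = measure lebesgue (f ` ?C)"
    using measure_linear_image_cart[OF orthogonal_transformation_linear[OF f(1)] Cm] f(1) by simp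
  also have "f ` ?C = {z \<in> cball 0 1. 1 - s \<le> z \<bullet> e}"
  proof (intro set_eqI iffI)
    fix z assume "z \<in> f ` ?C"
    then show "z \<in> {z \<in> cball 0 1. 1 - s \<le> z \<bullet> e}"
      using f by (auto simp: orthogonal_transformation_norm orthogonal_transformation_def)
  next
    fix z assume z: "z \<in> {z \<in> cball 0 1. 1 - s \<le> z \<bullet> e}"
    obtain y where y: "z = f y"
      using orthogonal_transformation_surj[OF f(1)] by (metis surjD)
    show "z \<in> f ` ?C" using z f unfolding y
      by (auto simp: orthogonal_transformation_norm orthogonal_transformation_def intro!: imageI)
  qed
  finally show ?thesis .
qed

section \<open>Floating bodies\<close>

lemma negligible_hyperplane_inner:
  fixes u :: "'a::euclidean_space"
  assumes "u \<noteq> 0" shows "negligible {x. x \<bullet> u = a}"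
  using negligible_hyperplane[of u a] assms by (simp add: inner_commute)

lemma compact_cap:
  fixes K :: "'a::euclidean_space set"
  assumes "compact K" shows "compact {x \<in> K. a \<le> x \<bullet> u}"
proof -
  have "{x \<in> K. a \<le> x \<bullet> u} = K \<inter> {x. a \<le> u \<bullet> x}" by (auto simp: inner_commute)
  then show ?thesis using assms by (auto intro: compact_Int_closed closed_halfspace_ge)
qed

lemma vol_pos:
  assumes "compact K" "interior K \<noteq> {}" shows "0 < vol K"
proof -
  have "\<not> negligible (interior K)" using assms(2) open_not_negligible[OF open_interior] by blast
  then have "\<not> negligible K" using interior_subset negligible_subset by blast
  then show ?thesis using lmeasurable_compact[OF assms(1)] negligible_iff_measure
    unfolding vol_def by (metis measure_nonneg order_le_less)
qed

lemma vol_cap_mono: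
  assumes "compact K" "a \<le> b"
  shows "vol {x \<in> K. b \<le> x \<bullet> u} \<le> vol {x \<in> K. a \<le> x \<bullet> u}"
  unfolding vol_def using assms
  by (intro measure_mono_fmeasurable fmeasurableD lmeasurable_compact compact_cap) auto

text \<open>Dominated convergence: as the level moves to \<open>a\<close>, the indicators can fail
  to converge only on the hyperplane \<open>x \<bullet> u = a\<close>, which is a null set.\<close>

lemma continuous_vol_cap:
  fixes K :: "(real^'n) set"
  assumes "compact K" "u \<noteq> 0"
  shows "isCont (\<lambda>a. vol {x \<in> K. a \<le> x \<bullet> u}) a"
proof (rule continuous_at_sequentiallyI)
  fix X :: "nat \<Rightarrow> real" assume X: "X \<longlonglongrightarrow> a"
  have m: "{x \<in> K. b \<le> x \<bullet> u} \<in> lmeasurable" for b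
    using assms by (intro lmeasurable_compact compact_cap)
  have eq: "vol {x \<in> K. b \<le> x \<bullet> u} = integral\<^sup>L lebesgue (indicat_real {x \<in> K. b \<le> x \<bullet> u})" for b
    using m by (simp add: vol_def)
  have "(\<lambda>n. integral\<^sup>L lebesgue (indicat_real {x \<in> K. X n \<le> x \<bullet> u}))
      \<longlonglongrightarrow> integral\<^sup>L lebesgue (indicat_real {x \<in> K. a \<le> x \<bullet> u})"
  proof (rule integral_dominated_convergence[where w = "indicat_real K"])
    show "integrable lebesgue (indicat_real K)"
      using lmeasurable_compact[OF assms(1)] lmeasurable_iff_integrable by blast
    have "AE x in lebesgue. x \<notin> {x. x \<bullet> u = a}"
      using negligible_hyperplane_inner[OF assms(2)] by (intro AE_not_in) (simp add: negligible_iff_null_sets)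
    then show "AE x in lebesgue. (\<lambda>n. indicat_real {x \<in> K. X n \<le> x \<bullet> u} x) \<longlonglongrightarrow> indicat_real {x \<in> K. a \<le> x \<bullet> u} x"
    proof eventually_elim
      fix x assume "x \<notin> {x. x \<bullet> u = a}"
      then consider "x \<bullet> u < a" | "a < x \<bullet> u" by fastforce
      then have "eventually (\<lambda>n. indicat_real {x \<in> K. X n \<le> x \<bullet> u} x = indicat_real {x \<in> K. a \<le> x \<bullet> u} x) sequentially"
      proof cases
        case 1
        from order_tendstoD(1)[OF X this] show ?thesis by eventually_elim (use 1 in \<open>auto simp: indicator_def\<close>)
      next
        case 2
        from order_tendstoD(2)[OF X this] show ?thesis by eventually_elim (use 2 in \<open>auto simp: indicator_def\<close>)
      qed
      then show "(\<lambda>n. indicat_real {x \<in> K. X n \<le> x \<bullet> u} x) \<longlonglongrightarrow> indicat_real {x \<in> K. a \<le> x \<bullet> u} x"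
        by (rule tendsto_eventually)
    qed
    show "(\<lambda>x. indicat_real {x \<in> K. a \<le> x \<bullet> u} x) \<in> borel_measurable lebesgue"
      "\<And>n. (\<lambda>x. indicat_real {x \<in> K. X n \<le> x \<bullet> u} x) \<in> borel_measurable lebesgue"
      using m by (auto intro!: borel_measurable_indicator)
  qed (auto simp: indicator_def)
  then show "(\<lambda>n. vol {x \<in> K. X n \<le> x \<bullet> u}) \<longlonglongrightarrow> vol {x \<in> K. a \<le> x \<bullet> u}" by (simp add: eq)
qed

text \<open>Equal volumes would leave no volume in the slab between the two levels. But
  \<open>0 < d\<close> and \<open>d < vol K\<close> provide interior points beyond \<open>b\<close>
  and before \<open>a\<close>; the segment between them crosses the slab, which therefore contains
  an open piece of \<open>K\<close>. This makes the \<open>THE\<close> in \<open>float_level\<close>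
  well defined.\<close>

lemma vol_cap_eq_level_unique:
  fixes K :: "(real^'n) set"
  assumes K: "compact K" "convex K"
    and d: "0 < d" "d < vol K" and ab: "a < b"
    and eq: "vol {x \<in> K. a \<le> x \<bullet> u} = d" "vol {x \<in> K. b \<le> x \<bullet> u} = d"
  shows False
proof -
  have mK: "K \<in> lmeasurable" using K by (simp add: lmeasurable_compact)
  have m: "{x \<in> K. b \<le> x \<bullet> u} \<in> lmeasurable" for b
    using K by (intro lmeasurable_compact compact_cap)
  have neg: "negligible (K - interior K)"
    using negligible_convex_frontier[OF K(2)] K(1) by (simp add: frontier_def compact_imp_closed)
  have "\<exists>p\<in>interior K. b \<le> p \<bullet> u"
  proof (rule ccontr)
    assume "\<not> ?thesis"
    then have "{x \<in> K. b \<le> x \<bullet> u} \<subseteq> K - interior K" by auto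
    with neg have "negligible {x \<in> K. b \<le> x \<bullet> u}" by (rule negligible_subset)
    then show False using eq d by (simp add: vol_def negligible_imp_measure0)
  qed
  then obtain p where p: "p \<in> interior K" "b \<le> p \<bullet> u" by blast
  have "\<exists>q\<in>interior K. q \<bullet> u < a"
  proof (rule ccontr)
    assume c: "\<not> ?thesis"
    have "measure lebesgue K = measure lebesgue {x \<in> K. a \<le> x \<bullet> u}"
      using c by (intro measure_negligible_symdiff[symmetric] negligible_subset[OF neg] mK)
        (auto simp: not_less)
    then show False using eq d by (simp add: vol_def)
  qed
  then obtain q where q: "q \<in> interior K" "q \<bullet> u < a" by blast
  define c where "c = (a + b) / 2"
  have c: "a < c" "c < b" using ab by (auto simp: c_def)
  define \<tau> where "\<tau> = (c - q \<bullet> u) / (p \<bullet> u - q \<bullet> u)"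
  have \<tau>: "0 \<le> \<tau>" "\<tau> \<le> 1" using p q c by (auto simp: \<tau>_def divide_simps)
  define w where "w = (1 - \<tau>) *\<^sub>R q + \<tau> *\<^sub>R p"
  have wi: "w \<in> interior K"
    unfolding w_def using convex_interior[OF K(2)] p q \<tau> by (intro convexD) auto
  have "w \<bullet> u = c"
  proof -
    have "w \<bullet> u = q \<bullet> u + \<tau> * (p \<bullet> u - q \<bullet> u)" by (simp add: w_def inner_add_left algebra_simps)
    also have "\<dots> = c" using p q c by (simp add: \<tau>_def)
    finally show ?thesis .
  qed
  let ?O = "interior K \<inter> ({x. a < x \<bullet> u} \<inter> {x. x \<bullet> u < b})"
  have op: "open ?O"
    by (intro open_Int open_interior open_Collect_less continuous_intros)
  have "w \<in> ?O" using wi \<open>w \<bullet> u = c\<close> c by simp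
  then have nn: "\<not> negligible ?O" using op open_not_negligible by blast
  have Om: "?O \<in> lmeasurable"
    using op K by (intro lmeasurable_open) (auto intro: bounded_subset[OF compact_imp_bounded[OF K(1)]] dest: interior_subset[THEN subsetD])
  have "measure lebesgue ?O + measure lebesgue {x \<in> K. b \<le> x \<bullet> u}
      = measure lebesgue (?O \<union> {x \<in> K. b \<le> x \<bullet> u})"
    using measure_Un2[OF Om m[of b]] by (simp add: Diff_triv Int_commute disjoint_iff)
  also have "\<dots> \<le> measure lebesgue {x \<in> K. a \<le> x \<bullet> u}"
    using Om m[of a] m[of b] ab interior_subset[of K]
    by (intro measure_mono_fmeasurable) (auto intro!: sets.Un dest: fmeasurableD)
  finally have "measure lebesgue ?O \<le> 0" using eq by (simp add: vol_def)
  then have "measure lebesgue ?O = 0" using measure_nonneg[of lebesgue ?O] by linarith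
  then show False using nn Om negligible_iff_measure by blast
qed

lemma float_level:
  fixes K :: "(real^'n) set"
  assumes K: "compact K" "convex K" and d: "0 < d" "d < vol K" and u: "u \<noteq> 0"
  shows "vol {x \<in> K. float_level K d u \<le> x \<bullet> u} = d"
proof -
  let ?V = "\<lambda>a. vol {x \<in> K. a \<le> x \<bullet> u}"
  obtain R where R: "0 < R" "\<And>x. x \<in> K \<Longrightarrow> norm x \<le> R"
    using compact_imp_bounded[OF K(1)] bounded_pos by blast
  \<comment> \<open>The summand 1 makes the bound strict, so that the cap at level \<open>T\<close>
    is empty.\<close>
  define T where "T = R * norm u + 1"
  have bd: "\<bar>x \<bullet> u\<bar> < T" if "x \<in> K" for x
  proof -
    have "\<bar>x \<bullet> u\<bar> \<le> norm x * norm u" by (rule Cauchy_Schwarz_ineq2)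
    also have "\<dots> \<le> R * norm u" using R that by (intro mult_right_mono) auto
    finally show ?thesis by (simp add: T_def)
  qed
  have "{x \<in> K. T \<le> x \<bullet> u} = {}" using bd by force
  then have 1: "?V T = 0" by (simp only: vol_def) simp
  have "{x \<in> K. - T \<le> x \<bullet> u} = K" using bd by force
  then have 2: "?V (- T) = vol K" by simp
  have "\<exists>a. - T \<le> a \<and> a \<le> T \<and> ?V a = d"
    using 1 2 d R by (intro IVT2) (auto simp: T_def continuous_vol_cap[OF K(1) u] add_nonneg_nonneg)
  then obtain a where a: "?V a = d" by blast
  have "a' = a" if "?V a' = d" for a'
    using vol_cap_eq_level_unique[OF K d _ that a] vol_cap_eq_level_unique[OF K d _ a that] by (meson linorder_neqE)
  then have "float_level K d u = a" unfolding float_level_def using a by (intro the_equality)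
  then show ?thesis using a by simp
qed

lemma le_float_level:
  fixes K :: "(real^'n) set"
  assumes K: "compact K" "convex K" and d: "0 < d" "d < vol K" and u: "u \<noteq> 0"
    and a: "d \<le> vol {x \<in> K. a \<le> x \<bullet> u}"
  shows "a \<le> float_level K d u"
proof (rule ccontr)
  assume c: "\<not> ?thesis"
  then have "vol {x \<in> K. a \<le> x \<bullet> u} \<le> d"
    using vol_cap_mono[OF K(1), of "float_level K d u" a u] float_level[OF K d u] by simp
  with a have "vol {x \<in> K. a \<le> x \<bullet> u} = d" by simp
  then show False using vol_cap_eq_level_unique[OF K d _ float_level[OF K d u], of a] c by linarith
qed

lemma float_level_less:
  fixes K :: "(real^'n) set"
  assumes K: "compact K" "convex K" and d: "0 < d" "d < vol K" and u: "u \<noteq> 0"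
    and a: "vol {x \<in> K. a \<le> x \<bullet> u} < d"
  shows "float_level K d u < a"
  using vol_cap_mono[OF K(1), of a "float_level K d u" u] float_level[OF K d u] a by fastforce

text \<open>All caps of an ellipsoid cut off by hyperplanes at the same affine depth have equal volume,
  so a point of depth \<open>s\<close> in an inscribed ellipsoid is cut off from \<open>K\<close> only by large caps.\<close>

lemma ellipsoid_point_in_floating_body:
  fixes K :: "(real^'n) set" and A :: "real^'n \<Rightarrow> real^'n"
  assumes K: "compact K" "convex K" and d: "0 < d" "d < vol K"
    and A: "linear A" and sub: "(\<lambda>y. c + A y) ` cball 0 1 \<subseteq> K"
    and s: "0 \<le> s" "s \<le> 1" and y: "norm y \<le> 1 - s"
    and dv: "d \<le> \<bar>det (matrix A)\<bar> * ((cap_const CARD('n) * s) powr ((real CARD('n) + 1) / 2) * (1 - s / 2) powr ((real CARD('n) - 1) / 2))"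
  shows "c + A y \<in> floating_body K d"
  unfolding floating_body_def
proof (intro InterI, clarsimp)
  fix v :: "real^'n" assume v: "norm v = 1"
  let ?p = "c + A y"
  have "?p \<in> K" using sub y s by (intro subsetD[OF sub] imageI) auto
  \<comment> \<open>In the coordinates of the ball, a half-space with normal \<open>v\<close> has
    normal \<open>adjoint A v\<close>, and \<open>e\<close> is its unit vector. If
    \<open>adjoint A v = 0\<close>, all points of the image have the same height over
    \<open>v\<close> and any unit vector serves.\<close>
  have "\<exists>e. norm e = 1 \<and> adjoint A v = norm (adjoint A v) *\<^sub>R e"
  proof (cases "adjoint A v = 0")
    case True then show ?thesis by (auto intro: exI[of _ v] simp: v)
  next
    case False then show ?thesis by (auto intro!: exI[of _ "adjoint A v /\<^sub>R norm (adjoint A v)"])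
  qed
  then obtain e where e: "norm e = 1" "adjoint A v = norm (adjoint A v) *\<^sub>R e" by blast
  let ?C = "{z \<in> cball 0 1. 1 - s \<le> z \<bullet> e}"
  have Cm: "?C \<in> lmeasurable" by (intro lmeasurable_compact compact_cap compact_cball)
  have ACm: "A ` ?C \<in> lmeasurable" "measure lebesgue (A ` ?C) = \<bar>det (matrix A)\<bar> * measure lebesgue ?C"
    using measure_linear_image_cart[OF A Cm] by auto
  have "(+) c ` A ` ?C \<subseteq> {x \<in> K. ?p \<bullet> v \<le> x \<bullet> v}"
  proof (unfold image_image, rule image_subsetI)
    fix z assume "z \<in> ?C"
    then have z: "z \<in> cball 0 1" "1 - s \<le> z \<bullet> e" by auto
    have "y \<bullet> e \<le> 1 - s" using y e Cauchy_Schwarz_ineq2[of y e] by simp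
    then have "y \<bullet> e \<le> z \<bullet> e" using z by simp
    then have "y \<bullet> adjoint A v \<le> z \<bullet> adjoint A v"
      by (subst (1 2) e(2)) (auto intro: mult_left_mono)
    then have "A y \<bullet> v \<le> A z \<bullet> v" by (simp add: adjoint_works[OF A] inner_commute)
    then show "c + A z \<in> {x \<in> K. ?p \<bullet> v \<le> x \<bullet> v}"
      using sub z by (auto simp: inner_add_left)
  qed
  then have "measure lebesgue ((+) c ` A ` ?C) \<le> vol {x \<in> K. ?p \<bullet> v \<le> x \<bullet> v}"
    unfolding vol_def using ACm(1) K
    by (intro measure_mono_fmeasurable lmeasurable_compact[OF compact_cap] fmeasurableD measurable_translation) auto
  moreover have "d \<le> measure lebesgue ((+) c ` A ` ?C)"
    unfolding measure_translation ACm(2) using dv measure_ball_cap_ge[OF e(1) s]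
    by (meson abs_ge_zero mult_left_mono order_trans)
  ultimately have "?p \<bullet> v \<le> float_level K d v"
    using v by (intro le_float_level[OF K d]) auto
  then show "?p \<in> K \<and> ?p \<bullet> v \<le> float_level K d v" using \<open>?p \<in> K\<close> by simp
qed

lemma supp_ge:
  assumes "bounded L" "x \<in> L" shows "x \<bullet> u \<le> supp L u"
proof -
  have "bdd_above ((\<lambda>x. x \<bullet> u) ` L)"
    using bounded_linear_image[OF assms(1) bounded_linear_inner_left] by (rule bounded_imp_bdd_above)
  then show ?thesis unfolding supp_def using assms(2) by (rule cSUP_upper2) auto
qed

lemma supp_le:
  assumes "L \<noteq> {}" "\<And>x. x \<in> L \<Longrightarrow> x \<bullet> u \<le> a" shows "supp L u \<le> a"
  unfolding supp_def using assms by (intro cSUP_least)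

lemma floating_body_subset:
  fixes K :: "(real^'n) set"
  shows "floating_body K d \<subseteq> K"
proof -
  obtain v :: "real^'n" where "norm v = 1" using vector_choose_size[of 1] by auto
  then have "floating_body K d \<subseteq> {x \<in> K. x \<bullet> v \<le> float_level K d v}"
    unfolding floating_body_def by (intro INF_lower) simp
  then show ?thesis by auto
qed

lemma supp_floating_body_le:
  assumes "floating_body K d \<noteq> {}" "norm u = 1"
  shows "supp (floating_body K d) u \<le> float_level K d u"
  using assms by (intro supp_le) (auto simp: floating_body_def)

section \<open>Quadratic forms and second order expansions\<close>

text \<open>If \<open>v \<bullet> S v\<close> vanished, moving from \<open>v\<close> along
  \<open>- S v\<close> would make the form negative at first order unless \<open>S v = 0\<close>,
  and the determinant excludes the latter.\<close>

lemma psd_det_nonzero_imp_pos: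
  fixes S :: "real^'n \<Rightarrow> real^'n"
  assumes S: "linear S" and sym: "\<And>v w. v \<bullet> S w = w \<bullet> S v" and psd: "\<And>v. 0 \<le> v \<bullet> S v"
    and det: "det (matrix S) \<noteq> 0" and v: "v \<noteq> 0"
  shows "0 < v \<bullet> S v"
proof (rule ccontr)
  assume "\<not> ?thesis"
  with psd[of v] have v0: "v \<bullet> S v = 0" by simp
  define w where "w = S v"
  define q where "q = w \<bullet> w"
  define r where "r = w \<bullet> S w"
  have r: "0 \<le> r" using psd by (simp add: r_def)
  \<comment> \<open>The exact minimiser would be \<open>- q / r\<close>; the denominator
    \<open>r + 1\<close> avoids division by 0 and still makes the form negative when
    \<open>q\<close> is nonzero.\<close>
  define t where "t = - q / (r + 1)"
  have "0 \<le> (v + t *\<^sub>R w) \<bullet> S (v + t *\<^sub>R w)" by (rule psd)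
  also have "\<dots> = v \<bullet> S v + t * (v \<bullet> S w) + t * (w \<bullet> S v) + t * t * (w \<bullet> S w)"
    using S by (simp add: linear_add linear_scale inner_add_left inner_add_right algebra_simps)
  also have "\<dots> = 2 * t * q + t * t * r"
    using v0 sym[of v w] by (simp add: r_def q_def w_def)
  also have "\<dots> = - (q\<^sup>2 * (r + 2)) / (r + 1)\<^sup>2"
    using r by (simp add: t_def divide_simps power2_eq_square) (simp add: algebra_simps)
  finally have "q\<^sup>2 * (r + 2) \<le> 0" using r by (auto simp: zero_le_divide_iff divide_le_0_iff)
  then have "q = 0" using r by (simp add: mult_le_0_iff)
  then have "S v = 0" by (simp add: q_def w_def)
  moreover have "inj S" using det det_nz_iff_inj[OF S] by simp
  ultimately show False using v S by (metis injD linear_0)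
qed

text \<open>Gram-Schmidt without projections: the vectors \<open>S (b i)\<close> with
  \<open>i < m\<close> do not span the space, so some nonzero \<open>v\<close> is orthogonal to all
  of them, which means orthogonal to every \<open>b i\<close> with respect to the form.\<close>

lemma form_orthonormal_family:
  fixes S :: "'a::euclidean_space \<Rightarrow> 'a"
  assumes S: "linear S" and sym: "\<And>v w. v \<bullet> S w = w \<bullet> S v" and pos: "\<And>v. v \<noteq> 0 \<Longrightarrow> 0 < v \<bullet> S v"
    and m: "m \<le> DIM('a)"
  shows "\<exists>b::nat \<Rightarrow> 'a. \<forall>i<m. \<forall>j<m. b i \<bullet> S (b j) = (if i = j then 1 else 0)"
  using m
proof (induction m)
  case (Suc m)
  then obtain b :: "nat \<Rightarrow> 'a" where b: "\<And>i j. i < m \<Longrightarrow> j < m \<Longrightarrow> b i \<bullet> S (b j) = (if i = j then 1 else 0)"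
    by auto
  have "dim ((\<lambda>i. S (b i)) ` {..<m}) \<le> card ((\<lambda>i. S (b i)) ` {..<m})"
    by (rule dim_le_card') simp
  also have "\<dots> \<le> m" using card_image_le[of "{..<m}"] by simp
  finally have "dim ((\<lambda>i. S (b i)) ` {..<m}) < DIM('a)" using Suc.prems by simp
  then obtain v where v: "v \<noteq> 0" "\<And>y. y \<in> span ((\<lambda>i. S (b i)) ` {..<m}) \<Longrightarrow> orthogonal v y"
    using orthogonal_to_subspace_exists by metis
  have vb: "v \<bullet> S (b i) = 0" if "i < m" for i
    using v(2)[OF span_base] that by (auto simp: orthogonal_def)
  define c where "c = sqrt (v \<bullet> S v)"
  have c: "0 < c" "c * c = v \<bullet> S v" using pos[OF v(1)] by (auto simp: c_def)
  define b' where "b' = b(m := v /\<^sub>R c)"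
  have "b' i \<bullet> S (b' j) = (if i = j then 1 else 0)" if "i < Suc m" "j < Suc m" for i j
  proof -
    consider "i < m" "j < m" | "i = m" "j < m" | "i < m" "j = m" | "i = m" "j = m"
      using \<open>i < Suc m\<close> \<open>j < Suc m\<close> by linarith
    then show ?thesis
    proof cases
      case 1 then show ?thesis using b by (simp add: b'_def)
    next
      case 2 then show ?thesis using vb by (simp add: b'_def)
    next
      case 3 then show ?thesis using vb sym[of v "b i"] S by (simp add: b'_def linear_scale)
    next
      case 4 then show ?thesis using c S pos[OF v(1)] by (simp add: b'_def linear_scale field_simps)
    qed
  qed
  then show ?case by blast
qed simp

text \<open>\<open>B\<close> has form-orthonormal columns, so the transpose of \<open>B\<close>
  times \<open>S\<close> times \<open>B\<close> is the identity; taking determinants gives the last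
  claim.\<close>

lemma form_orthonormal_coordinates:
  fixes S :: "real^'n \<Rightarrow> real^'n"
  assumes S: "linear S" and sym: "\<And>v w. v \<bullet> S w = w \<bullet> S v" and pos: "\<And>v. v \<noteq> 0 \<Longrightarrow> 0 < v \<bullet> S v"
  obtains B where "linear B" "\<And>x y. B x \<bullet> S (B y) = x \<bullet> y" "(det (matrix B))\<^sup>2 * det (matrix S) = 1"
proof -
  obtain b :: "nat \<Rightarrow> real^'n" where b: "\<And>i j. i < CARD('n) \<Longrightarrow> j < CARD('n) \<Longrightarrow> b i \<bullet> S (b j) = (if i = j then 1 else 0)"
    using form_orthonormal_family[OF S sym pos, of "CARD('n)"] by auto
  obtain h :: "'n \<Rightarrow> nat" where h: "bij_betw h UNIV {0..<CARD('n)}"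
    using ex_bij_betw_finite_nat[of "UNIV :: 'n set"] by auto
  have hb: "b (h i) \<bullet> S (b (h j)) = (if i = j then 1 else 0)" for i j
  proof -
    have "h i < CARD('n)" "h j < CARD('n)" using h by (auto simp: bij_betw_def)
    moreover have "h i = h j \<longleftrightarrow> i = j" using h by (auto simp: bij_betw_def inj_on_def)
    ultimately show ?thesis using b by simp
  qed
  define B where "B x = (\<Sum>i\<in>UNIV. x $ i *\<^sub>R b (h i))" for x :: "real^'n"
  have B: "linear B"
    by (rule linearI) (simp_all add: B_def scaleR_add_left sum.distrib scaleR_sum_right)
  have BS: "B x \<bullet> S (B y) = x \<bullet> y" for x y
  proof -
    have "S (B y) = (\<Sum>j\<in>UNIV. y $ j *\<^sub>R S (b (h j)))"
      using S by (simp add: B_def linear_sum linear_scale)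
    then have "B x \<bullet> S (B y) = (\<Sum>i\<in>UNIV. \<Sum>j\<in>UNIV. x $ i * (y $ j * (b (h i) \<bullet> S (b (h j)))))"
      by (simp add: B_def inner_sum_left inner_sum_right sum_distrib_left mult_ac) (rule sum.swap)
    also have "\<dots> = x \<bullet> y" unfolding hb by (simp add: inner_vec_def if_distrib cong: if_cong)
    finally show ?thesis .
  qed
  have "(adjoint B \<circ> (S \<circ> B)) y = id y" for y
  proof -
    have "x \<bullet> (adjoint B \<circ> (S \<circ> B)) y = x \<bullet> y" for x
      using adjoint_works[OF B, of x "S (B y)"] BS by simp
    then show ?thesis using vector_eq_ldot by auto
  qed
  then have "adjoint B \<circ> (S \<circ> B) = id" by auto
  then have "matrix (adjoint B) ** (matrix S ** matrix B) = mat 1"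
    using B S adjoint_linear[OF B]
    by (metis matrix_compose linear_compose matrix_id_mat_1)
  then have "det (matrix (adjoint B)) * (det (matrix S) * det (matrix B)) = 1"
    by (metis det_I det_mul)
  then have "(det (matrix B))\<^sup>2 * det (matrix S) = 1"
    using B by (simp add: matrix_adjoint det_transpose power2_eq_square mult_ac)
  with that B BS show ?thesis by blast
qed

text \<open>The preimage of \<open>\<nu>\<close> under the coordinates just built is a unit vector,
  since \<open>\<nu> \<bullet> S \<nu> = 1\<close>, so a rotation can move \<open>e\<close> there.
  Then \<open>S \<nu> = \<nu>\<close> turns the Euclidean product with \<open>\<nu>\<close> into the
  form: heights in direction \<open>\<nu>\<close> are read off unchanged in the new
  coordinates.\<close>

lemma adapted_coordinates:
  fixes S :: "real^'n \<Rightarrow> real^'n"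
  assumes S: "linear S" and sym: "\<And>v w. v \<bullet> S w = w \<bullet> S v" and pos: "\<And>v. v \<noteq> 0 \<Longrightarrow> 0 < v \<bullet> S v"
    and \<nu>: "norm \<nu> = 1" "S \<nu> = \<nu>" and e: "norm e = 1"
  obtains B where "linear B" "\<And>x y. B x \<bullet> S (B y) = x \<bullet> y" "(det (matrix B))\<^sup>2 * det (matrix S) = 1"
    "B e = \<nu>" "\<And>z. B z \<bullet> \<nu> = z \<bullet> e"
proof -
  obtain B where B: "linear B" "\<And>x y. B x \<bullet> S (B y) = x \<bullet> y" "(det (matrix B))\<^sup>2 * det (matrix S) = 1"
    using form_orthonormal_coordinates[OF S sym pos] by metis
  have "det (matrix B) \<noteq> 0" using B(3) by auto
  then have "surj B" using det_nz_iff_inj[OF B(1)] linear_injective_imp_surjective[OF B(1)] by simp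
  then obtain z where z: "B z = \<nu>" by (metis surjD)
  have "z \<bullet> z = 1" using B(2)[of z z] \<nu> z by (simp add: norm_eq_1)
  then obtain f where f: "orthogonal_transformation f" "f e = z"
    using orthogonal_transformation_exists[of e z] e by (metis norm_eq_1)
  show ?thesis
  proof
    show "linear (B \<circ> f)" using B(1) f(1) orthogonal_transformation_linear linear_compose by blast
    show 1: "(B \<circ> f) x \<bullet> S ((B \<circ> f) y) = x \<bullet> y" for x y
      using f(1) by (simp add: B(2) orthogonal_transformation_def)
    show 2: "(B \<circ> f) e = \<nu>" using f z by simp
    show "(B \<circ> f) y \<bullet> \<nu> = y \<bullet> e" for y using 1[of y e] 2 \<nu> by simp
    have "(det (matrix f))\<^sup>2 = 1" using orthogonal_transformation_det[OF f(1)] by (simp add: abs_square_eq_1)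
    then show "(det (matrix (B \<circ> f)))\<^sup>2 * det (matrix S) = 1"
      using matrix_compose[OF orthogonal_transformation_linear[OF f(1)] B(1)] B(3)
      by (simp add: det_mul power_mult_distrib)
  qed
qed

section \<open>Second-order behaviour of a function with differentiable gradient\<close>

lemma DERIV_along_line:
  assumes "(g has_derivative (\<lambda>v. G \<bullet> v)) (at (p + \<tau> *\<^sub>R w))"
  shows "((\<lambda>\<tau>. g (p + \<tau> *\<^sub>R w)) has_real_derivative (G \<bullet> w)) (at \<tau>)"
proof -
  have "((\<lambda>\<tau>. p + \<tau> *\<^sub>R w) has_derivative (\<lambda>t. t *\<^sub>R w)) (at \<tau>)"
    by (auto intro!: derivative_eq_intros)
  from has_derivative_compose[OF this assms]
  show ?thesis by (simp add: has_field_derivative_def mult.commute[of _ "G \<bullet> w"] mult_commute_abs)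
qed

context
  fixes g :: "'a::euclidean_space \<Rightarrow> real" and G H :: "'a \<Rightarrow> 'a" and x :: 'a and U :: "'a set"
  assumes U: "open U" "x \<in> U"
    and g: "\<And>y. y \<in> U \<Longrightarrow> (g has_derivative (\<lambda>v. G y \<bullet> v)) (at y)"
    and G: "(G has_derivative H) (at x)"
begin

private lemma gradient_linear_approx:
  assumes "0 < \<epsilon>"
  obtains \<delta> where "0 < \<delta>" "\<And>w. norm w < \<delta> \<Longrightarrow> x + w \<in> U \<and> norm (G (x + w) - G x - H w) \<le> \<epsilon> * norm w"
proof -
  obtain d1 where d1: "0 < d1" "ball x d1 \<subseteq> U" using U open_contains_ball by blast
  obtain d2 where d2: "0 < d2" "\<And>y. norm (y - x) < d2 \<Longrightarrow> norm (G y - G x - H (y - x)) \<le> \<epsilon> * norm (y - x)"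
    using G assms unfolding has_derivative_at_alt by blast
  show ?thesis
  proof (rule that[of "min d1 d2"])
    fix w :: 'a assume w: "norm w < min d1 d2"
    then have "x + w \<in> ball x d1" by (simp add: dist_norm)
    with d1 d2(2)[of "x + w"] w show "x + w \<in> U \<and> norm (G (x + w) - G x - H w) \<le> \<epsilon> * norm w" by auto
  qed (use d1 d2 in auto)
qed

text \<open>The mean value theorem is applied along the segment to \<open>g\<close> minus its
  quadratic model; the derivative of this difference is the error in the linear approximation of
  \<open>G\<close>, paired with \<open>w\<close>, and hence of size
  \<open>\<epsilon> * (norm w)\<^sup>2\<close>.\<close>

lemma second_order_taylor:
  assumes "0 < \<epsilon>"
  shows "\<exists>\<delta>>0. \<forall>w. norm w < \<delta> \<longrightarrow> x + w \<in> U \<and> \<bar>g (x + w) - g x - G x \<bullet> w - (w \<bullet> H w) / 2\<bar> \<le> \<epsilon> * (norm w)\<^sup>2"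
proof -
  obtain \<delta> where \<delta>: "0 < \<delta>" "\<And>w. norm w < \<delta> \<Longrightarrow> x + w \<in> U \<and> norm (G (x + w) - G x - H w) \<le> \<epsilon> * norm w"
    using gradient_linear_approx[OF assms] by metis
  have H: "linear H" using G has_derivative_linear by blast
  have "\<bar>g (x + w) - g x - G x \<bullet> w - (w \<bullet> H w) / 2\<bar> \<le> \<epsilon> * (norm w)\<^sup>2" if w: "norm w < \<delta>" for w :: 'a
  proof -
    have small: "norm (\<tau> *\<^sub>R w) < \<delta>" if "0 \<le> \<tau>" "\<tau> \<le> 1" for \<tau>
      using that w by (smt (verit) mult_left_le_one_le norm_ge_zero norm_scaleR)
    let ?\<phi> = "\<lambda>\<tau>. g (x + \<tau> *\<^sub>R w) - \<tau> * (G x \<bullet> w) - \<tau>\<^sup>2 / 2 * (w \<bullet> H w)"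
    have "\<exists>\<xi>>0. \<xi> < 1 \<and> ?\<phi> 1 - ?\<phi> 0 = (1 - 0) * (G (x + \<xi> *\<^sub>R w) \<bullet> w - G x \<bullet> w - \<xi> * (w \<bullet> H w))"
    proof (rule MVT2)
      fix \<tau> :: real assume "0 \<le> \<tau>" "\<tau> \<le> 1"
      then have "x + \<tau> *\<^sub>R w \<in> U" using \<delta>(2)[OF small] by blast
      from DERIV_along_line[OF g[OF this]]
      show "DERIV ?\<phi> \<tau> :> G (x + \<tau> *\<^sub>R w) \<bullet> w - G x \<bullet> w - \<tau> * (w \<bullet> H w)"
        by (auto intro!: derivative_eq_intros)
    qed simp
    then obtain \<xi> where \<xi>: "0 < \<xi>" "\<xi> < 1" "?\<phi> 1 - ?\<phi> 0 = G (x + \<xi> *\<^sub>R w) \<bullet> w - G x \<bullet> w - \<xi> * (w \<bullet> H w)"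
      by auto
    have "g (x + w) - g x - G x \<bullet> w - (w \<bullet> H w) / 2 = ?\<phi> 1 - ?\<phi> 0" by simp
    also have "\<dots> = (G (x + \<xi> *\<^sub>R w) - G x - H (\<xi> *\<^sub>R w)) \<bullet> w"
      using H unfolding \<xi>(3) by (simp add: inner_diff_left linear_scale inner_commute[of w])
    finally have "\<bar>g (x + w) - g x - G x \<bullet> w - (w \<bullet> H w) / 2\<bar> \<le> norm (G (x + \<xi> *\<^sub>R w) - G x - H (\<xi> *\<^sub>R w)) * norm w"
      by (metis Cauchy_Schwarz_ineq2)
    also have "\<dots> \<le> (\<epsilon> * norm (\<xi> *\<^sub>R w)) * norm w"
      using \<delta>(2)[OF small, of \<xi>] \<xi> by (intro mult_right_mono) auto
    also have "\<dots> = \<xi> * (\<epsilon> * (norm w)\<^sup>2)" using \<xi> by (simp add: power2_eq_square)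
    also have "\<dots> \<le> \<epsilon> * (norm w)\<^sup>2" using \<xi> assms by (intro mult_left_le_one_le) auto
    finally show ?thesis .
  qed
  with \<delta> show ?thesis by blast
qed

text \<open>By the mean value theorem the second difference of \<open>g\<close> in the directions \<open>v\<close> and \<open>w\<close> is
  approximately \<open>s\<^sup>2 * (w \<bullet> H v)\<close>, and it is symmetric in \<open>v\<close> and \<open>w\<close>.\<close>

lemma second_derivative_symmetric:
  fixes v w :: 'a
  shows "v \<bullet> H w = w \<bullet> H v"
proof -
  have H: "linear H" using G has_derivative_linear by blast
  have bound: "\<bar>w \<bullet> H v - v \<bullet> H w\<bar> \<le> \<epsilon> * (4 * (norm v + norm w + 1)\<^sup>2)" if \<epsilon>: "0 < \<epsilon>" for \<epsilon>
  proof -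
    obtain \<delta> where \<delta>: "0 < \<delta>" "\<And>w. norm w < \<delta> \<Longrightarrow> x + w \<in> U \<and> norm (G (x + w) - G x - H w) \<le> \<epsilon> * norm w"
      using gradient_linear_approx[OF \<epsilon>] by metis
    define L where "L = norm v + norm w + 1"
    have L: "1 \<le> L" by (simp add: L_def)
    \<comment> \<open>Makes \<open>s * L\<close> equal to \<open>\<delta> / 2\<close>, so that all
      points of the second difference lie where the linear approximation of \<open>G\<close>
      holds.\<close>
    define s where "s = \<delta> / (2 * L)"
    have s: "0 < s" using \<delta> L by (simp add: s_def)
    have sL: "s * L < \<delta>" using \<delta> L by (simp add: s_def)
    define D where "D = g (x + s *\<^sub>R v + s *\<^sub>R w) - g (x + s *\<^sub>R v) - g (x + s *\<^sub>R w) + g x"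
    \<comment> \<open>Stated for fresh \<open>v\<close> and \<open>w\<close> because it is applied a
      second time with the two exchanged; \<open>D\<close> and \<open>L\<close> are symmetric in
      them.\<close>
    have key: "\<bar>D - s\<^sup>2 * (w \<bullet> H v)\<bar> \<le> 2 * \<epsilon> * s\<^sup>2 * L\<^sup>2"
      if vw: "norm v + norm w + 1 = L"
        and Dd: "D = g (x + s *\<^sub>R v + s *\<^sub>R w) - g (x + s *\<^sub>R v) - g (x + s *\<^sub>R w) + g x" for v w :: 'a
    proof -
      have b1: "norm (s *\<^sub>R v + (\<tau> * s) *\<^sub>R w) \<le> s * L" "norm ((\<tau> * s) *\<^sub>R w) \<le> s * L"
        if "0 \<le> \<tau>" "\<tau> \<le> 1" for \<tau>
      proof -
        have t: "norm ((\<tau> * s) *\<^sub>R w) \<le> s * norm w"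
          using that s by (simp add: abs_mult mult_left_le_one_le mult.assoc)
        have "s * norm w \<le> s * L" "s * norm v + s * norm w \<le> s * L"
          using s unfolding vw[symmetric] distrib_left by simp_all
        moreover have "norm (s *\<^sub>R v + (\<tau> * s) *\<^sub>R w) \<le> s * norm v + norm ((\<tau> * s) *\<^sub>R w)"
          using norm_triangle_ineq[of "s *\<^sub>R v" "(\<tau> * s) *\<^sub>R w"] s by simp
        ultimately show "norm (s *\<^sub>R v + (\<tau> * s) *\<^sub>R w) \<le> s * L" "norm ((\<tau> * s) *\<^sub>R w) \<le> s * L"
          using t by linarith+
      qed
      let ?\<psi> = "\<lambda>\<tau>. g ((x + s *\<^sub>R v) + \<tau> *\<^sub>R (s *\<^sub>R w)) - g (x + \<tau> *\<^sub>R (s *\<^sub>R w))"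
      have "\<exists>\<xi>>0. \<xi> < 1 \<and> ?\<psi> 1 - ?\<psi> 0 = (1 - 0) *
          (G ((x + s *\<^sub>R v) + \<xi> *\<^sub>R (s *\<^sub>R w)) \<bullet> (s *\<^sub>R w) - G (x + \<xi> *\<^sub>R (s *\<^sub>R w)) \<bullet> (s *\<^sub>R w))"
      proof (rule MVT2)
        fix \<tau> :: real assume \<tau>: "0 \<le> \<tau>" "\<tau> \<le> 1"
        have "x + (s *\<^sub>R v + (\<tau> * s) *\<^sub>R w) \<in> U" "x + (\<tau> * s) *\<^sub>R w \<in> U"
          using \<delta>(2) b1[OF \<tau>] sL by (meson order_le_less_trans)+
        then have "(x + s *\<^sub>R v) + \<tau> *\<^sub>R (s *\<^sub>R w) \<in> U" "x + \<tau> *\<^sub>R (s *\<^sub>R w) \<in> U" by (simp_all add: add.assoc)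
        then show "DERIV ?\<psi> \<tau> :> G ((x + s *\<^sub>R v) + \<tau> *\<^sub>R (s *\<^sub>R w)) \<bullet> (s *\<^sub>R w) - G (x + \<tau> *\<^sub>R (s *\<^sub>R w)) \<bullet> (s *\<^sub>R w)"
          by (intro DERIV_diff DERIV_along_line g)
      qed simp
      then obtain \<xi> where \<xi>: "0 \<le> \<xi>" "\<xi> \<le> 1" and eq: "?\<psi> 1 - ?\<psi> 0 =
          (G ((x + s *\<^sub>R v) + \<xi> *\<^sub>R (s *\<^sub>R w)) \<bullet> (s *\<^sub>R w) - G (x + \<xi> *\<^sub>R (s *\<^sub>R w)) \<bullet> (s *\<^sub>R w))"
        by (metis (no_types, lifting) less_imp_le diff_zero mult_1)
      define p where "p = s *\<^sub>R v + (\<xi> * s) *\<^sub>R w"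
      define q where "q = (\<xi> * s) *\<^sub>R w"
      have "D = (G (x + p) - G (x + q)) \<bullet> (s *\<^sub>R w)"
        using eq unfolding Dd p_def q_def by (simp add: algebra_simps inner_diff_left)
      note Deq = this
      have "H (p - q) = s *\<^sub>R H v" using H by (simp add: p_def q_def linear_scale)
      then have Hpq: "H p - H q = s *\<^sub>R H v" using H by (simp add: linear_diff)
      have "D - s\<^sup>2 * (w \<bullet> H v) = ((G (x + p) - G x - H p) - (G (x + q) - G x - H q)) \<bullet> (s *\<^sub>R w)"
      proof -
        have "((G (x + p) - G x - H p) - (G (x + q) - G x - H q)) = (G (x + p) - G (x + q)) - (H p - H q)"
          by (simp add: algebra_simps)
        then show ?thesis unfolding Deq Hpq
          by (simp only: inner_diff_left inner_scaleR_left inner_scaleR_right power2_eq_square inner_commute[of _ w])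
             (simp only: inner_diff_right inner_scaleR_right, simp add: algebra_simps)
      qed
      also have "\<bar>\<dots>\<bar> \<le> norm ((G (x + p) - G x - H p) - (G (x + q) - G x - H q)) * norm (s *\<^sub>R w)"
        by (rule Cauchy_Schwarz_ineq2)
      also have "\<dots> \<le> (2 * \<epsilon> * (s * L)) * (s * L)"
      proof (rule mult_mono)
        have pq: "norm p \<le> s * L" "norm q \<le> s * L" using b1[OF \<xi>] by (auto simp: p_def q_def)
        have "norm (G (x + p) - G x - H p) \<le> \<epsilon> * norm p" "norm (G (x + q) - G x - H q) \<le> \<epsilon> * norm q"
          using \<delta>(2) pq sL by (meson order_le_less_trans)+
        moreover have "\<epsilon> * norm p \<le> \<epsilon> * (s * L)" "\<epsilon> * norm q \<le> \<epsilon> * (s * L)"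
          using pq \<epsilon> by (auto intro: mult_left_mono)
        ultimately show "norm ((G (x + p) - G x - H p) - (G (x + q) - G x - H q)) \<le> 2 * \<epsilon> * (s * L)"
          using norm_triangle_ineq4[of "G (x + p) - G x - H p" "G (x + q) - G x - H q"] by linarith
        show "norm (s *\<^sub>R w) \<le> s * L" using b1(2)[of 1] by simp
      qed (use \<epsilon> s L in auto)
      finally show ?thesis by (simp add: power2_eq_square mult_ac)
    qed
    have "\<bar>D - s\<^sup>2 * (w \<bullet> H v)\<bar> \<le> 2 * \<epsilon> * s\<^sup>2 * L\<^sup>2" by (rule key) (auto simp: L_def D_def)
    moreover have "\<bar>D - s\<^sup>2 * (v \<bullet> H w)\<bar> \<le> 2 * \<epsilon> * s\<^sup>2 * L\<^sup>2"
      by (rule key) (auto simp: L_def D_def algebra_simps)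
    ultimately have "\<bar>s\<^sup>2 * (w \<bullet> H v) - s\<^sup>2 * (v \<bullet> H w)\<bar> \<le> s\<^sup>2 * (\<epsilon> * (4 * L\<^sup>2))" by (simp add: mult_ac)
    then have "s\<^sup>2 * \<bar>w \<bullet> H v - v \<bullet> H w\<bar> \<le> s\<^sup>2 * (\<epsilon> * (4 * L\<^sup>2))"
      by (simp add: right_diff_distrib[symmetric] abs_mult)
    then show ?thesis using s by (simp add: L_def)
  qed
  have "\<bar>w \<bullet> H v - v \<bullet> H w\<bar> \<le> 0"
  proof (rule field_le_epsilon)
    fix e :: real assume e: "0 < e"
    let ?C = "4 * (norm v + norm w + 1)\<^sup>2"
    have "0 < norm v + norm w + 1" by (simp add: add_nonneg_pos)
    then have C: "0 < ?C" by simp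
    have "\<bar>w \<bullet> H v - v \<bullet> H w\<bar> \<le> (e / ?C) * ?C" using e C by (intro bound divide_pos_pos)
    also have "\<dots> = e" using C by simp
    finally show "\<bar>w \<bullet> H v - v \<bullet> H w\<bar> \<le> 0 + e" by simp
  qed
  then show ?thesis by simp
qed

end

section \<open>Boundary points of class \<open>C\<^sup>2\<close>\<close>

definition tangent_part :: "'a::real_inner \<Rightarrow> 'a \<Rightarrow> 'a" where
  "tangent_part \<nu> w = w - (w \<bullet> \<nu>) *\<^sub>R \<nu>"

lemma linear_tangent_part: "linear (tangent_part \<nu>)"
  by (rule linearI) (simp_all add: tangent_part_def inner_add_left algebra_simps)

lemma shape_ext_eq:
  "shape_ext a B v = (1 / norm a) *\<^sub>R tangent_part (a /\<^sub>R norm a) (B (tangent_part (a /\<^sub>R norm a) v))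
     + (v \<bullet> (a /\<^sub>R norm a)) *\<^sub>R (a /\<^sub>R norm a)"
  by (simp add: shape_ext_def Let_def tangent_part_def)

lemma linear_shape_ext: "linear B \<Longrightarrow> linear (shape_ext a B)"
proof (rule linearI)
  assume B: "linear B"
  note l = linear_add[OF B] linear_scale[OF B] linear_add[OF linear_tangent_part] linear_scale[OF linear_tangent_part]
  show "shape_ext a B (x + y) = shape_ext a B x + shape_ext a B y" for x y
    unfolding shape_ext_eq by (simp add: l inner_add_left algebra_simps)
  show "shape_ext a B (c *\<^sub>R x) = c *\<^sub>R shape_ext a B x" for c x
    unfolding shape_ext_eq by (simp add: l algebra_simps)
qed

lemma inner_shape_ext:
  fixes a :: "real^'n"
  defines "\<nu> \<equiv> a /\<^sub>R norm a"
  assumes "a \<noteq> 0"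
  shows "w \<bullet> shape_ext a B v = (tangent_part \<nu> w \<bullet> B (tangent_part \<nu> v)) / norm a + (w \<bullet> \<nu>) * (v \<bullet> \<nu>)"
proof -
  have "w \<bullet> tangent_part \<nu> z = tangent_part \<nu> w \<bullet> z" for z
    by (simp add: tangent_part_def inner_diff_left inner_diff_right inner_commute)
  then show ?thesis unfolding shape_ext_eq \<nu>_def[symmetric]
    by (simp add: inner_add_right)
qed

lemma shape_ext_normal:
  fixes a :: "real^'n"
  assumes "a \<noteq> 0" "linear B"
  shows "shape_ext a B (a /\<^sub>R norm a) = a /\<^sub>R norm a"
proof -
  have n: "(a /\<^sub>R norm a) \<bullet> (a /\<^sub>R norm a) = 1" using assms by (intro norm_eq_1[THEN iffD1]) simp
  then have "tangent_part (a /\<^sub>R norm a) (a /\<^sub>R norm a) = 0" unfolding tangent_part_def by simp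
  then show ?thesis unfolding shape_ext_eq n
    using linear_0[OF assms(2)] linear_0[OF linear_tangent_part, of "a /\<^sub>R norm a"] by simp
qed

lemma unit_vectors_eqI:
  fixes a b :: "'a::real_inner"
  assumes "norm a = 1" "norm b = 1" "1 \<le> a \<bullet> b" shows "a = b"
proof -
  have "(norm (a - b))\<^sup>2 = 2 - 2 * (a \<bullet> b)"
    using assms(1,2) unfolding power2_norm_eq_inner norm_eq_1
    by (simp add: inner_diff_left inner_diff_right inner_commute)
  also have "\<dots> \<le> 0" using assms by simp
  finally show ?thesis by simp
qed

text \<open>The local data are parameters because \<open>outer_normal\<close> and
  \<open>gauss_curvature\<close> obtain theirs from separate uses of \<open>SOME\<close>, and
  because data given at one boundary point are reused at its neighbours.\<close>

locale C2_boundary_point =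
  fixes K :: "(real^'n) set" and x :: "real^'n" and U g G H
  assumes compact: "compact K" and convex: "convex K" and frontier: "x \<in> frontier K"
    and loc: "local_C2_defining K x U g G H"
begin

definition "\<nu> = G x /\<^sub>R norm (G x)"

lemma U: "open U" "x \<in> U"
  and g: "y \<in> U \<Longrightarrow> (g has_derivative (\<lambda>v. G y \<bullet> v)) (at y)"
  and G: "y \<in> U \<Longrightarrow> (G has_derivative blinfun_apply (H y)) (at y)"
  and G0: "y \<in> U \<Longrightarrow> G y \<noteq> 0"
  and K_iff: "y \<in> U \<Longrightarrow> y \<in> K \<longleftrightarrow> g y \<le> 0"
  and H_cont: "continuous_on U H"
  using loc unfolding local_C2_defining_def by blast+

lemma norm_normal: "norm \<nu> = 1" using G0[OF U(2)] by (simp add: \<nu>_def)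

lemma G_eq: "G x = norm (G x) *\<^sub>R \<nu>" using G0[OF U(2)] by (simp add: \<nu>_def)

lemma x_mem: "x \<in> K"
  using frontier compact frontier_subset_closed compact_imp_closed by blast

lemma continuous_g: "continuous_on U g"
  using g has_derivative_continuous U by (metis continuous_at_imp_continuous_on)

lemma neg_interior: assumes "y \<in> U" "g y < 0" shows "y \<in> interior K"
proof (rule interiorI)
  have "open (U \<inter> g -` {..<0})" by (rule continuous_open_preimage[OF continuous_g U(1)]) simp
  then show "open (U \<inter> g -` {..<0})" .
  show "y \<in> U \<inter> g -` {..<0}" using assms by simp
  show "U \<inter> g -` {..<0} \<subseteq> K" using K_iff by auto
qed

lemma g_zero: "g x = 0"
proof -
  have "\<not> g x < 0" using neg_interior[OF U(2)] frontier by (auto simp: frontier_def)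
  moreover have "g x \<le> 0" using K_iff[OF U(2)] x_mem by simp
  ultimately show ?thesis by simp
qed

lemma line_in_U: "\<exists>d>0. \<forall>h. 0 < h \<and> h < d \<longrightarrow> x + h *\<^sub>R v \<in> U"
proof -
  obtain e where e: "0 < e" "ball x e \<subseteq> U" using U open_contains_ball by blast
  show ?thesis
  proof (intro exI[of _ "e / (norm v + 1)"] conjI allI impI)
    show "0 < e / (norm v + 1)" using e by (simp add: add_nonneg_pos)
    fix h assume h: "0 < h \<and> h < e / (norm v + 1)"
    have p: "0 < norm v + 1" by (simp add: add_nonneg_pos)
    have "h * (norm v + 1) < e" using h p by (simp add: pos_less_divide_eq)
    then have "norm (h *\<^sub>R v) < e" using h by (simp add: algebra_simps)
    then show "x + h *\<^sub>R v \<in> U" using e by (auto simp: dist_norm)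
  qed
qed

lemma deriv_line: "((\<lambda>t. g (x + t *\<^sub>R v)) has_real_derivative (G x \<bullet> v)) (at 0)"
  using DERIV_along_line[of g "G x" x 0 v] g[OF U(2)] by simp

text \<open>If the product were positive, \<open>g\<close> would be positive just after
  \<open>x\<close> on the segment to \<open>y\<close>, yet convexity keeps this segment in
  \<open>K\<close>.\<close>

lemma normal_supports: assumes "y \<in> K" shows "G x \<bullet> (y - x) \<le> 0"
proof (rule ccontr)
  assume "\<not> ?thesis"
  then obtain d1 where d1: "0 < d1" "\<And>h. 0 < h \<Longrightarrow> h < d1 \<Longrightarrow> 0 < g (x + h *\<^sub>R (y - x))"
    using DERIV_pos_inc_right[OF deriv_line[of "y - x"]] g_zero by auto
  obtain d2 where d2: "0 < d2" "\<And>h. 0 < h \<Longrightarrow> h < d2 \<Longrightarrow> x + h *\<^sub>R (y - x) \<in> U"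
    using line_in_U[of "y - x"] by auto
  define h where "h = min (min d1 d2) 1 / 2"
  have h: "0 < h" "h < d1" "h < d2" "h < 1" using d1(1) d2(1) by (auto simp: h_def min_def)
  have "(1 - h) *\<^sub>R x + h *\<^sub>R y \<in> K"
    using convex x_mem assms h by (intro convexD) auto
  then have "x + h *\<^sub>R (y - x) \<in> K" by (simp add: algebra_simps)
  then show False using d1(2)[OF h(1,2)] d2(2)[OF h(1,3)] K_iff by fastforce
qed

lemma normal_supports': assumes "y \<in> K" shows "(y - x) \<bullet> \<nu> \<le> 0"
  using normal_supports[OF assms] by (simp add: \<nu>_def inner_commute mult_nonneg_nonpos)

lemma normal_strict_interior: assumes "y \<in> interior K" shows "(y - x) \<bullet> \<nu> < 0"
proof -
  obtain e where e: "0 < e" "ball y e \<subseteq> K" using assms mem_interior by blast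
  have "y + (e / 2) *\<^sub>R \<nu> \<in> K" using e norm_normal by (intro subsetD[OF e(2)]) (simp add: dist_norm)
  from normal_supports'[OF this] have "(y - x) \<bullet> \<nu> + (e / 2) * (\<nu> \<bullet> \<nu>) \<le> 0"
    by (simp add: inner_add_left inner_diff_left)
  moreover have "\<nu> \<bullet> \<nu> = 1" using norm_normal norm_eq_1 by blast
  ultimately show ?thesis using e by simp
qed

text \<open>If \<open>a\<close> differs from \<open>\<nu>\<close>, moving from \<open>x\<close>
  along \<open>a - \<nu>\<close> strictly decreases \<open>g\<close> and so remains in
  \<open>K\<close> for a while, but it strictly increases the height over \<open>a\<close>.
  Consequently the normal is the same for all choices of local data.\<close>

lemma supporting_unique:
  assumes a: "norm a = 1" "\<And>y. y \<in> K \<Longrightarrow> (y - x) \<bullet> a \<le> 0"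
  shows "a = \<nu>"
proof (rule ccontr)
  assume ne: "a \<noteq> \<nu>"
  then have lt: "a \<bullet> \<nu> < 1" using unit_vectors_eqI[OF a(1) norm_normal] by fastforce
  have nn: "\<nu> \<bullet> \<nu> = 1" "a \<bullet> a = 1" using norm_normal a(1) norm_eq_1 by blast+
  define v where "v = a - \<nu>"
  have "G x \<bullet> v = norm (G x) * (\<nu> \<bullet> v)" using G_eq by (metis inner_scaleR_left)
  moreover have "\<nu> \<bullet> v < 0" using lt nn by (simp only: v_def inner_diff_right inner_commute[of \<nu> a])
  ultimately have "G x \<bullet> v < 0" using G0[OF U(2)] by (simp add: mult_pos_neg)
  then obtain d1 where d1: "0 < d1" "\<And>h. 0 < h \<Longrightarrow> h < d1 \<Longrightarrow> g (x + h *\<^sub>R v) < 0"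
    using DERIV_neg_dec_right[OF deriv_line[of v]] g_zero by auto
  obtain d2 where d2: "0 < d2" "\<And>h. 0 < h \<Longrightarrow> h < d2 \<Longrightarrow> x + h *\<^sub>R v \<in> U"
    using line_in_U[of v] by auto
  define h where "h = min d1 d2 / 2"
  have h: "0 < h" "h < d1" "h < d2" using d1(1) d2(1) by (auto simp: h_def min_def)
  have "x + h *\<^sub>R v \<in> K" using d1(2)[OF h(1,2)] d2(2)[OF h(1,3)] K_iff by fastforce
  from a(2)[OF this] have "h * (v \<bullet> a) \<le> 0" by simp
  then have "v \<bullet> a \<le> 0" using h by (simp add: mult_le_0_iff)
  then show False using lt nn by (simp only: v_def inner_diff_left inner_commute[of \<nu> a])
qed

lemma taylor:
  assumes "0 < \<epsilon>"
  shows "\<exists>\<delta>>0. \<forall>w. norm w < \<delta> \<longrightarrow> x + w \<in> U \<and>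
    \<bar>g (x + w) - G x \<bullet> w - (w \<bullet> H x w) / 2\<bar> \<le> \<epsilon> * (norm w)\<^sup>2"
  using second_order_taylor[OF U g G[OF U(2)] assms] g_zero by simp

lemma hessian_symmetric: "v \<bullet> H x w = w \<bullet> H x v"
  by (rule second_derivative_symmetric[OF U g G[OF U(2)]])

text \<open>A tangential direction of negative second derivative would lead to interior points of
  \<open>K\<close> on the tangent hyperplane, contrary to
  \<open>normal_strict_interior\<close>.\<close>

lemma hessian_psd:
  assumes "w \<bullet> \<nu> = 0" shows "0 \<le> w \<bullet> H x w"
proof (rule ccontr)
  assume "\<not> ?thesis"
  then have neg: "w \<bullet> H x w < 0" by simp
  define c where "c = - (w \<bullet> H x w)"
  have c: "0 < c" using neg by (simp add: c_def)
  have "w \<noteq> 0" using neg by auto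
  then have nw: "0 < norm w" by simp
  \<comment> \<open>With this value the Taylor error is half of the quadratic gain
    \<open>s\<^sup>2 * c / 2\<close>.\<close>
  define \<epsilon> where "\<epsilon> = c / (4 * (norm w)\<^sup>2)"
  have "0 < \<epsilon>" using c nw by (simp add: \<epsilon>_def)
  then obtain \<delta> where \<delta>: "0 < \<delta>" "\<And>w. norm w < \<delta> \<Longrightarrow> x + w \<in> U \<and>
    \<bar>g (x + w) - G x \<bullet> w - (w \<bullet> H x w) / 2\<bar> \<le> \<epsilon> * (norm w)\<^sup>2"
    using taylor by meson
  define s where "s = \<delta> / (2 * norm w)"
  have s: "0 < s" "norm (s *\<^sub>R w) < \<delta>" using \<delta> nw by (auto simp: s_def)
  have "G x \<bullet> w = 0" using assms G_eq by (metis inner_commute inner_scaleR_right mult_zero_right)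
  then have "\<bar>g (x + s *\<^sub>R w) + s\<^sup>2 * c / 2\<bar> \<le> \<epsilon> * (norm (s *\<^sub>R w))\<^sup>2"
    using \<delta>(2)[OF s(2)] by (simp add: c_def blinfun.scaleR_right power2_eq_square mult.assoc)
  also have "\<dots> = s\<^sup>2 * c / 4" using nw by (simp add: \<epsilon>_def power_mult_distrib)
  finally have "g (x + s *\<^sub>R w) \<le> - (s\<^sup>2 * c / 4)" by linarith
  moreover have "0 < s\<^sup>2 * c / 4" using s c by simp
  ultimately have "g (x + s *\<^sub>R w) < 0" by linarith
  then have "x + s *\<^sub>R w \<in> interior K" using \<delta>(2)[OF s(2)] neg_interior by blast
  from normal_strict_interior[OF this] have "s * (w \<bullet> \<nu>) < 0" by simp
  then show False using assms by simp
qed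

abbreviation "S \<equiv> shape_ext (G x) (blinfun_apply (H x))"

lemma inner_S:
  "w \<bullet> S v = (tangent_part \<nu> w \<bullet> H x (tangent_part \<nu> v)) / norm (G x) + (w \<bullet> \<nu>) * (v \<bullet> \<nu>)"
  using inner_shape_ext[OF G0[OF U(2)], folded \<nu>_def] .

lemma linear_S: "linear S"
  by (rule linear_shape_ext) (simp add: bounded_linear.linear blinfun.bounded_linear_right)

lemma S_symmetric: "v \<bullet> S w = w \<bullet> S v"
  unfolding inner_S by (simp add: hessian_symmetric[of "tangent_part \<nu> v"] mult.commute)

lemma S_normal: "S \<nu> = \<nu>"
  by (rule shape_ext_normal[OF G0[OF U(2)], folded \<nu>_def]) (simp add: bounded_linear.linear blinfun.bounded_linear_right)

lemma tangent_part_orthogonal: "tangent_part \<nu> v \<bullet> \<nu> = 0"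
proof -
  have "\<nu> \<bullet> \<nu> = 1" using norm_normal norm_eq_1 by blast
  then show ?thesis unfolding tangent_part_def inner_diff_left inner_scaleR_left[of _ \<nu>] by simp
qed

lemma S_psd: "0 \<le> v \<bullet> S v"
  unfolding inner_S
  using hessian_psd[OF tangent_part_orthogonal, of v] by simp

text \<open>Here \<open>z \<bullet> e\<close> is the height over the tangent plane and
  \<open>(norm z)\<^sup>2 - (z \<bullet> e)\<^sup>2\<close> the tangential part of the squared norm.
  The error is stated in terms of these two quantities because both can be absorbed by changing the
  coefficient of the paraboloid slightly.\<close>

lemma normal_expansion:
  fixes B :: "real^'n \<Rightarrow> real^'n"
  assumes B: "linear B" and BS: "\<And>z z'. B z \<bullet> S (B z') = z \<bullet> z'" and Be: "\<And>z. B z \<bullet> \<nu> = z \<bullet> e"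
    and \<eta>: "0 < \<eta>"
  shows "\<exists>r>0. \<forall>z. norm z < r \<longrightarrow> x + B z \<in> U \<and>
    \<bar>g (x + B z) / norm (G x) - z \<bullet> e - ((norm z)\<^sup>2 - (z \<bullet> e)\<^sup>2) / 2\<bar>
      \<le> \<eta> * ((norm z)\<^sup>2 - (z \<bullet> e)\<^sup>2 + \<bar>z \<bullet> e\<bar>)"
proof -
  define N where "N = norm (G x)"
  have N: "0 < N" using G0[OF U(2)] by (simp add: N_def)
  obtain b where b: "0 < b" "\<And>z. norm (B z) \<le> norm z * b"
    using bounded_linear.pos_bounded[OF B[unfolded linear_conv_bounded_linear]] by blast
  define h where "h = norm (H x) + 1"
  have h: "0 < h" by (simp add: h_def add_nonneg_pos)
  have Hh: "\<bar>v \<bullet> H x w\<bar> \<le> h * norm v * norm w" for v w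
  proof -
    have "\<bar>v \<bullet> H x w\<bar> \<le> norm v * norm (H x w)" by (rule Cauchy_Schwarz_ineq2)
    also have "\<dots> \<le> norm v * (norm (H x) * norm w)" by (intro mult_left_mono norm_blinfun) auto
    also have "\<dots> \<le> norm v * (h * norm w)" by (intro mult_left_mono mult_right_mono) (auto simp: h_def)
    finally show ?thesis by (simp add: mult_ac)
  qed
  define \<epsilon> where "\<epsilon> = \<eta> * N / (2 * b\<^sup>2)"
  have "0 < \<epsilon>" using \<eta> N b by (simp add: \<epsilon>_def)
  then obtain \<delta> where \<delta>: "0 < \<delta>" "\<And>w. norm w < \<delta> \<Longrightarrow> x + w \<in> U \<and>
    \<bar>g (x + w) - G x \<bullet> w - (w \<bullet> H x w) / 2\<bar> \<le> \<epsilon> * (norm w)\<^sup>2"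
    using taylor by meson
  \<comment> \<open>The three bounds serve, in turn, to get
    \<open>m\<^sup>2 \<le> \<bar>m\<bar>\<close>, to stay in the Taylor neighbourhood, and to make
    the contribution of the Hessian terms with a normal factor at most
    \<open>\<eta> * N / 2 * \<bar>m\<bar>\<close>.\<close>
  define r where "r = min 1 (min (\<delta> / b) (\<eta> * N / (2 * h * b)))"
  have r: "0 < r" "r \<le> 1" "r \<le> \<delta> / b" "r \<le> \<eta> * N / (2 * h * b)"
    using \<delta> b \<eta> N h by (auto simp: r_def)
  show ?thesis
  proof (intro exI[of _ r] conjI allI impI)
    fix z :: "real^'n" assume z: "norm z < r"
    define w where "w = B z"
    define m where "m = z \<bullet> e"
    define q where "q = (norm z)\<^sup>2 - m\<^sup>2"
    define p where "p = tangent_part \<nu> w"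
    have wm: "w \<bullet> \<nu> = m" by (simp add: w_def m_def Be)
    have wp: "w = p + m *\<^sub>R \<nu>" by (simp add: p_def tangent_part_def wm)
    have nwb: "norm w \<le> norm z * b" using b by (simp add: w_def)
    also have "norm z * b < r * b" using z b by simp
    also have "r * b \<le> \<delta>" using r(3) b by (simp add: pos_le_divide_eq)
    finally have "norm w < \<delta>" .
    from \<delta>(2)[OF this] have wU: "x + w \<in> U"
      and T: "\<bar>g (x + w) - G x \<bullet> w - (w \<bullet> H x w) / 2\<bar> \<le> \<epsilon> * (norm w)\<^sup>2" by auto
    show "x + B z \<in> U" using wU by (simp add: w_def)
    have Gw: "G x \<bullet> w = N * m"
      using wm G_eq unfolding N_def by (metis inner_commute inner_scaleR_right)
    have "z \<bullet> z = w \<bullet> S w" by (simp add: w_def BS)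
    also have "\<dots> = (p \<bullet> H x p) / N + m * m"
      unfolding inner_S wm p_def N_def ..
    finally have q: "q = (p \<bullet> H x p) / N" by (simp add: q_def power2_norm_eq_inner power2_eq_square[of m])
    have pn: "norm p \<le> norm w"
    proof -
      have "(norm w)\<^sup>2 = (norm p)\<^sup>2 + m\<^sup>2"
      proof -
        have "p \<bullet> \<nu> = 0" unfolding p_def by (rule tangent_part_orthogonal)
        moreover have "\<nu> \<bullet> \<nu> = 1" using norm_normal norm_eq_1 by blast
        ultimately show ?thesis unfolding power2_norm_eq_inner wp
          by (simp only: inner_add_left inner_add_right inner_scaleR_left[of m] inner_scaleR_right[of _ m] inner_commute[of \<nu> p])
             (simp add: power2_eq_square)
      qed
      then have "(norm p)\<^sup>2 \<le> (norm w)\<^sup>2" using zero_le_power2[of m] by linarith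
      then show ?thesis by (rule power2_le_imp_le) (rule norm_ge_zero)
    qed
    \<comment> \<open>The difference collects the terms with at least one normal factor
      \<open>m *\<^sub>R \<nu>\<close>; they are small compared with \<open>m\<close> because
      \<open>w\<close> is small. The purely tangential term is exactly \<open>N * q\<close>.\<close>
    have "w \<bullet> H x w - p \<bullet> H x p = (m *\<^sub>R \<nu>) \<bullet> H x w + p \<bullet> H x (m *\<^sub>R \<nu>)"
    proof -
      have "w \<bullet> H x w = p \<bullet> H x w + (m *\<^sub>R \<nu>) \<bullet> H x w" by (metis wp inner_add_left)
      moreover have "p \<bullet> H x w = p \<bullet> H x p + p \<bullet> H x (m *\<^sub>R \<nu>)"
        by (metis wp blinfun.add_right inner_add_right)
      ultimately show ?thesis by simp
    qed
    also have "\<bar>\<dots>\<bar> \<le> \<bar>(m *\<^sub>R \<nu>) \<bullet> H x w\<bar> + \<bar>p \<bullet> H x (m *\<^sub>R \<nu>)\<bar>" by (rule abs_triangle_ineq)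
    also have "\<dots> \<le> h * norm (m *\<^sub>R \<nu>) * norm w + h * norm p * norm (m *\<^sub>R \<nu>)"
      by (intro add_mono Hh)
    also have "\<dots> = h * \<bar>m\<bar> * norm w + h * norm p * \<bar>m\<bar>"
      using norm_normal by (simp only: norm_scaleR)
    also have "\<dots> \<le> h * \<bar>m\<bar> * norm w + h * norm w * \<bar>m\<bar>"
      using pn h by (intro add_left_mono mult_right_mono mult_left_mono) auto
    finally have X: "\<bar>w \<bullet> H x w - p \<bullet> H x p\<bar> \<le> 2 * (h * norm w * \<bar>m\<bar>)" by (simp add: mult_ac)
    have X2: "h * norm w * \<bar>m\<bar> \<le> \<eta> * N / 2 * \<bar>m\<bar>"
    proof (rule mult_right_mono)
      have "norm z * b \<le> r * b" using z b by (intro mult_right_mono) auto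
      then have "h * norm w \<le> h * (r * b)" using nwb h by (intro mult_left_mono) auto
      also have "\<dots> \<le> \<eta> * N / 2" using r(4) h b by (simp add: pos_le_divide_eq mult_ac)
      finally show "h * norm w \<le> \<eta> * N / 2" .
    qed simp
    have "m\<^sup>2 \<le> \<bar>m\<bar>"
    proof -
      have "\<bar>m\<bar> \<le> 1"
      proof -
        show ?thesis
        proof -
          have "0 \<le> q" unfolding q using hessian_psd[OF tangent_part_orthogonal, of w] N by (simp add: p_def)
          then have "m\<^sup>2 \<le> (norm z)\<^sup>2" by (simp add: q_def)
          then have "\<bar>m\<bar> \<le> norm z" by (metis abs_le_square_iff abs_norm_cancel)
          then show ?thesis using z r by simp
        qed
      qed
      then have "\<bar>m\<bar> * \<bar>m\<bar> \<le> 1 * \<bar>m\<bar>" by (intro mult_right_mono) auto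
      then show ?thesis by (simp add: power2_eq_square)
    qed
    then have Y: "\<epsilon> * (norm w)\<^sup>2 \<le> \<eta> * N / 2 * (q + \<bar>m\<bar>)"
    proof -
      have "(norm w)\<^sup>2 \<le> (norm z * b)\<^sup>2" using nwb by (intro power_mono) auto
      then have "\<epsilon> * (norm w)\<^sup>2 \<le> \<epsilon> * (norm z * b)\<^sup>2" using \<open>0 < \<epsilon>\<close> by simp
      also have "\<dots> = \<eta> * N / 2 * (norm z)\<^sup>2" using b by (simp add: \<epsilon>_def power_mult_distrib)
      also have "\<dots> \<le> \<eta> * N / 2 * (q + \<bar>m\<bar>)"
        using \<open>m\<^sup>2 \<le> \<bar>m\<bar>\<close> \<eta> N by (intro mult_left_mono) (auto simp: q_def)
      finally show ?thesis .
    qed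
    have "\<bar>g (x + w) - N * m - N * q / 2\<bar> \<le> \<eta> * N * (q + \<bar>m\<bar>)"
    proof -
      have e: "N * q = p \<bullet> H x p" using q N by simp
      have "0 \<le> q" unfolding q using hessian_psd[OF tangent_part_orthogonal, of w] N by (simp add: p_def)
      then have "0 \<le> \<eta> * N / 2 * q" using \<eta> N by simp
      have "\<bar>g (x + w) - N * m - N * q / 2\<bar> \<le> \<eta> * N / 2 * (q + \<bar>m\<bar>) + \<eta> * N / 2 * \<bar>m\<bar>"
        using T Y X X2 unfolding Gw e by linarith
      also have "\<dots> \<le> \<eta> * N * (q + \<bar>m\<bar>)"
      proof -
        have "\<eta> * N * (q + \<bar>m\<bar>) = \<eta> * N / 2 * q + (\<eta> * N / 2 * (q + \<bar>m\<bar>) + \<eta> * N / 2 * \<bar>m\<bar>)"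
          by (simp add: field_simps)
        then show ?thesis using \<open>0 \<le> \<eta> * N / 2 * q\<close> by linarith
      qed
      finally show ?thesis .
    qed
    moreover have "g (x + w) - N * m - N * q / 2 = N * (g (x + w) / N - m - q / 2)"
      using N by (simp add: algebra_simps)
    ultimately have "N * \<bar>g (x + w) / N - m - q / 2\<bar> \<le> N * (\<eta> * (q + \<bar>m\<bar>))"
      using N by (simp add: abs_mult mult_ac)
    then show "\<bar>g (x + B z) / norm (G x) - z \<bullet> e - ((norm z)\<^sup>2 - (z \<bullet> e)\<^sup>2) / 2\<bar>
      \<le> \<eta> * ((norm z)\<^sup>2 - (z \<bullet> e)\<^sup>2 + \<bar>z \<bullet> e\<bar>)"
      using N by (simp add: w_def m_def q_def N_def)
  qed (use r in simp)
qed

text \<open>\<open>B\<close> is fixed before \<open>\<epsilon>\<close> and only the radius depends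
  on it, so the inner and the outer volume comparison share one determinant at every precision. In
  both implications the height is nonpositive, which removes the absolute value from the error in
  \<open>normal_expansion\<close>.\<close>

lemma paraboloid_coordinates:
  assumes \<kappa>: "\<kappa> = det (matrix S)" "0 < \<kappa>" and e: "norm e = 1"
  obtains B where "linear B" "B e = \<nu>" "\<And>z. B z \<bullet> \<nu> = z \<bullet> e" "(det (matrix B))\<^sup>2 * \<kappa> = 1"
    "\<And>\<epsilon>. 0 < \<epsilon> \<Longrightarrow> \<epsilon> < 1 \<Longrightarrow> \<exists>r>0. \<forall>z. norm z < r \<longrightarrow>
       (z \<bullet> e \<le> - ((1 + \<epsilon>) / 2) * ((norm z)\<^sup>2 - (z \<bullet> e)\<^sup>2) \<longrightarrow> x + B z \<in> K) \<and>
       (x + B z \<in> K \<longrightarrow> z \<bullet> e \<le> - ((1 - \<epsilon>) / 2) * ((norm z)\<^sup>2 - (z \<bullet> e)\<^sup>2))"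
proof -
  have pos: "0 < v \<bullet> S v" if "v \<noteq> 0" for v
    using psd_det_nonzero_imp_pos[OF linear_S S_symmetric S_psd _ that] \<kappa> by simp
  obtain B where B: "linear B" "\<And>x y. B x \<bullet> S (B y) = x \<bullet> y" "(det (matrix B))\<^sup>2 * det (matrix S) = 1"
    "B e = \<nu>" "\<And>z. B z \<bullet> \<nu> = z \<bullet> e"
    using adapted_coordinates[OF linear_S S_symmetric pos norm_normal S_normal e] by metis
  show ?thesis
  proof (rule that[OF B(1,4,5)])
    show "(det (matrix B))\<^sup>2 * \<kappa> = 1" using B(3) \<kappa> by simp
    fix \<epsilon> :: real assume \<epsilon>: "0 < \<epsilon>" "\<epsilon> < 1"
    define N where "N = norm (G x)"
    have N: "0 < N" using G0[OF U(2)] by (simp add: N_def)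
    \<comment> \<open>A quarter suffices: absorbing the error leaves the remainders
      \<open>q * (\<epsilon> * (\<epsilon> - 1) / 8)\<close> and
      \<open>q * (\<epsilon> * (1 + \<epsilon>) / 8)\<close>, which have the required signs.\<close>
    define \<eta> where "\<eta> = \<epsilon> / 4"
    have \<eta>: "0 < \<eta>" "\<eta> < 1/4" using \<epsilon> by (auto simp: \<eta>_def)
    obtain r where r: "0 < r" "\<And>z. norm z < r \<Longrightarrow> x + B z \<in> U \<and>
      \<bar>g (x + B z) / N - z \<bullet> e - ((norm z)\<^sup>2 - (z \<bullet> e)\<^sup>2) / 2\<bar>
        \<le> \<eta> * ((norm z)\<^sup>2 - (z \<bullet> e)\<^sup>2 + \<bar>z \<bullet> e\<bar>)"
      using normal_expansion[OF B(1,2,5) \<eta>(1)] unfolding N_def by meson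
    show "\<exists>r>0. \<forall>z. norm z < r \<longrightarrow>
       (z \<bullet> e \<le> - ((1 + \<epsilon>) / 2) * ((norm z)\<^sup>2 - (z \<bullet> e)\<^sup>2) \<longrightarrow> x + B z \<in> K) \<and>
       (x + B z \<in> K \<longrightarrow> z \<bullet> e \<le> - ((1 - \<epsilon>) / 2) * ((norm z)\<^sup>2 - (z \<bullet> e)\<^sup>2))"
    proof (intro exI[of _ r] conjI allI impI r(1))
      fix z :: "real^'n" assume z: "norm z < r"
      define m where "m = z \<bullet> e"
      define q where "q = (norm z)\<^sup>2 - m\<^sup>2"
      have "m\<^sup>2 \<le> (norm z)\<^sup>2"
        using Cauchy_Schwarz_ineq2[of z e] e by (simp add: m_def abs_le_square_iff[symmetric])
      then have q: "0 \<le> q" by (simp add: q_def)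
      have zU: "x + B z \<in> U" and E: "\<bar>g (x + B z) / N - m - q / 2\<bar> \<le> \<eta> * (q + \<bar>m\<bar>)"
        using r(2)[OF z] by (auto simp: m_def q_def)
      {
        assume "z \<bullet> e \<le> - ((1 + \<epsilon>) / 2) * ((norm z)\<^sup>2 - (z \<bullet> e)\<^sup>2)"
        then have m: "m \<le> - ((1 + \<epsilon>) / 2) * q" by (simp add: m_def q_def)
        have "0 \<le> ((1 + \<epsilon>) / 2) * q" using q \<epsilon> by simp
        then have m0: "m \<le> 0" using m by linarith
        have "g (x + B z) / N \<le> m * (1 - \<eta>) + (1 / 2 + \<eta>) * q" using E m0 by (simp add: abs_le_iff algebra_simps)
        also have "\<dots> \<le> (- ((1 + \<epsilon>) / 2) * q) * (1 - \<eta>) + (1 / 2 + \<eta>) * q"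
          using m \<eta> by (intro add_right_mono mult_right_mono) auto
        also have "\<dots> = q * (\<epsilon> * (\<epsilon> - 1) / 8)"
          by (simp add: \<eta>_def ring_distribs add_divide_distrib diff_divide_distrib) (simp add: mult_ac)
        also have "\<dots> \<le> 0" using q \<epsilon> by (intro mult_nonneg_nonpos divide_nonpos_pos) auto
        finally have "g (x + B z) \<le> 0" using N by (simp add: divide_le_0_iff)
        then show "x + B z \<in> K" using K_iff[OF zU] by simp
      }
      {
        assume xB: "x + B z \<in> K"
        have m0: "m \<le> 0" using normal_supports'[OF xB] B(5)[of z] by (simp add: m_def)
        have "g (x + B z) / N \<le> 0" using K_iff[OF zU] xB N by (simp add: divide_le_0_iff)
        then have "m * (1 + \<eta>) \<le> - (1 / 2 - \<eta>) * q" using E m0 by (simp add: abs_le_iff algebra_simps)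
        also have "\<dots> \<le> (- ((1 - \<epsilon>) / 2) * q) * (1 + \<eta>)"
        proof -
          have "(- ((1 - \<epsilon>) / 2) * q) * (1 + \<eta>) + (1 / 2 - \<eta>) * q = q * (\<epsilon> * (1 + \<epsilon>) / 8)"
            by (simp add: \<eta>_def ring_distribs add_divide_distrib diff_divide_distrib) (simp add: mult_ac)
          moreover have "0 \<le> q * (\<epsilon> * (1 + \<epsilon>) / 8)" using q \<epsilon> by simp
          ultimately show ?thesis by linarith
        qed
        finally have "m \<le> - ((1 - \<epsilon>) / 2) * q" by (rule mult_right_le_imp_le) (use \<eta> in simp)
        then show "z \<bullet> e \<le> - ((1 - \<epsilon>) / 2) * ((norm z)\<^sup>2 - (z \<bullet> e)\<^sup>2)" by (simp add: m_def q_def)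
      }
    qed
  qed
qed

end

section \<open>Depth of the floating body in a fixed direction\<close>

lemma abs_mult_powr_half:
  fixes b \<kappa> :: real
  assumes "b\<^sup>2 * \<kappa> = 1" "0 < \<kappa>"
  shows "\<bar>b\<bar> * \<kappa> powr (1 / 2) = 1"
proof -
  have "(\<bar>b\<bar> * sqrt \<kappa>)\<^sup>2 = 1\<^sup>2" using assms by (simp add: power_mult_distrib)
  moreover have "0 \<le> \<bar>b\<bar> * sqrt \<kappa>" using assms by simp
  ultimately have "\<bar>b\<bar> * sqrt \<kappa> = 1" using power2_eq_iff_nonneg by (metis zero_le_one)
  then show ?thesis using assms by (simp add: powr_half_sqrt)
qed

lemma frontier_support_point:
  fixes K :: "'a::euclidean_space set"
  assumes "compact K" "K \<noteq> {}" "u \<noteq> 0"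
  obtains x where "x \<in> frontier K" "x \<in> K" "\<And>y. y \<in> K \<Longrightarrow> y \<bullet> u \<le> x \<bullet> u"
proof -
  have "continuous_on K (\<lambda>y. y \<bullet> u)" by (intro continuous_intros)
  then obtain x where x: "x \<in> K" "\<And>y. y \<in> K \<Longrightarrow> y \<bullet> u \<le> x \<bullet> u"
    using continuous_attains_sup[OF assms(1,2)] by metis
  have "x \<notin> interior K"
  proof
    assume "x \<in> interior K"
    then obtain e where e: "0 < e" "cball x e \<subseteq> K" using mem_interior_cball by blast
    have "x + (e / norm u) *\<^sub>R u \<in> K" using e assms(3) by (intro subsetD[OF e(2)]) (simp add: dist_norm)
    from x(2)[OF this] have "(e / norm u) * (u \<bullet> u) \<le> 0" by (simp add: inner_add_left)
    moreover have "0 < (e / norm u) * (u \<bullet> u)" using e assms(3) by simp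
    ultimately show False by linarith
  qed
  then have "x \<in> frontier K" using x assms closure_subset by (auto simp: frontier_def)
  then show thesis using that x by blast
qed

lemma supp_eqI:
  assumes "x \<in> K" "\<And>y. y \<in> K \<Longrightarrow> y \<bullet> u \<le> x \<bullet> u" shows "supp K u = x \<bullet> u"
  unfolding supp_def using assms by (intro cSup_eq_maximum) auto

lemma powr_tendsto_zero_at_right:
  fixes a :: real
  assumes "0 < a" shows "((\<lambda>d. d powr a) \<longlongrightarrow> 0) (at_right 0)"
proof (rule tendsto_zero_powrI)
  show "((\<lambda>d::real. d) \<longlongrightarrow> 0) (at_right 0)" by (rule tendsto_ident_at)
  show "\<forall>\<^sub>F x in at_right 0. 0 \<le> (x::real)" using eventually_at_right_less by eventually_elim simp
qed (use assms in auto)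

lemma eventually_powr_small:
  fixes a b C :: real
  assumes "0 < a" "0 < b"
  shows "eventually (\<lambda>d. C * d powr a < b) (at_right 0)"
  using tendsto_mult_right_zero[OF powr_tendsto_zero_at_right[OF assms(1)], of C] assms(2)
  by (rule order_tendstoD)

lemma eventually_less_at_right_0:
  fixes b :: real assumes "0 < b" shows "eventually (\<lambda>d. 0 < d \<and> d < b) (at_right 0)"
  using eventually_at_right_real[OF assms] by eventually_elim auto

context C2_boundary_point
begin

text \<open>The segment from \<open>x\<close> to \<open>y\<close> lies in \<open>K\<close> and in
  the tangent hyperplane, but close to \<open>x\<close> the outer paraboloid meets that hyperplane
  only in its vertex. This is what makes the boundary point with a given normal unique.\<close>

lemma touching_unique:
  assumes \<kappa>: "0 < det (matrix S)" and y: "y \<in> K" "(y - x) \<bullet> \<nu> = 0"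
  shows "y = x"
proof -
  obtain e :: "real^'n" where e: "norm e = 1" using vector_choose_size[of 1] by auto
  obtain B where B: "linear B" "B e = \<nu>" "\<And>z. B z \<bullet> \<nu> = z \<bullet> e" "(det (matrix B))\<^sup>2 * det (matrix S) = 1"
    "\<And>\<epsilon>. 0 < \<epsilon> \<Longrightarrow> \<epsilon> < 1 \<Longrightarrow> \<exists>r>0. \<forall>z. norm z < r \<longrightarrow>
       (z \<bullet> e \<le> - ((1 + \<epsilon>) / 2) * ((norm z)\<^sup>2 - (z \<bullet> e)\<^sup>2) \<longrightarrow> x + B z \<in> K) \<and>
       (x + B z \<in> K \<longrightarrow> z \<bullet> e \<le> - ((1 - \<epsilon>) / 2) * ((norm z)\<^sup>2 - (z \<bullet> e)\<^sup>2))"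
    using paraboloid_coordinates[OF refl \<kappa> e] by metis
  obtain r where r: "0 < r" "\<And>z. norm z < r \<Longrightarrow> x + B z \<in> K \<Longrightarrow> z \<bullet> e \<le> - ((1 - 1/2) / 2) * ((norm z)\<^sup>2 - (z \<bullet> e)\<^sup>2)"
    using B(5)[of "1/2"] by auto
  have "det (matrix B) \<noteq> 0" using B(4) by auto
  then have "surj B" using det_nz_iff_inj[OF B(1)] linear_injective_imp_surjective[OF B(1)] by simp
  then obtain z where z: "B z = y - x" by (metis surjD)
  have ze: "z \<bullet> e = 0" using B(3)[of z] y z by simp
  define s where "s = min 1 (r / (2 * (norm z + 1)))"
  have p: "0 < norm z + 1" by (simp add: add_nonneg_pos)
  have s: "0 < s" "s \<le> 1" using r p by (auto simp: s_def)
  have "s * (norm z + 1) \<le> r / (2 * (norm z + 1)) * (norm z + 1)"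
    using p by (intro mult_right_mono) (auto simp: s_def)
  also have "r / (2 * L) * L = r / 2" if "0 < L" for L using that by simp
  note this[OF p]
  finally have "norm (s *\<^sub>R z) < r" using s r by (simp add: algebra_simps)
  moreover have "(1 - s) *\<^sub>R x + s *\<^sub>R y \<in> K" using convex x_mem y s by (intro convexD) auto
  then have "x + B (s *\<^sub>R z) \<in> K" by (simp add: linear_scale[OF B(1)] z algebra_simps)
  ultimately have "(s *\<^sub>R z) \<bullet> e \<le> - ((1 - 1/2) / 2) * ((norm (s *\<^sub>R z))\<^sup>2 - ((s *\<^sub>R z) \<bullet> e)\<^sup>2)" by (rule r(2))
  then have "(norm (s *\<^sub>R z))\<^sup>2 \<le> 0" by (simp add: ze)
  then have "z = 0" using s by simp
  then show ?thesis using z linear_0[OF B(1)] by simp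
qed

text \<open>Outside a ball about \<open>x\<close> the height over \<open>\<nu>\<close> attains its
  maximum on \<open>K\<close> by compactness, and by \<open>touching_unique\<close> that maximum is
  below the height of \<open>x\<close>; half the gap serves as \<open>t\<close>. The local
  paraboloid thereby controls entire caps.\<close>

lemma caps_localize:
  assumes \<kappa>: "0 < det (matrix S)" and \<rho>: "0 < \<rho>"
  shows "\<exists>t>0. \<forall>y\<in>K. x \<bullet> \<nu> - t \<le> y \<bullet> \<nu> \<longrightarrow> norm (y - x) < \<rho>"
proof (cases "K - ball x \<rho> = {}")
  case True then show ?thesis by (intro exI[of _ 1]) (auto simp: dist_norm norm_minus_commute)
next
  case False
  have "compact (K - ball x \<rho>)" using compact by (simp add: compact_diff)
  moreover have "continuous_on (K - ball x \<rho>) (\<lambda>y. y \<bullet> \<nu>)" by (intro continuous_intros)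
  ultimately obtain y0 where y0: "y0 \<in> K" "y0 \<notin> ball x \<rho>" "\<And>y. y \<in> K \<Longrightarrow> y \<notin> ball x \<rho> \<Longrightarrow> y \<bullet> \<nu> \<le> y0 \<bullet> \<nu>"
    using continuous_attains_sup[OF _ False] by (metis DiffD1 DiffD2 DiffI)
  have "(y0 - x) \<bullet> \<nu> \<noteq> 0" using touching_unique[OF \<kappa> y0(1)] y0(2) \<rho> by auto
  then have lt: "y0 \<bullet> \<nu> < x \<bullet> \<nu>" using normal_supports'[OF y0(1)] by (simp add: inner_diff_left)
  show ?thesis
  proof (intro exI[of _ "(x \<bullet> \<nu> - y0 \<bullet> \<nu>) / 2"] conjI ballI impI)
    fix y assume y: "y \<in> K" "x \<bullet> \<nu> - (x \<bullet> \<nu> - y0 \<bullet> \<nu>) / 2 \<le> y \<bullet> \<nu>"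
    then have "\<not> y \<bullet> \<nu> \<le> y0 \<bullet> \<nu>" using lt by (simp add: field_simps)
    then show "norm (y - x) < \<rho>" using y0(3)[OF y(1)] by (auto simp: dist_norm norm_minus_commute)
  qed (use lt in simp)
qed

text \<open>In the coordinates \<open>B\<close> the ellipsoid has tangential semi-axes
  \<open>\<rho>\<close> and normal semi-axis \<open>M * \<rho>\<^sup>2\<close>, so its curvature at
  the pole is their quotient \<open>M * \<rho>\<^sup>2 / \<rho>\<^sup>2 = M\<close>. In the leading
  factor of the cap volume \<open>\<rho>\<close> cancels, and it may be taken as small as the local
  comparison demands.\<close>

lemma floating_body_depth_upper:
  assumes \<kappa>: "\<kappa> = det (matrix S)" "0 < \<kappa>" and \<epsilon>: "0 < \<epsilon>" and K0: "0 < vol K"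
  shows "\<forall>\<^sub>F d in at_right 0. x - ((1 + \<epsilon>) * \<kappa> powr (1 / (real CARD('n) + 1)) * d powr (2 / (real CARD('n) + 1)) / cap_const CARD('n)) *\<^sub>R \<nu>
     \<in> floating_body K d"
proof -
  let ?n = "real CARD('n)" and ?c = "cap_const CARD('n)"
  define P where "P = (?n + 1) / 2"
  define Q where "Q = (?n - 1) / 2"
  have n1: "1 \<le> ?n" by (simp add: Suc_leI)
  have PQ: "P = Q + 1" "0 \<le> Q" "0 < P" using n1 by (auto simp: P_def Q_def field_simps)
  have c: "0 < ?c" by (rule cap_const_pos) (simp add: Suc_leI)
  obtain k :: 'n where True by blast
  define e :: "real^'n" where "e = axis k 1"
  have e: "norm e = 1" by (simp add: e_def)
  have ee: "e \<bullet> e = 1" using e norm_eq_1 by blast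
  have ye: "y \<bullet> e = y $ k" for y by (simp add: e_def inner_axis)
  obtain B where B: "linear B" "B e = \<nu>" "(det (matrix B))\<^sup>2 * \<kappa> = 1"
    "\<And>\<epsilon>. 0 < \<epsilon> \<Longrightarrow> \<epsilon> < 1 \<Longrightarrow> \<exists>r>0. \<forall>z. norm z < r \<longrightarrow>
       (z \<bullet> e \<le> - ((1 + \<epsilon>) / 2) * ((norm z)\<^sup>2 - (z \<bullet> e)\<^sup>2) \<longrightarrow> x + B z \<in> K) \<and>
       (x + B z \<in> K \<longrightarrow> z \<bullet> e \<le> - ((1 - \<epsilon>) / 2) * ((norm z)\<^sup>2 - (z \<bullet> e)\<^sup>2))"
    using paraboloid_coordinates[OF \<kappa> e] by metis
  \<comment> \<open>At most half of \<open>\<epsilon>\<close> is spent on the curvature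
    \<open>M\<close>; the rest pays for the factor \<open>1 - s d / 2\<close> of the ball
    cap.\<close>
  define \<epsilon>1 where "\<epsilon>1 = min \<epsilon> 1 / 2"
  have \<epsilon>1: "0 < \<epsilon>1" "\<epsilon>1 < 1" "\<epsilon>1 \<le> \<epsilon> / 2" using \<epsilon> by (auto simp: \<epsilon>1_def)
  define M where "M = 1 + \<epsilon>1"
  have M: "1 < M" "M < 2" "M \<le> 1 + \<epsilon> / 2" using \<epsilon>1 by (auto simp: M_def)
  obtain r where r: "0 < r" "\<And>z. norm z < r \<Longrightarrow> z \<bullet> e \<le> - (M / 2) * ((norm z)\<^sup>2 - (z \<bullet> e)\<^sup>2) \<Longrightarrow> x + B z \<in> K"
    using B(4)[OF \<epsilon>1(1,2)] unfolding M_def by blast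
  \<comment> \<open>Points of the ellipsoid have height at most \<open>4 * \<rho>\<close> in
    absolute value and tangential norm at most \<open>\<rho>\<close>, hence norm below
    \<open>5 * \<rho>\<close>. The bound by 1 serves to estimate \<open>\<rho>\<^sup>2\<close> by
    \<open>\<rho>\<close>.\<close>
  define \<rho> where "\<rho> = min 1 (r / 5)"
  have \<rho>: "0 < \<rho>" "\<rho> \<le> 1" "5 * \<rho> \<le> r" using r by (auto simp: \<rho>_def)
  define D where "D y = (\<chi> i. (if i = k then M * \<rho>\<^sup>2 else \<rho>) * y $ i)" for y :: "real^'n"
  have D: "linear D" by (rule linearI) (auto simp: D_def vec_eq_iff algebra_simps)
  have Deq: "D y = \<rho> *\<^sub>R y + ((M * \<rho>\<^sup>2 - \<rho>) * (y \<bullet> e)) *\<^sub>R e" for y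
    unfolding ye by (auto simp: D_def vec_eq_iff e_def axis_def algebra_simps)
  have De: "D e = (M * \<rho>\<^sup>2) *\<^sub>R e" unfolding Deq ee by (simp add: scaleR_left_distrib[symmetric])
  have detD: "det (matrix D) = M * \<rho> ^ (CARD('n) + 1)"
  proof -
    have "det (matrix D) = (\<Prod>i\<in>UNIV. if i = k then M * \<rho>\<^sup>2 else \<rho>)"
      by (subst det_diagonal) (auto simp: matrix_def axis_def D_def intro!: prod.cong)
    also have "\<dots> = M * \<rho>\<^sup>2 * (\<Prod>i\<in>UNIV - {k}. \<rho>)"
      by (subst prod.remove[of _ k]) (auto intro!: prod.cong)
    also have "\<dots> = M * (\<rho>\<^sup>2 * \<rho> ^ (CARD('n) - 1))" by simp
    also have "\<rho>\<^sup>2 * \<rho> ^ (CARD('n) - 1) = \<rho> ^ (CARD('n) + 1)"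
      unfolding power_add[symmetric] by (rule arg_cong[of _ _ "power \<rho>"]) simp
    finally show ?thesis .
  qed
  \<comment> \<open>The centre lies one normal semi-axis below the vertex, so that the pole of the
    ellipsoid is the point \<open>x\<close> itself.\<close>
  define z0 where "z0 = (- (M * \<rho>\<^sup>2)) *\<^sub>R e"
  define A where "A = B \<circ> D"
  have A: "linear A" unfolding A_def by (rule linear_compose[OF D B(1)])
  define b where "b = \<bar>det (matrix B)\<bar>"
  have b: "b * \<kappa> powr (1 / 2) = 1" unfolding b_def by (rule abs_mult_powr_half[OF B(3) \<kappa>(2)])
  have detA: "\<bar>det (matrix A)\<bar> = b * (M * \<rho> ^ (CARD('n) + 1))"
    unfolding A_def matrix_compose[OF D B(1)] using M \<rho> by (simp add: det_mul detD b_def abs_mult)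
  have sub: "(\<lambda>y. (x + B z0) + A y) ` cball 0 1 \<subseteq> K"
  proof (rule image_subsetI)
    fix y :: "real^'n" assume "y \<in> cball 0 1"
    then have y: "norm y \<le> 1" by simp
    define t where "t = y \<bullet> e"
    have t: "\<bar>t\<bar> \<le> 1" using Cauchy_Schwarz_ineq2[of y e] e y by (simp add: t_def)
    define z where "z = z0 + D y"
    define \<beta> where "\<beta> = (M * \<rho>\<^sup>2 - \<rho>) * t - M * \<rho>\<^sup>2"
    have z: "z = \<rho> *\<^sub>R y + \<beta> *\<^sub>R e"
      unfolding z_def Deq z0_def \<beta>_def t_def by (simp add: algebra_simps)
    have m: "z \<bullet> e = \<rho> * t + \<beta>" unfolding z by (simp add: inner_add_left ee t_def)
    have nz: "(norm z)\<^sup>2 = \<rho>\<^sup>2 * (norm y)\<^sup>2 + 2 * \<rho> * \<beta> * t + \<beta>\<^sup>2"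
      unfolding z power2_norm_eq_inner
      by (simp add: inner_add_left inner_add_right ee t_def inner_commute[of e y] power2_eq_square algebra_simps)
    have q: "(norm z)\<^sup>2 - (z \<bullet> e)\<^sup>2 = \<rho>\<^sup>2 * ((norm y)\<^sup>2 - t\<^sup>2)"
      unfolding nz m by (simp add: power2_eq_square algebra_simps)
    have m': "z \<bullet> e = M * \<rho>\<^sup>2 * (t - 1)" unfolding m \<beta>_def by (simp add: algebra_simps)
    have ny: "(norm y)\<^sup>2 \<le> 1" using y by (simp add: abs_square_le_1)
    have "norm z < r"
    proof -
      have "(z \<bullet> e)\<^sup>2 \<le> (4 * \<rho>)\<^sup>2"
      proof (rule power2_le_iff_abs_le[THEN iffD2])
        have "\<bar>z \<bullet> e\<bar> = (M * (\<rho> * \<rho>)) * \<bar>t - 1\<bar>" unfolding m' using M \<rho> by (simp add: abs_mult power2_eq_square)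
        also have "\<dots> \<le> (2 * (\<rho> * 1)) * 2" using M \<rho> t by (intro mult_mono) auto
        finally show "\<bar>z \<bullet> e\<bar> \<le> 4 * \<rho>" by simp
      qed (use \<rho> in simp)
      moreover have "\<rho>\<^sup>2 * ((norm y)\<^sup>2 - t\<^sup>2) \<le> \<rho>\<^sup>2 * 1" using ny zero_le_power2[of t] by (intro mult_left_mono) (linarith, simp)
      ultimately have "(norm z)\<^sup>2 \<le> 17 * \<rho>\<^sup>2" using q by (simp add: power_mult_distrib)
      also have "\<dots> < (5 * \<rho>)\<^sup>2" using \<rho> by (simp add: power_mult_distrib)
      also have "\<dots> \<le> r\<^sup>2" using \<rho> by (intro power_mono) auto
      finally show ?thesis using r(1) by (intro power_less_imp_less_base[of "norm z" 2 r]) auto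
    qed
    moreover have "z \<bullet> e \<le> - (M / 2) * ((norm z)\<^sup>2 - (z \<bullet> e)\<^sup>2)"
    proof -
      \<comment> \<open>\<open>1 - t\<^sup>2 \<le> 2 * (1 - t)\<close> says that an ellipsoid lies
        inside the paraboloid with the same pole and the same curvature there.\<close>
      have "0 \<le> (1 - t)\<^sup>2" by simp
      then have "(norm y)\<^sup>2 - t\<^sup>2 \<le> 2 * (1 - t)" using ny by (simp add: power2_diff)
      then have "(M * \<rho>\<^sup>2 / 2) * ((norm y)\<^sup>2 - t\<^sup>2) \<le> (M * \<rho>\<^sup>2 / 2) * (2 * (1 - t))"
        using M by (intro mult_left_mono) auto
      then show ?thesis unfolding q unfolding m' by (simp add: algebra_simps)
    qed
    ultimately have "x + B z \<in> K" by (rule r(2))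
    then show "(x + B z0) + A y \<in> K" by (simp add: z_def A_def linear_add[OF B(1)] add.assoc)
  qed
  define t where "t d = (1 + \<epsilon>) * \<kappa> powr (1 / (?n + 1)) * d powr (2 / (?n + 1)) / ?c" for d
  \<comment> \<open>The depth \<open>t d\<close> measured in units of the normal semi-axis, which is
    the depth in the ball.\<close>
  define s where "s d = t d / (M * \<rho>\<^sup>2)" for d
  \<comment> \<open>This threshold is what gives
    \<open>M \<le> (1 + \<epsilon>) * (1 - s d / 2)\<close> below.\<close>
  have "\<forall>\<^sub>F d in at_right 0. ((1 + \<epsilon>) * \<kappa> powr (1 / (?n + 1)) / ?c / (M * \<rho>\<^sup>2)) * d powr (2 / (?n + 1)) < \<epsilon> / (1 + \<epsilon>)"
    using n1 \<epsilon> by (intro eventually_powr_small) auto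
  with eventually_less_at_right_0[OF K0] show ?thesis
  proof eventually_elim
    fix d assume d: "0 < d \<and> d < vol K"
      and "((1 + \<epsilon>) * \<kappa> powr (1 / (?n + 1)) / ?c / (M * \<rho>\<^sup>2)) * d powr (2 / (?n + 1)) < \<epsilon> / (1 + \<epsilon>)"
    then have s2: "s d < \<epsilon> / (1 + \<epsilon>)" by (simp add: s_def t_def)
    have t0: "0 \<le> t d" using \<epsilon> c by (simp add: t_def)
    have s0: "0 \<le> s d" using t0 M \<rho> by (simp add: s_def)
    have "s d * (1 + \<epsilon>) \<le> \<epsilon>" using s2 \<epsilon> by (simp add: pos_less_divide_eq)
    moreover have "(1 + \<epsilon>) * (1 - s d / 2) = 1 + \<epsilon> - (s d * (1 + \<epsilon>)) / 2" by (simp add: algebra_simps)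
    ultimately have sM: "M \<le> (1 + \<epsilon>) * (1 - s d / 2)" using M(3) by linarith
    have "\<epsilon> / (1 + \<epsilon>) \<le> 1" using \<epsilon> by simp
    then have s1: "s d \<le> 1" using s2 by linarith
    have dv: "d \<le> \<bar>det (matrix A)\<bar> * ((?c * s d) powr ((?n + 1) / 2) * (1 - s d / 2) powr ((?n - 1) / 2))"
    proof -
      have ct: "(?c * t d) powr P = (1 + \<epsilon>) powr P * \<kappa> powr (1 / 2) * d"
      proof -
        have nz: "?n + 1 \<noteq> 0" using n1 by linarith
        have e1: "1 / (?n + 1) * P = 1 / 2" "2 / (?n + 1) * P = 1" using nz by (simp_all add: P_def)
        have "?c * t d = (1 + \<epsilon>) * \<kappa> powr (1 / (?n + 1)) * d powr (2 / (?n + 1))" using c by (simp add: t_def)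
        then have "(?c * t d) powr P = (1 + \<epsilon>) powr P * (\<kappa> powr (1 / (?n + 1))) powr P * (d powr (2 / (?n + 1))) powr P"
          using \<epsilon> by (simp add: powr_mult)
        also have "\<dots> = (1 + \<epsilon>) powr P * \<kappa> powr (1 / 2) * d" unfolding powr_powr e1 using d by simp
        finally show ?thesis .
      qed
      have r2: "(\<rho>\<^sup>2) powr P = \<rho> ^ (CARD('n) + 1)"
      proof -
        have "(\<rho>\<^sup>2) powr P = (\<rho> powr 2) powr P" using \<rho> by simp
        also have "\<dots> = \<rho> powr (2 * P)" by (rule powr_powr)
        also have "2 * P = real (CARD('n) + 1)" by (simp add: P_def)
        finally show ?thesis using \<rho> by (simp only: powr_realpow)
      qed
      have "(?c * s d) powr P = (?c * t d) powr P / (M powr P * (\<rho>\<^sup>2) powr P)"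
        using t0 c M \<rho> by (simp add: s_def powr_divide powr_mult)
      then have "\<bar>det (matrix A)\<bar> * ((?c * s d) powr P * (1 - s d / 2) powr Q)
        = (b * \<kappa> powr (1 / 2)) * ((M / M powr P) * ((1 + \<epsilon>) powr P * (1 - s d / 2) powr Q)) * d"
        unfolding detA ct r2 using \<rho> by simp
      also have "\<dots> = (1 + \<epsilon>) * ((1 + \<epsilon>) powr Q * (1 - s d / 2) powr Q / M powr Q) * d"
        unfolding b PQ(1) using M \<epsilon> by (simp add: powr_add)
      also have "(1 + \<epsilon>) powr Q * (1 - s d / 2) powr Q / M powr Q = ((1 + \<epsilon>) * (1 - s d / 2) / M) powr Q"
        using M \<epsilon> s1 by (simp add: powr_mult powr_divide)
      finally have E: "\<bar>det (matrix A)\<bar> * ((?c * s d) powr P * (1 - s d / 2) powr Q)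
        = ((1 + \<epsilon>) * ((1 + \<epsilon>) * (1 - s d / 2) / M) powr Q) * d" .
      have "1 \<le> ((1 + \<epsilon>) * (1 - s d / 2) / M) powr Q"
        using sM M PQ by (intro ge_one_powr_ge_zero) (auto simp: pos_le_divide_eq)
      then have "1 * 1 \<le> (1 + \<epsilon>) * ((1 + \<epsilon>) * (1 - s d / 2) / M) powr Q"
        using \<epsilon> by (intro mult_mono) auto
      then have "1 * d \<le> ((1 + \<epsilon>) * ((1 + \<epsilon>) * (1 - s d / 2) / M) powr Q) * d"
        using d by (intro mult_right_mono) auto
      then show ?thesis using E by (simp add: P_def Q_def)
    qed
    have "(x + B z0) + A ((1 - s d) *\<^sub>R e) \<in> floating_body K d"
      using d s0 s1 e by (intro ellipsoid_point_in_floating_body[OF compact convex _ _ A sub s0 s1 _ dv]) auto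
    also have "(x + B z0) + A ((1 - s d) *\<^sub>R e) = x - t d *\<^sub>R \<nu>"
    proof -
      have "z0 + D ((1 - s d) *\<^sub>R e) = (- (M * \<rho>\<^sup>2 * s d)) *\<^sub>R e"
        unfolding linear_scale[OF D] De z0_def scaleR_scaleR scaleR_left_distrib[symmetric] by (simp add: algebra_simps)
      also have "M * \<rho>\<^sup>2 * s d = t d" using M \<rho> by (simp add: s_def)
      finally have "B (z0 + D ((1 - s d) *\<^sub>R e)) = - t d *\<^sub>R \<nu>" by (simp only: linear_scale[OF B(1)] B(2))
      then show ?thesis by (simp add: A_def linear_add[OF B(1)] add.assoc)
    qed
    finally show "x - ((1 + \<epsilon>) * \<kappa> powr (1 / (?n + 1)) * d powr (2 / (?n + 1)) / ?c) *\<^sub>R \<nu> \<in> floating_body K d"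
      by (simp add: t_def)
  qed
qed

text \<open>The factor \<open>M = 1 - \<epsilon>\<close> appears both as the curvature of the
  enclosing paraboloid and in the depth. Since \<open>P = Q + 1\<close>, the powers
  \<open>M powr P\<close> and \<open>M powr (- Q)\<close> combine to \<open>M\<close>: the cap has
  volume at most \<open>M * d\<close>, which is below \<open>d\<close>, so the level must lie
  further inside.\<close>

lemma float_level_depth_lower:
  assumes \<kappa>: "\<kappa> = det (matrix S)" "0 < \<kappa>" and \<epsilon>: "0 < \<epsilon>" "\<epsilon> < 1" and K0: "0 < vol K"
  shows "\<forall>\<^sub>F d in at_right 0. float_level K d \<nu>
     < x \<bullet> \<nu> - (1 - \<epsilon>) * \<kappa> powr (1 / (real CARD('n) + 1)) * d powr (2 / (real CARD('n) + 1)) / cap_const CARD('n)"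
proof -
  let ?n = "real CARD('n)" and ?c = "cap_const CARD('n)"
  define P where "P = (?n + 1) / 2"
  define Q where "Q = (?n - 1) / 2"
  have n1: "1 \<le> ?n" by (simp add: Suc_leI)
  have PQ: "P = Q + 1" "0 \<le> Q" "0 < P" using n1 by (auto simp: P_def Q_def field_simps)
  have c: "0 < ?c" by (rule cap_const_pos) (simp add: Suc_leI)
  obtain e :: "real^'n" where eB: "e \<in> Basis" using nonempty_Basis by blast
  have e: "norm e = 1" using eB by simp
  obtain B where B: "linear B" "B e = \<nu>" "\<And>z. B z \<bullet> \<nu> = z \<bullet> e" "(det (matrix B))\<^sup>2 * \<kappa> = 1"
    "\<And>\<epsilon>. 0 < \<epsilon> \<Longrightarrow> \<epsilon> < 1 \<Longrightarrow> \<exists>r>0. \<forall>z. norm z < r \<longrightarrow>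
       (z \<bullet> e \<le> - ((1 + \<epsilon>) / 2) * ((norm z)\<^sup>2 - (z \<bullet> e)\<^sup>2) \<longrightarrow> x + B z \<in> K) \<and>
       (x + B z \<in> K \<longrightarrow> z \<bullet> e \<le> - ((1 - \<epsilon>) / 2) * ((norm z)\<^sup>2 - (z \<bullet> e)\<^sup>2))"
    using paraboloid_coordinates[OF \<kappa> e] by metis
  define M where "M = 1 - \<epsilon>"
  have M: "0 < M" "M < 1" using \<epsilon> by (auto simp: M_def)
  obtain r where r: "0 < r" "\<And>z. norm z < r \<Longrightarrow> x + B z \<in> K \<Longrightarrow> z \<bullet> e \<le> - (M / 2) * ((norm z)\<^sup>2 - (z \<bullet> e)\<^sup>2)"
    using B(5)[OF \<epsilon>] unfolding M_def by blast
  define b where "b = \<bar>det (matrix B)\<bar>"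
  have b: "b * \<kappa> powr (1 / 2) = 1" unfolding b_def by (rule abs_mult_powr_half[OF B(4) \<kappa>(2)])
  have "det (matrix B) \<noteq> 0" using B(4) by auto
  then have inj: "inj B" using det_nz_iff_inj[OF B(1)] by simp
  obtain B' where B': "linear B'" "\<And>z. B' (B z) = z" "\<And>w. B (B' w) = w"
    using linear_injective_isomorphism[OF B(1) inj] by metis
  obtain b' where b': "0 < b'" "\<And>w. norm (B' w) \<le> norm w * b'"
    using bounded_linear.pos_bounded[OF B'(1)[unfolded linear_conv_bounded_linear]] by blast
  \<comment> \<open>Confines the cap to a ball about \<open>x\<close> that \<open>B'\<close> maps
    into the region where the paraboloid comparison holds.\<close>
  obtain t0 where t0: "0 < t0" "\<And>y. y \<in> K \<Longrightarrow> x \<bullet> \<nu> - t0 \<le> y \<bullet> \<nu> \<Longrightarrow> norm (y - x) < r / b'"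
    using caps_localize[of "r / b'"] \<kappa> r b' by auto
  let ?Par = "\<lambda>t. {z. - t \<le> z \<bullet> e \<and> z \<bullet> e \<le> - (M / 2) * hsum e z}"
  define t where "t d = M * \<kappa> powr (1 / (?n + 1)) * d powr (2 / (?n + 1)) / ?c" for d
  have cap: "vol {y \<in> K. x \<bullet> \<nu> - t \<le> y \<bullet> \<nu>} \<le> b * ((?c * t) powr P * M powr (- Q))" if t: "0 \<le> t" "t \<le> t0" for t
  proof -
    have em: "emeasure lborel (?Par t) = ennreal ((?c * t) powr P * M powr (- Q))"
      using emeasure_paraboloid_cap[OF eB t(1) M(1)] by (simp only: DIM_cart DIM_real P_def Q_def minus_divide_left mult_1_right)
    have pb: "?Par t \<in> sets borel" by measurable
    have pm: "?Par t \<in> lmeasurable" using em pb by (auto simp: fmeasurable_def)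
    have pv: "measure lebesgue (?Par t) = (?c * t) powr P * M powr (- Q)" using em pb by (simp add: measure_def)
    have BP: "B ` ?Par t \<in> lmeasurable" "measure lebesgue (B ` ?Par t) = b * ((?c * t) powr P * M powr (- Q))"
      using measure_linear_image_cart[OF B(1) pm] pv by (auto simp: b_def)
    have "{y \<in> K. x \<bullet> \<nu> - t \<le> y \<bullet> \<nu>} \<subseteq> (+) x ` B ` ?Par t"
    proof
      fix y assume y: "y \<in> {y \<in> K. x \<bullet> \<nu> - t \<le> y \<bullet> \<nu>}"
      define z where "z = B' (y - x)"
      have Bz: "B z = y - x" by (simp add: z_def B')
      have "norm (y - x) < r / b'" using y t by (intro t0(2)) auto
      then have "norm (y - x) * b' < r" using b' by (simp add: pos_less_divide_eq)
      then have "norm z < r" using b'(2)[of "y - x"] by (simp add: z_def)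
      moreover have "x + B z \<in> K" using y by (simp add: Bz)
      ultimately have "z \<bullet> e \<le> - (M / 2) * ((norm z)\<^sup>2 - (z \<bullet> e)\<^sup>2)" by (rule r(2))
      moreover have "z \<bullet> e = y \<bullet> \<nu> - x \<bullet> \<nu>" using B(3)[of z] by (simp add: Bz inner_diff_left)
      ultimately have "z \<in> ?Par t" using y norm_sq_hsum[OF eB, of z] by auto
      moreover have "y = x + B z" by (simp add: Bz)
      ultimately show "y \<in> (+) x ` B ` ?Par t" by blast
    qed
    then have "vol {y \<in> K. x \<bullet> \<nu> - t \<le> y \<bullet> \<nu>} \<le> measure lebesgue ((+) x ` B ` ?Par t)"
      unfolding vol_def using measurable_translation[OF BP(1)]
      by (intro measure_mono_fmeasurable fmeasurableD[OF lmeasurable_compact[OF compact_cap[OF compact]]])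
    then show ?thesis by (simp only: measure_translation BP(2))
  qed
  have "\<forall>\<^sub>F d in at_right 0. (M * \<kappa> powr (1 / (?n + 1)) / ?c) * d powr (2 / (?n + 1)) < t0"
    using n1 t0 by (intro eventually_powr_small) auto
  with eventually_less_at_right_0[OF K0] show ?thesis
  proof eventually_elim
    fix d assume d: "0 < d \<and> d < vol K" and "(M * \<kappa> powr (1 / (?n + 1)) / ?c) * d powr (2 / (?n + 1)) < t0"
    then have tt: "t d \<le> t0" by (simp add: t_def)
    have t00: "0 \<le> t d" using M c by (simp add: t_def)
    have ct: "(?c * t d) powr P = M powr P * \<kappa> powr (1 / 2) * d"
    proof -
      have nz: "?n + 1 \<noteq> 0" using n1 by linarith
      have e1: "1 / (?n + 1) * P = 1 / 2" "2 / (?n + 1) * P = 1" using nz by (simp_all add: P_def)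
      have "?c * t d = M * \<kappa> powr (1 / (?n + 1)) * d powr (2 / (?n + 1))" using c by (simp add: t_def)
      then have "(?c * t d) powr P = M powr P * (\<kappa> powr (1 / (?n + 1))) powr P * (d powr (2 / (?n + 1))) powr P"
        using M by (simp add: powr_mult)
      also have "\<dots> = M powr P * \<kappa> powr (1 / 2) * d" unfolding powr_powr e1 using d by simp
      finally show ?thesis .
    qed
    have "vol {y \<in> K. x \<bullet> \<nu> - t d \<le> y \<bullet> \<nu>} \<le> b * ((?c * t d) powr P * M powr (- Q))"
      by (rule cap[OF t00 tt])
    also have "\<dots> = (b * \<kappa> powr (1 / 2)) * (M powr P * M powr (- Q)) * d" unfolding ct by simp
    also have "\<dots> = M * d" unfolding b powr_add[symmetric] PQ(1) using M by simp
    also have "\<dots> < d" using M d by simp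
    finally have "float_level K d \<nu> < x \<bullet> \<nu> - t d"
      using d norm_normal by (intro float_level_less[OF compact convex]) auto
    then show "float_level K d \<nu> < x \<bullet> \<nu> - (1 - \<epsilon>) * \<kappa> powr (1 / (?n + 1)) * d powr (2 / (?n + 1)) / ?c"
      by (simp add: t_def M_def)
  qed
qed

text \<open>A squeeze: the point from \<open>floating_body_depth_upper\<close> bounds the support
  function from below, and \<open>float_level\<close> bounds it from above.\<close>

lemma supp_floating_body_limit:
  assumes \<kappa>: "\<kappa> = det (matrix S)" "0 < \<kappa>" and K0: "0 < vol K"
  shows "((\<lambda>d. cap_const CARD('n) * (x \<bullet> \<nu> - supp (floating_body K d) \<nu>) / d powr (2 / (real CARD('n) + 1)))
    \<longlongrightarrow> \<kappa> powr (1 / (real CARD('n) + 1))) (at_right 0)"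
proof (rule tendstoI)
  let ?a = "2 / (real CARD('n) + 1)" and ?c = "cap_const CARD('n)"
  let ?k = "\<kappa> powr (1 / (real CARD('n) + 1))"
  have c: "0 < ?c" by (rule cap_const_pos) (simp add: Suc_leI)
  have k: "0 < ?k" using \<kappa> by simp
  fix \<eta> :: real assume \<eta>: "0 < \<eta>"
  define \<epsilon> where "\<epsilon> = min (1 / 2) (\<eta> / (2 * ?k))"
  have \<epsilon>: "0 < \<epsilon>" "\<epsilon> < 1" using \<eta> k by (auto simp: \<epsilon>_def)
  have "\<epsilon> * ?k \<le> \<eta> / (2 * ?k) * ?k" using k by (intro mult_right_mono) (auto simp: \<epsilon>_def)
  then have \<epsilon>k: "\<epsilon> * ?k < \<eta>" using k \<eta> by simp
  have d0: "\<forall>\<^sub>F d in at_right (0::real). 0 < d" by (rule eventually_at_right_less)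
  from floating_body_depth_upper[OF \<kappa> \<epsilon>(1) K0] float_level_depth_lower[OF \<kappa> \<epsilon> K0] d0
  show "\<forall>\<^sub>F d in at_right 0. dist (?c * (x \<bullet> \<nu> - supp (floating_body K d) \<nu>) / d powr ?a) ?k < \<eta>"
  proof eventually_elim
    fix d :: real
    assume p: "x - ((1 + \<epsilon>) * ?k * d powr ?a / ?c) *\<^sub>R \<nu> \<in> floating_body K d"
      and l: "float_level K d \<nu> < x \<bullet> \<nu> - (1 - \<epsilon>) * ?k * d powr ?a / ?c" and d: "0 < d"
    let ?h = "x \<bullet> \<nu> - supp (floating_body K d) \<nu>"
    have da: "0 < d powr ?a" using d by simp
    have nn: "\<nu> \<bullet> \<nu> = 1" using norm_normal norm_eq_1 by blast
    have bd: "bounded (floating_body K d)"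
      using compact_imp_bounded[OF compact] floating_body_subset bounded_subset by blast
    have "(x - ((1 + \<epsilon>) * ?k * d powr ?a / ?c) *\<^sub>R \<nu>) \<bullet> \<nu> \<le> supp (floating_body K d) \<nu>"
      by (rule supp_ge[OF bd p])
    then have 1: "?h \<le> (1 + \<epsilon>) * ?k * d powr ?a / ?c" by (simp add: inner_diff_left nn)
    have "supp (floating_body K d) \<nu> \<le> float_level K d \<nu>"
      using p norm_normal by (intro supp_floating_body_le) auto
    then have 2: "(1 - \<epsilon>) * ?k * d powr ?a / ?c \<le> ?h" using l by linarith
    have "?c * ?h / d powr ?a \<le> (1 + \<epsilon>) * ?k"
      using 1 c da by (simp add: pos_divide_le_eq pos_le_divide_eq mult.commute)
    moreover have "(1 - \<epsilon>) * ?k \<le> ?c * ?h / d powr ?a"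
      using 2 c da by (simp add: pos_divide_le_eq pos_le_divide_eq mult.commute)
    ultimately show "dist (?c * ?h / d powr ?a) ?k < \<eta>"
      using \<epsilon>k by (simp add: dist_real_def abs_less_iff algebra_simps)
  qed
qed

end

section \<open>Volume of the polar body\<close>

lemma emeasure_lborel_scale:
  fixes S :: "'a::euclidean_space set"
  assumes r: "0 < r" and [measurable]: "S \<in> sets borel"
  shows "emeasure lborel {x. (1 / r) *\<^sub>R x \<in> S} = ennreal (r ^ DIM('a)) * emeasure lborel S"
proof -
  let ?T = "{x. (1 / r) *\<^sub>R x \<in> S}"
  have [measurable]: "?T \<in> sets borel" by measurable
  have "emeasure lborel ?T = emeasure (density (distr lborel borel (\<lambda>x::'a. 0 + r *\<^sub>R x)) (\<lambda>_. ennreal (\<bar>r\<bar> ^ DIM('a)))) ?T"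
    using r by (subst lborel_affine[of r 0]) auto
  also have "\<dots> = ennreal (r ^ DIM('a)) * emeasure (distr lborel borel (\<lambda>x::'a. 0 + r *\<^sub>R x)) ?T"
    using r by (subst emeasure_density) (auto simp: nn_integral_cmult_indicator)
  also have "emeasure (distr lborel borel (\<lambda>x::'a. 0 + r *\<^sub>R x)) ?T = emeasure lborel S"
    using r by (subst emeasure_distr) (auto simp: vimage_def)
  finally show ?thesis .
qed

text \<open>Both sides of the next identity turn into \<open>DIM('a) * \<integral> ln (1 / h)\<close> over \<open>h \<le> 1\<close>, which does not involve \<open>p\<close>:
  write \<open>(p / h) ^ DIM('a)\<close> as an integral over \<open>0 < r \<le> p x / h x\<close>, exchange the integrals and rescale by \<open>r\<close>.\<close>

lemma homogeneous_gauge_integral: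
  fixes p h :: "'a::euclidean_space \<Rightarrow> real"
  assumes [measurable]: "p \<in> borel_measurable borel" "h \<in> borel_measurable borel"
    and pos: "\<And>x. x \<noteq> 0 \<Longrightarrow> 0 < p x" "\<And>x. x \<noteq> 0 \<Longrightarrow> 0 < h x"
    and hom: "\<And>t x. 0 < t \<Longrightarrow> p (t *\<^sub>R x) = t * p x" "\<And>t x. 0 < t \<Longrightarrow> h (t *\<^sub>R x) = t * h x"
  shows "(\<integral>\<^sup>+x. ennreal ((p x / h x) ^ DIM('a)) * indicator {x. p x \<le> 1} x \<partial>lborel)
    = (\<integral>\<^sup>+x. (\<integral>\<^sup>+r. ennreal (real DIM('a) / r) * indicator {x. 0 < fst x \<and> h (snd x) \<le> fst x \<and> fst x \<le> 1} (r, x) \<partial>lborel) \<partial>lborel)"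
proof -
  let ?n = "DIM('a)"
  have n: "0 < ?n" by simp
  have ae: "AE x in lborel. x \<noteq> (0::'a)" by (rule AE_lborel_singleton)
  have pw: "ennreal (c ^ ?n) = (\<integral>\<^sup>+r. ennreal (real ?n * r ^ (?n - 1)) * indicator {0..c} r \<partial>lborel)" if "0 < c" for c :: real
  proof -
    have "(\<integral>\<^sup>+r. ennreal (real ?n * r ^ (?n - 1)) * indicator {0..c} r \<partial>lborel) = ennreal (c ^ ?n - 0 ^ ?n)"
      using that by (intro nn_integral_FTC_Icc) (auto intro!: derivative_eq_intros)
    then show ?thesis using n by (simp add: zero_power del: DIM_positive)
  qed
  have "(\<integral>\<^sup>+x. ennreal ((p x / h x) ^ ?n) * indicator {x. p x \<le> 1} x \<partial>lborel)
      = (\<integral>\<^sup>+x. (\<integral>\<^sup>+r. ennreal (real ?n * r ^ (?n - 1)) * indicator {x. 0 < fst x \<and> p (snd x) \<le> 1 \<and> fst x * h (snd x) \<le> p (snd x)} (r, x) \<partial>lborel) \<partial>lborel)"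
  proof (rule nn_integral_cong_AE, use ae in eventually_elim)
    fix x :: 'a assume x: "x \<noteq> 0"
    have c: "0 < p x / h x" using pos x by simp
    have "ennreal ((p x / h x) ^ ?n) * indicator {x. p x \<le> 1} x
      = (\<integral>\<^sup>+r. ennreal (real ?n * r ^ (?n - 1)) * indicator {0..p x / h x} r * indicator {x. p x \<le> 1} x \<partial>lborel)"
      unfolding pw[OF c] by (rule nn_integral_multc[symmetric]) measurable
    also have "\<dots> = (\<integral>\<^sup>+r. ennreal (real ?n * r ^ (?n - 1)) * indicator {x. 0 < fst x \<and> p (snd x) \<le> 1 \<and> fst x * h (snd x) \<le> p (snd x)} (r, x) \<partial>lborel)"
    proof (rule nn_integral_cong_AE)
      have "AE r in lborel. r \<noteq> (0::real)" by (rule AE_lborel_singleton)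
      then show "AE r in lborel. ennreal (real ?n * r ^ (?n - 1)) * indicator {0..p x / h x} r * indicator {x. p x \<le> 1} x
         = ennreal (real ?n * r ^ (?n - 1)) * indicator {x. 0 < fst x \<and> p (snd x) \<le> 1 \<and> fst x * h (snd x) \<le> p (snd x)} (r, x)"
      proof eventually_elim
        fix r :: real assume "r \<noteq> 0"
        have "r \<le> p x / h x \<longleftrightarrow> r * h x \<le> p x" using pos(2)[OF x] by (simp add: pos_le_divide_eq)
        then show "ennreal (real ?n * r ^ (?n - 1)) * indicator {0..p x / h x} r * indicator {x. p x \<le> 1} x
         = ennreal (real ?n * r ^ (?n - 1)) * indicator {x. 0 < fst x \<and> p (snd x) \<le> 1 \<and> fst x * h (snd x) \<le> p (snd x)} (r, x)"
          using \<open>r \<noteq> 0\<close> by (auto simp: indicator_def)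
      qed
    qed
    finally show "ennreal ((p x / h x) ^ ?n) * indicator {x. p x \<le> 1} x
      = (\<integral>\<^sup>+r. ennreal (real ?n * r ^ (?n - 1)) * indicator {x. 0 < fst x \<and> p (snd x) \<le> 1 \<and> fst x * h (snd x) \<le> p (snd x)} (r, x) \<partial>lborel)" .
  qed
  also have "\<dots> = (\<integral>\<^sup>+r. (\<integral>\<^sup>+x. ennreal (real ?n * r ^ (?n - 1)) * indicator {x. 0 < fst x \<and> p (snd x) \<le> 1 \<and> fst x * h (snd x) \<le> p (snd x)} (r, x) \<partial>lborel) \<partial>lborel)"
    by (rule lborel_pair.Fubini') measurable
  also have "\<dots> = (\<integral>\<^sup>+r. (\<integral>\<^sup>+x. ennreal (real ?n / r) * indicator {x. 0 < fst x \<and> p (snd x) \<le> fst x \<and> fst x * h (snd x) \<le> p (snd x)} (r, x) \<partial>lborel) \<partial>lborel)"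
  proof (rule nn_integral_cong)
    fix r :: real
    show "(\<integral>\<^sup>+x. ennreal (real ?n * r ^ (?n - 1)) * indicator {x. 0 < fst x \<and> p (snd x) \<le> 1 \<and> fst x * h (snd x) \<le> p (snd x)} (r, x) \<partial>lborel)
      = (\<integral>\<^sup>+x. ennreal (real ?n / r) * indicator {x. 0 < fst x \<and> p (snd x) \<le> fst x \<and> fst x * h (snd x) \<le> p (snd x)} (r, x) \<partial>lborel)"
    proof (cases "0 < r")
      case True
      \<comment> \<open>Dilation by \<open>r\<close> multiplies volume by \<open>r ^ n\<close>,
        which reduces the weight to \<open>n / r\<close> and turns \<open>p x \<le> 1\<close> into
        \<open>p x \<le> r\<close>; the other condition is homogeneous and stays the same.\<close>
      let ?A = "{x. p x \<le> 1 \<and> r * h x \<le> p x}"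
      have A: "?A \<in> sets borel" by measurable
      have "(\<integral>\<^sup>+x. ennreal (real ?n * r ^ (?n - 1)) * indicator {x. 0 < fst x \<and> p (snd x) \<le> 1 \<and> fst x * h (snd x) \<le> p (snd x)} (r, x) \<partial>lborel)
        = (\<integral>\<^sup>+x. ennreal (real ?n * r ^ (?n - 1)) * indicator ?A x \<partial>lborel)"
        using True by (intro nn_integral_cong) (auto simp: indicator_def)
      also have "\<dots> = ennreal (real ?n * r ^ (?n - 1)) * emeasure lborel ?A"
        using A by (subst nn_integral_cmult) auto
      also have "\<dots> = ennreal (real ?n / r) * ennreal (r ^ ?n) * emeasure lborel ?A"
        using True n by (subst ennreal_mult'[symmetric]) (auto simp: power_eq_if)
      also have "ennreal (real ?n / r) * ennreal (r ^ ?n) * emeasure lborel ?A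
          = ennreal (real ?n / r) * emeasure lborel {x. (1 / r) *\<^sub>R x \<in> ?A}"
        using emeasure_lborel_scale[OF True A] by (simp add: mult.assoc)
      also have "{x. (1 / r) *\<^sub>R x \<in> ?A} = {x. p x \<le> r \<and> r * h x \<le> p x}"
      proof -
        have e: "p ((1 / r) *\<^sub>R x) = p x / r" "h ((1 / r) *\<^sub>R x) = h x / r" for x
          using hom[of "1 / r" x] True by auto
        have "p x / r \<le> 1 \<longleftrightarrow> p x \<le> r" "r * (h x / r) \<le> p x / r \<longleftrightarrow> r * h x \<le> p x" for x
          using True by (simp_all add: divide_simps mult.commute)
        then show ?thesis by (simp add: e)
      qed
      also have "ennreal (real ?n / r) * emeasure lborel {x. p x \<le> r \<and> r * h x \<le> p x}
         = (\<integral>\<^sup>+x. ennreal (real ?n / r) * indicator {x. p x \<le> r \<and> r * h x \<le> p x} x \<partial>lborel)"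
        by (subst nn_integral_cmult) auto
      also have "\<dots> = (\<integral>\<^sup>+x. ennreal (real ?n / r) * indicator {x. 0 < fst x \<and> p (snd x) \<le> fst x \<and> fst x * h (snd x) \<le> p (snd x)} (r, x) \<partial>lborel)"
        using True by (intro nn_integral_cong) (auto simp: indicator_def)
      finally show ?thesis .
    qed (simp add: indicator_def)
  qed
  also have "\<dots> = (\<integral>\<^sup>+x. (\<integral>\<^sup>+r. ennreal (real ?n / r) * indicator {x. 0 < fst x \<and> p (snd x) \<le> fst x \<and> fst x * h (snd x) \<le> p (snd x)} (r, x) \<partial>lborel) \<partial>lborel)"
    by (rule lborel_pair.Fubini'[symmetric]) measurable
  also have "\<dots> = (\<integral>\<^sup>+x. (\<integral>\<^sup>+r. ennreal (real ?n / r) * indicator {x. 0 < fst x \<and> h (snd x) \<le> fst x \<and> fst x \<le> 1} (r, x) \<partial>lborel) \<partial>lborel)"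
  proof (rule nn_integral_cong_AE, use ae in eventually_elim)
    fix x :: 'a assume x: "x \<noteq> 0"
    text \<open>The substitution \<open>r = (p x / h x) * s\<close> carries \<open>h x \<le> s \<le> 1\<close> to \<open>p x \<le> r \<le> p x / h x\<close> and preserves \<open>dr / r\<close>.\<close>
    define c where "c = p x / h x"
    have c: "0 < c" using pos x by (simp add: c_def)
    have J: "indicator {x. 0 < fst x \<and> p (snd x) \<le> fst x \<and> fst x * h (snd x) \<le> p (snd x)} (r, x)
      = (indicator {r. 0 < r \<and> p x \<le> r \<and> r * h x \<le> p x} r :: ennreal)" for r
      by (simp add: indicator_def)
    have mm: "(\<lambda>r. ennreal (real ?n / r) * indicator {x. 0 < fst x \<and> p (snd x) \<le> fst x \<and> fst x * h (snd x) \<le> p (snd x)} (r, x)) \<in> borel_measurable borel"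
      unfolding J by measurable
    have "(\<integral>\<^sup>+r. ennreal (real ?n / r) * indicator {x. 0 < fst x \<and> p (snd x) \<le> fst x \<and> fst x * h (snd x) \<le> p (snd x)} (r, x) \<partial>lborel)
      = ennreal c * (\<integral>\<^sup>+s. ennreal (real ?n / (c * s)) * indicator {x. 0 < fst x \<and> p (snd x) \<le> fst x \<and> fst x * h (snd x) \<le> p (snd x)} (c * s, x) \<partial>lborel)"
      using c by (subst nn_integral_real_affine[OF mm, of c 0]) auto
    also have "\<dots> = (\<integral>\<^sup>+s. ennreal c * (ennreal (real ?n / (c * s)) * indicator {x. 0 < fst x \<and> p (snd x) \<le> fst x \<and> fst x * h (snd x) \<le> p (snd x)} (c * s, x)) \<partial>lborel)"
      unfolding J by (rule nn_integral_cmult[symmetric]) measurable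
    also have "\<dots> = (\<integral>\<^sup>+s. ennreal (real ?n / s) * indicator {x. 0 < fst x \<and> h (snd x) \<le> fst x \<and> fst x \<le> 1} (s, x) \<partial>lborel)"
    proof (rule nn_integral_cong)
      fix s :: real
      have px: "0 < p x" "0 < h x" using pos x by auto
      have 1: "0 < c * s \<longleftrightarrow> 0 < s" using c by (simp add: zero_less_mult_iff)
      have 2: "p x \<le> c * s \<longleftrightarrow> h x \<le> s" using px by (simp add: c_def field_simps)
      have 3: "c * s * h x \<le> p x \<longleftrightarrow> s \<le> 1" using px by (simp add: c_def)
      have 4: "ennreal c * ennreal (real ?n / (c * s)) = ennreal (real ?n / s)" if "0 < s"
        using c that by (subst ennreal_mult'[symmetric]) auto
      show "ennreal c * (ennreal (real ?n / (c * s)) * indicator {x. 0 < fst x \<and> p (snd x) \<le> fst x \<and> fst x * h (snd x) \<le> p (snd x)} (c * s, x))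
        = ennreal (real ?n / s) * indicator {x. 0 < fst x \<and> h (snd x) \<le> fst x \<and> fst x \<le> 1} (s, x)"
        using 4 by (auto simp: indicator_def 1 2 3)
    qed
    finally show "(\<integral>\<^sup>+r. ennreal (real ?n / r) * indicator {x. 0 < fst x \<and> p (snd x) \<le> fst x \<and> fst x * h (snd x) \<le> p (snd x)} (r, x) \<partial>lborel)
       = (\<integral>\<^sup>+s. ennreal (real ?n / s) * indicator {x. 0 < fst x \<and> h (snd x) \<le> fst x \<and> fst x \<le> 1} (s, x) \<partial>lborel)" .
  qed
  finally show ?thesis .
qed

text \<open>Polar coordinates without a Jacobian: the preceding identity is used with
  \<open>p = h\<close>, where its left side is the volume sought, and with \<open>p = norm\<close>;
  its right side is the same for both.\<close>

lemma emeasure_star_body: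
  fixes h :: "'a::euclidean_space \<Rightarrow> real"
  assumes [measurable]: "h \<in> borel_measurable borel"
    and pos: "\<And>x. x \<noteq> 0 \<Longrightarrow> 0 < h x" and hom: "\<And>t x. 0 < t \<Longrightarrow> h (t *\<^sub>R x) = t * h x"
  shows "emeasure lborel {x. h x \<le> 1} = (\<integral>\<^sup>+x. ennreal (1 / h (x /\<^sub>R norm x) ^ DIM('a)) * indicator (cball 0 1 - {0}) x \<partial>lborel)"
proof -
  have ae: "AE x in lborel. x \<noteq> (0::'a)" by (rule AE_lborel_singleton)
  have "emeasure lborel {x. h x \<le> 1} = (\<integral>\<^sup>+x. indicator {x. h x \<le> 1} x \<partial>lborel)"
    by (rule nn_integral_indicator[symmetric]) measurable
  also have "\<dots> = (\<integral>\<^sup>+x. ennreal ((h x / h x) ^ DIM('a)) * indicator {x. h x \<le> 1} x \<partial>lborel)"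
  proof (rule nn_integral_cong_AE, use ae in eventually_elim)
    fix x :: 'a assume "x \<noteq> 0"
    then show "indicator {x. h x \<le> 1} x = ennreal ((h x / h x) ^ DIM('a)) * indicator {x. h x \<le> 1} x"
      using pos[of x] by simp
  qed
  also have "\<dots> = (\<integral>\<^sup>+x. ennreal ((norm x / h x) ^ DIM('a)) * indicator {x. norm x \<le> 1} x \<partial>lborel)"
    by (subst (1 2) homogeneous_gauge_integral) (auto simp: pos hom)
  also have "\<dots> = (\<integral>\<^sup>+x. ennreal (1 / h (x /\<^sub>R norm x) ^ DIM('a)) * indicator (cball 0 1 - {0}) x \<partial>lborel)"
  proof (rule nn_integral_cong_AE, use ae in eventually_elim)
    fix x :: 'a assume x: "x \<noteq> 0"
    have "h (x /\<^sub>R norm x) = h x / norm x" using hom[of "1 / norm x" x] x by (simp add: divide_inverse_commute)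
    then have "1 / h (x /\<^sub>R norm x) ^ DIM('a) = (norm x / h x) ^ DIM('a)" by (simp add: power_divide)
    then show "ennreal ((norm x / h x) ^ DIM('a)) * indicator {x. norm x \<le> 1} x
        = ennreal (1 / h (x /\<^sub>R norm x) ^ DIM('a)) * indicator (cball 0 1 - {0}) x"
      using x by (auto simp: indicator_def)
  qed
  finally show ?thesis .
qed

section \<open>Support functions, the sphere measure and the volume of polar bodies\<close>

lemma supp_lipschitz:
  fixes L :: "(real^'n) set"
  assumes L: "L \<noteq> {}" "\<And>x. x \<in> L \<Longrightarrow> norm x \<le> R"
  shows "\<bar>supp L u - supp L v\<bar> \<le> R * norm (u - v)"
proof -
  have b: "bounded L" using L by (auto simp: bounded_iff)
  have "supp L u \<le> supp L v + R * norm (u - v)" for u v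
  proof (rule supp_le[OF L(1)])
    fix x assume x: "x \<in> L"
    have "x \<bullet> u = x \<bullet> v + x \<bullet> (u - v)" by (simp add: inner_diff_right)
    also have "x \<bullet> (u - v) \<le> norm x * norm (u - v)" by (rule norm_cauchy_schwarz)
    also have "\<dots> \<le> R * norm (u - v)" using L(2)[OF x] by (intro mult_right_mono) auto
    finally show "x \<bullet> u \<le> supp L v + R * norm (u - v)" using supp_ge[OF b x, of v] by linarith
  qed
  from this[of u v] this[of v u] show ?thesis by (simp add: norm_minus_commute abs_le_iff)
qed

lemma continuous_supp:
  fixes L :: "(real^'n) set"
  assumes "L \<noteq> {}" "bounded L"
  shows "continuous_on UNIV (supp L)"
proof -
  obtain R where R: "0 < R" "\<And>x. x \<in> L \<Longrightarrow> norm x \<le> R" using assms(2) bounded_pos by blast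
  show ?thesis
  proof (rule continuous_onI)
    fix u :: "real^'n" and e :: real assume e: "0 < e"
    show "\<exists>d>0. \<forall>v\<in>UNIV. dist v u < d \<longrightarrow> dist (supp L v) (supp L u) \<le> e"
    proof (intro exI[of _ "e / R"] conjI ballI impI)
      fix v assume "dist v u < e / R"
      then have "R * norm (v - u) \<le> e" using R by (simp add: dist_norm pos_less_divide_eq mult.commute)
      then show "dist (supp L v) (supp L u) \<le> e"
        using supp_lipschitz[OF assms(1) R(2), of v u] by (simp add: dist_real_def)
    qed (use e R in simp)
  qed
qed

lemma supp_scale:
  fixes L :: "(real^'n) set"
  assumes "L \<noteq> {}" "bounded L" "0 < t"
  shows "supp L (t *\<^sub>R u) = t * supp L u"
proof (rule antisym)
  show "supp L (t *\<^sub>R u) \<le> t * supp L u"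
    using assms by (intro supp_le) (auto intro!: mult_left_mono supp_ge)
  have "supp L u \<le> supp L (t *\<^sub>R u) / t"
    using assms supp_ge[OF assms(2), of _ "t *\<^sub>R u"] by (intro supp_le) (auto simp: pos_le_divide_eq mult.commute)
  then show "t * supp L u \<le> supp L (t *\<^sub>R u)" using assms by (simp add: pos_le_divide_eq mult.commute)
qed

lemma polar_eq_supp:
  assumes "L \<noteq> {}" "bounded L" shows "polar L = {y. supp L y \<le> 1}"
proof -
  have "(\<forall>z\<in>L. y \<bullet> z \<le> 1) \<longleftrightarrow> supp L y \<le> 1" for y
    using supp_le[OF assms(1), of y 1] supp_ge[OF assms(2), of _ y] by (auto simp: inner_commute intro: order_trans)
  then show ?thesis by (simp add: polar_def)
qed

lemma nn_integral_sphere_measure: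
  fixes f :: "real^'n \<Rightarrow> ennreal"
  assumes [measurable]: "f \<in> borel_measurable borel"
  shows "(\<integral>\<^sup>+u. f u \<partial>sphere_measure) = ennreal (real CARD('n)) * (\<integral>\<^sup>+x. f (x /\<^sub>R norm x) * indicator (cball 0 1 - {0}) x \<partial>lborel)"
proof -
  have [measurable]: "cball 0 1 - {0} \<in> sets (borel :: (real^'n) measure)" by auto
  let ?R = "restrict_space lborel (cball 0 1 - {0}) :: (real^'n) measure"
  have [measurable]: "f \<in> borel_measurable (restrict_space borel (sphere 0 1))"
    by (rule measurable_restrict_space1) measurable
  have m[measurable]: "(\<lambda>x. x /\<^sub>R norm x) \<in> ?R \<rightarrow>\<^sub>M restrict_space borel (sphere 0 1)"
    by (intro measurable_restrict_space2 measurable_restrict_space1) (auto simp: space_restrict_space)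
  have "(\<integral>\<^sup>+u. f u \<partial>sphere_measure) = (\<integral>\<^sup>+u. ennreal (real CARD('n)) * f u \<partial>distr ?R (restrict_space borel (sphere 0 1)) (\<lambda>x. x /\<^sub>R norm x))"
    unfolding sphere_measure_def by (rule nn_integral_density) auto
  also have "\<dots> = (\<integral>\<^sup>+x. ennreal (real CARD('n)) * f (x /\<^sub>R norm x) \<partial>?R)"
    by (subst nn_integral_distr) auto
  also have "\<dots> = (\<integral>\<^sup>+x. ennreal (real CARD('n)) * f (x /\<^sub>R norm x) * indicator (cball 0 1 - {0}) x \<partial>lborel)"
    by (subst nn_integral_restrict_space) auto
  also have "\<dots> = ennreal (real CARD('n)) * (\<integral>\<^sup>+x. f (x /\<^sub>R norm x) * indicator (cball 0 1 - {0}) x \<partial>lborel)"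
    unfolding mult.assoc by (rule nn_integral_cmult) measurable
  finally show ?thesis .
qed

lemma space_sphere_measure: "space sphere_measure = sphere 0 1"
  by (simp add: sphere_measure_def space_restrict_space)

lemma borel_measurable_sphere_measure:
  assumes "f \<in> borel_measurable borel" shows "f \<in> borel_measurable sphere_measure"
proof -
  have "f \<in> borel_measurable (restrict_space borel (sphere 0 1))"
    using assms by (rule measurable_restrict_space1)
  then show ?thesis by (simp add: sphere_measure_def)
qed

lemma finite_sphere_measure: "finite_measure (sphere_measure :: (real^'n) measure)"
proof (rule finite_measureI)
  have bd: "bounded (cball 0 1 - {0} :: (real^'n) set)" by (rule bounded_subset[OF bounded_cball]) auto
  have "emeasure sphere_measure (space (sphere_measure :: (real^'n) measure)) = (\<integral>\<^sup>+u. 1 \<partial>(sphere_measure :: (real^'n) measure))"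
    by simp
  also have "\<dots> = ennreal (real CARD('n)) * emeasure lborel (cball 0 1 - {0} :: (real^'n) set)"
    by (subst nn_integral_sphere_measure) auto
  also have "ennreal (real CARD('n)) * emeasure lborel (cball 0 1 - {0} :: (real^'n) set) < \<infinity>"
    using emeasure_bounded_finite[OF bd] by (simp add: ennreal_mult_less_top)
  finally show "emeasure sphere_measure (space (sphere_measure :: (real^'n) measure)) \<noteq> \<infinity>" by (rule less_imp_neq)
qed

text \<open>The polar body is the star body of the gauge \<open>supp L\<close>, so
  \<open>emeasure_star_body\<close> applies; the integral over the punctured ball there is
  \<open>1 / n\<close> times an integral against \<open>sphere_measure\<close>.\<close>

lemma vol_polar:
  fixes L :: "(real^'n) set"
  assumes L: "L \<noteq> {}" "bounded L" and pos: "\<And>u. norm u = 1 \<Longrightarrow> 0 < supp L u"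
  shows "integrable sphere_measure (\<lambda>u. 1 / supp L u ^ CARD('n))"
    and "vol (polar L) = integral\<^sup>L sphere_measure (\<lambda>u. 1 / supp L u ^ CARD('n)) / real CARD('n)"
proof -
  have m[measurable]: "supp L \<in> borel_measurable borel"
    by (rule borel_measurable_continuous_onI[OF continuous_supp[OF L]])
  have pos': "0 < supp L x" if "x \<noteq> 0" for x
  proof -
    have "supp L x = norm x * supp L (x /\<^sub>R norm x)"
      using supp_scale[OF L, of "norm x" "x /\<^sub>R norm x"] that by simp
    then show ?thesis using pos[of "x /\<^sub>R norm x"] that by simp
  qed
  \<comment> \<open>Finiteness permits the passage from \<open>nn_integral\<close> to the Bochner
    integral. The minimum \<open>c\<close> of the support function on the sphere confines the polar
    body to the ball of radius \<open>1 / c\<close>.\<close>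
  have fin: "emeasure lborel (polar L) < \<infinity>"
  proof -
    have "continuous_on (sphere 0 1) (supp L)" using continuous_supp[OF L] continuous_on_subset by blast
    moreover have "sphere 0 1 \<noteq> ({} :: (real^'n) set)" by simp
    ultimately obtain u0 where u0: "u0 \<in> sphere 0 1" "\<And>u. u \<in> sphere 0 1 \<Longrightarrow> supp L u0 \<le> supp L u"
      using continuous_attains_inf[OF compact_sphere] by metis
    define c where "c = supp L u0"
    have c: "0 < c" using u0 pos by (simp add: c_def)
    have "norm x \<le> 1 / c" if "supp L x \<le> 1" for x
    proof (cases "x = 0")
      case False
      have "supp L x = norm x * supp L (x /\<^sub>R norm x)"
        using supp_scale[OF L, of "norm x" "x /\<^sub>R norm x"] False by simp
      moreover have "c \<le> supp L (x /\<^sub>R norm x)" using u0(2)[of "x /\<^sub>R norm x"] False by (simp add: c_def)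
      then have "norm x * c \<le> norm x * supp L (x /\<^sub>R norm x)" by (intro mult_left_mono) auto
      ultimately have "norm x * c \<le> 1" using that by linarith
      then show ?thesis using c by (simp add: pos_le_divide_eq)
    qed (use c in simp)
    then have "bounded (polar L)" unfolding polar_eq_supp[OF L] bounded_iff by blast
    then show ?thesis by (rule emeasure_bounded_finite)
  qed
  have em: "ennreal (real CARD('n)) * emeasure lborel (polar L) = (\<integral>\<^sup>+u. ennreal (1 / supp L u ^ CARD('n)) \<partial>sphere_measure)"
    unfolding polar_eq_supp[OF L]
    by (subst emeasure_star_body, auto simp: pos' supp_scale[OF L]) (subst nn_integral_sphere_measure, auto)
  have pm: "polar L \<in> sets borel" unfolding polar_eq_supp[OF L] by measurable
  have ms: "(\<lambda>u. 1 / supp L u ^ CARD('n)) \<in> borel_measurable sphere_measure"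
    by (rule borel_measurable_sphere_measure) measurable
  have nn: "AE u in sphere_measure. 0 \<le> 1 / supp L u ^ CARD('n)"
    by (rule AE_I2) (auto simp: space_sphere_measure pos less_imp_le)
  have "(\<integral>\<^sup>+u. ennreal (1 / supp L u ^ CARD('n)) \<partial>sphere_measure) < \<infinity>"
    unfolding em[symmetric] using fin by (simp add: ennreal_mult_less_top)
  then show "integrable sphere_measure (\<lambda>u. 1 / supp L u ^ CARD('n))"
    using ms nn by (intro integrableI_nonneg) auto
  have "integral\<^sup>L sphere_measure (\<lambda>u. 1 / supp L u ^ CARD('n)) = enn2real (ennreal (real CARD('n)) * emeasure lborel (polar L))"
    unfolding em using ms nn by (rule integral_eq_nn_integral)
  also have "\<dots> = real CARD('n) * vol (polar L)"
    using pm by (simp add: enn2real_mult vol_def measure_def)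
  finally show "vol (polar L) = integral\<^sup>L sphere_measure (\<lambda>u. 1 / supp L u ^ CARD('n)) / real CARD('n)" by simp
qed

section \<open>Inscribed balls and uniform depth bounds\<close>

lemma local_C2_defining_other_point:
  "local_C2_defining K x U g G H \<Longrightarrow> y \<in> U \<Longrightarrow> local_C2_defining K y U g G H"
  unfolding local_C2_defining_def by blast

text \<open>One set of local data serves all boundary points near \<open>x0\<close>, with
  \<open>norm (H y)\<close> bounded above by \<open>M\<close> and \<open>norm (G y)\<close> below by
  \<open>c\<close>. A point \<open>x + w\<close> of the ball satisfies
  \<open>(norm w)\<^sup>2 \<le> - (2 * r * (w \<bullet> u))\<close>, so the quadratic error of
  \<open>g\<close> is dominated by its linear decrease.\<close>

lemma rolling_ball_local:
  fixes K :: "(real^'n) set"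
  assumes K: "compact K" "convex K" and x0: "x0 \<in> frontier K" and loc0: "local_C2_defining K x0 U g G H"
  shows "\<exists>e>0. \<exists>r>0. \<forall>x\<in>frontier K \<inter> ball x0 e. \<forall>u. norm u = 1 \<longrightarrow> (\<forall>y\<in>K. (y - x) \<bullet> u \<le> 0)
     \<longrightarrow> cball (x - r *\<^sub>R u) r \<subseteq> K"
proof -
  interpret P: C2_boundary_point K x0 U g G H using K x0 loc0 by unfold_locales
  define M where "M = norm (H x0) + 1"
  define c where "c = norm (G x0) / 2"
  have M: "0 < M" by (simp add: M_def add_nonneg_pos)
  have c: "0 < c" using P.G0[OF P.U(2)] by (simp add: c_def)
  have "isCont H x0" using P.H_cont P.U continuous_on_eq_continuous_at by blast
  then have "isCont (\<lambda>y. norm (H y)) x0" by (rule continuous_norm)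
  then have "((\<lambda>y. norm (H y)) \<longlongrightarrow> norm (H x0)) (nhds x0)"
    unfolding continuous_at by (rule tendsto_at_iff_tendsto_nhds[THEN iffD1])
  then have "\<forall>\<^sub>F y in nhds x0. norm (H y) < M"
    unfolding M_def by (rule order_tendstoD) simp
  moreover have "isCont G x0" using P.G[OF P.U(2)] has_derivative_continuous by blast
  then have "isCont (\<lambda>y. norm (G y)) x0" by (rule continuous_norm)
  then have "((\<lambda>y. norm (G y)) \<longlongrightarrow> norm (G x0)) (nhds x0)"
    unfolding continuous_at by (rule tendsto_at_iff_tendsto_nhds[THEN iffD1])
  then have "\<forall>\<^sub>F y in nhds x0. c < norm (G y)"
    by (rule order_tendstoD) (use c in \<open>simp add: c_def\<close>)
  moreover have "\<forall>\<^sub>F y in nhds x0. y \<in> U" using P.U by (rule eventually_nhds_in_open)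
  ultimately have "\<forall>\<^sub>F y in nhds x0. norm (H y) < M \<and> c < norm (G y) \<and> y \<in> U" by eventually_elim simp
  then obtain e1 where e1: "0 < e1" "\<And>y. dist y x0 < e1 \<Longrightarrow> norm (H y) < M \<and> c < norm (G y) \<and> y \<in> U"
    unfolding eventually_nhds_metric by blast
  define e where "e = e1 / 2"
  have e: "0 < e" using e1 by (simp add: e_def)
  \<comment> \<open>\<open>e / 3\<close> keeps the ball, of diameter \<open>2 * r\<close>, inside
    the neighbourhood; the other bound gives \<open>2 * M * r \<le> c\<close>, which decides the
    sign of \<open>g\<close> at the end.\<close>
  define r where "r = min (e / 3) (c / (2 * M))"
  have r: "0 < r" "3 * r \<le> e" using e c M by (auto simp: r_def)
  have "r * (2 * M) \<le> c / (2 * M) * (2 * M)" using M by (intro mult_right_mono) (auto simp: r_def)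
  then have rM: "2 * M * r \<le> c" using M by (simp add: mult.commute)
  show ?thesis
  proof (rule exI[of _ e], rule conjI[OF e], rule exI[of _ r], intro conjI ballI allI impI r(1))
    fix x u assume x: "x \<in> frontier K \<inter> ball x0 e" and u: "norm u = 1" "\<forall>y\<in>K. (y - x) \<bullet> u \<le> 0"
    have xd: "dist x0 x < e" using x by simp
    have xU: "x \<in> U" using e1(2)[of x] xd e by (simp add: dist_commute e_def)
    interpret X: C2_boundary_point K x U g G H
      using K x local_C2_defining_other_point[OF loc0 xU] by unfold_locales auto
    have uN: "u = X.\<nu>" using X.supporting_unique u by blast
    show "cball (x - r *\<^sub>R u) r \<subseteq> K"
    proof
      fix z assume z: "z \<in> cball (x - r *\<^sub>R u) r"
      define w where "w = z - x"
      have wr: "norm (w + r *\<^sub>R u) \<le> r" using z by (simp add: w_def dist_norm norm_minus_commute algebra_simps)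
      have "norm w \<le> norm (w + r *\<^sub>R u) + norm (r *\<^sub>R u)" using norm_triangle_ineq4[of "w + r *\<^sub>R u" "r *\<^sub>R u"] by simp
      then have we: "norm w < e" using wr u r by simp
      have inB: "x + \<tau> *\<^sub>R w \<in> ball x0 e1" if "0 \<le> \<tau>" "\<tau> \<le> 1" for \<tau>
      proof -
        have "norm (\<tau> *\<^sub>R w) \<le> norm w" using that by (simp add: mult_left_le_one_le)
        moreover have "dist x0 (x + \<tau> *\<^sub>R w) \<le> dist x0 x + norm (\<tau> *\<^sub>R w)"
          using dist_triangle[of x0 "x + \<tau> *\<^sub>R w" x] by (simp add: dist_norm)
        ultimately show ?thesis using xd we by (simp add: e_def)
      qed
      have "(norm (w + r *\<^sub>R u))\<^sup>2 \<le> r\<^sup>2" using wr by (intro power_mono) auto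
      moreover have "(norm (w + r *\<^sub>R u))\<^sup>2 = (norm w)\<^sup>2 + 2 * r * (w \<bullet> u) + r\<^sup>2"
        using u(1) unfolding power2_norm_eq_inner norm_eq_1
        by (simp add: inner_add_left inner_add_right inner_commute power2_eq_square)
      ultimately have w2: "(norm w)\<^sup>2 \<le> - (2 * r * (w \<bullet> u))" by linarith
      have "0 \<le> - (2 * r * (w \<bullet> u))" using w2 zero_le_power2[of "norm w"] by linarith
      then have wu: "w \<bullet> u \<le> 0" using r by (simp add: mult_le_0_iff)
      let ?\<phi> = "\<lambda>\<tau>. g (x + \<tau> *\<^sub>R w)"
      have "\<exists>\<xi>>0. \<xi> < 1 \<and> ?\<phi> 1 - ?\<phi> 0 = (1 - 0) * (G (x + \<xi> *\<^sub>R w) \<bullet> w)"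
      proof (rule MVT2)
        fix \<tau> :: real assume "0 \<le> \<tau>" "\<tau> \<le> 1"
        then have "x + \<tau> *\<^sub>R w \<in> U" using inB[of \<tau>] e1(2) by (simp add: dist_commute)
        then show "DERIV ?\<phi> \<tau> :> G (x + \<tau> *\<^sub>R w) \<bullet> w" by (intro DERIV_along_line X.g)
      qed simp
      then obtain \<xi> where \<xi>: "0 < \<xi>" "\<xi> < 1" "g (x + w) = G (x + \<xi> *\<^sub>R w) \<bullet> w"
        using X.g_zero by auto
      have "norm (G (x + \<xi> *\<^sub>R w) - G x) \<le> M * norm ((x + \<xi> *\<^sub>R w) - x)"
      proof (rule differentiable_bound[of "ball x0 e1" G "\<lambda>y. blinfun_apply (H y)"])
        fix y assume y: "y \<in> ball x0 e1"
        then have y': "norm (H y) < M" "y \<in> U" using e1(2)[of y] by (auto simp: dist_commute)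
        show "(G has_derivative blinfun_apply (H y)) (at y within ball x0 e1)"
          using X.G[OF y'(2)] has_derivative_at_withinI by blast
        show "onorm (blinfun_apply (H y)) \<le> M" using y'(1) by (simp add: norm_blinfun.rep_eq)
      qed (use inB[of \<xi>] inB[of 0] \<xi> in auto)
      then have dG: "norm (G (x + \<xi> *\<^sub>R w) - G x) \<le> M * norm w"
        using \<xi> M mult_left_le_one_le[of "norm w" \<xi>] by (simp add: order_trans[OF _ mult_left_mono])
      have "g (x + w) = G x \<bullet> w + (G (x + \<xi> *\<^sub>R w) - G x) \<bullet> w" using \<xi>(3) by (simp add: inner_diff_left)
      also have "(G (x + \<xi> *\<^sub>R w) - G x) \<bullet> w \<le> norm (G (x + \<xi> *\<^sub>R w) - G x) * norm w" by (rule norm_cauchy_schwarz)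
      also have "\<dots> \<le> (M * norm w) * norm w" using dG by (intro mult_right_mono) auto
      also have "\<dots> = M * (norm w)\<^sup>2" by (simp add: power2_eq_square)
      also have "\<dots> \<le> M * (- (2 * r * (w \<bullet> u)))" using w2 M by (intro mult_left_mono) auto
      also have "G x \<bullet> w = norm (G x) * (w \<bullet> u)" using X.G_eq uN by (metis inner_commute inner_scaleR_right)
      also have "norm (G x) * (w \<bullet> u) \<le> c * (w \<bullet> u)"
        using e1(2)[of x] xd e wu by (intro mult_right_mono_neg) (auto simp: dist_commute e_def)
      finally have "g (x + w) \<le> (c - 2 * M * r) * (w \<bullet> u)" by (simp add: algebra_simps)
      also have "\<dots> \<le> 0" using rM wu by (intro mult_nonneg_nonpos) auto
      finally have "g (x + w) \<le> 0" .
      moreover have "x + w \<in> U" using inB[of 1] e1(2)[of "x + w"] by (simp add: dist_commute)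
      ultimately show "z \<in> K" using X.K_iff by (simp add: w_def)
    qed
  qed
qed

text \<open>Compactness of the frontier makes the local radii uniform. Passing to a smaller radius
  is harmless, because balls tangent at \<open>x\<close> from the same side are nested.\<close>

lemma rolling_ball:
  fixes K :: "(real^'n) set"
  assumes K: "compact K" "convex K" and C2: "C2_boundary K"
  shows "\<exists>r>0. \<forall>x\<in>frontier K. \<forall>u. norm u = 1 \<longrightarrow> (\<forall>y\<in>K. (y - x) \<bullet> u \<le> 0) \<longrightarrow> cball (x - r *\<^sub>R u) r \<subseteq> K"
proof -
  have "\<forall>x0\<in>frontier K. \<exists>e>0. \<exists>r>0. \<forall>x\<in>frontier K \<inter> ball x0 e. \<forall>u. norm u = 1 \<longrightarrow> (\<forall>y\<in>K. (y - x) \<bullet> u \<le> 0)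
     \<longrightarrow> cball (x - r *\<^sub>R u) r \<subseteq> K"
    using C2 rolling_ball_local[OF K] unfolding C2_boundary_def by metis
  then obtain e r where er: "\<And>x0. x0 \<in> frontier K \<Longrightarrow> 0 < e x0" "\<And>x0. x0 \<in> frontier K \<Longrightarrow> 0 < (r x0 :: real)"
    and b: "\<And>x0 x u. x0 \<in> frontier K \<Longrightarrow> x \<in> frontier K \<inter> ball x0 (e x0) \<Longrightarrow> norm u = 1 \<Longrightarrow> (\<forall>y\<in>K. (y - x) \<bullet> u \<le> 0)
     \<Longrightarrow> cball (x - r x0 *\<^sub>R u) (r x0) \<subseteq> K"
    by metis
  have "frontier K \<subseteq> (\<Union>x0\<in>frontier K. ball x0 (e x0))" using er(1) by force
  then obtain T where T: "T \<subseteq> frontier K" "finite T" "frontier K \<subseteq> (\<Union>x0\<in>T. ball x0 (e x0))"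
    using compactE_image[OF compact_frontier[OF K(1)], of "frontier K" "\<lambda>x0. ball x0 (e x0)"] by auto
  define r0 where "r0 = Min (insert 1 (r ` T))"
  have r0: "0 < r0" "\<And>x0. x0 \<in> T \<Longrightarrow> r0 \<le> r x0"
    using T er(2) by (auto simp: r0_def)
  show ?thesis
  proof (intro exI[of _ r0] conjI ballI allI impI r0(1))
    fix x u assume x: "x \<in> frontier K" and u: "norm u = 1" "\<forall>y\<in>K. (y - x) \<bullet> u \<le> 0"
    obtain x0 where x0: "x0 \<in> T" "x \<in> ball x0 (e x0)" using T(3) x by blast
    have "cball (x - r0 *\<^sub>R u) r0 \<subseteq> cball (x - r x0 *\<^sub>R u) (r x0)"
    proof
      fix z assume "z \<in> cball (x - r0 *\<^sub>R u) r0"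
      then have 1: "norm (x - r0 *\<^sub>R u - z) \<le> r0" by (simp add: dist_norm)
      have "x - r x0 *\<^sub>R u - z = (x - r0 *\<^sub>R u - z) - (r x0 - r0) *\<^sub>R u" by (simp add: algebra_simps)
      then have "norm (x - r x0 *\<^sub>R u - z) \<le> norm (x - r0 *\<^sub>R u - z) + norm ((r x0 - r0) *\<^sub>R u)"
        by (metis norm_triangle_ineq4)
      also have "\<dots> \<le> r x0" using 1 u(1) r0(2)[OF x0(1)] by simp
      finally show "z \<in> cball (x - r x0 *\<^sub>R u) (r x0)" by (simp add: dist_norm)
    qed
    also have "\<dots> \<subseteq> K" using b[of x0 x u] x0 x u T(1) by blast
    finally show "cball (x - r0 *\<^sub>R u) r0 \<subseteq> K" .
  qed
qed

text \<open>The ellipsoid argument applied to the inscribed balls. The constant is not sharp, but it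
  serves all directions simultaneously, and the points produced also show that the floating body is
  nonempty.\<close>

lemma floating_body_depth_uniform:
  fixes K :: "(real^'n) set"
  assumes K: "compact K" "convex K" and C2: "C2_boundary K" and K0: "0 < vol K"
  shows "\<exists>C>0. \<forall>\<^sub>F d in at_right 0. \<forall>x\<in>frontier K. \<forall>u. norm u = 1 \<longrightarrow> (\<forall>y\<in>K. (y - x) \<bullet> u \<le> 0) \<longrightarrow>
     x - (C * d powr (2 / (real CARD('n) + 1))) *\<^sub>R u \<in> floating_body K d"
proof -
  let ?n = "real CARD('n)" and ?c = "cap_const CARD('n)"
  obtain r where r: "0 < r" "\<And>x u. x \<in> frontier K \<Longrightarrow> norm u = 1 \<Longrightarrow> (\<forall>y\<in>K. (y - x) \<bullet> u \<le> 0) \<Longrightarrow> cball (x - r *\<^sub>R u) r \<subseteq> K"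
    using rolling_ball[OF K C2] by blast
  define P where "P = (?n + 1) / 2"
  define Q where "Q = (?n - 1) / 2"
  have n1: "1 \<le> ?n" by (simp add: Suc_leI)
  have PQ: "0 \<le> Q" "0 < P" using n1 by (auto simp: P_def Q_def)
  have c: "0 < ?c" by (rule cap_const_pos) (simp add: Suc_leI)
  \<comment> \<open>Chosen so that \<open>(cap_const n * C) powr P * r ^ n = 2 powr Q\<close>, which
    compensates the factor \<open>(1 - s / 2) powr Q\<close> as long as \<open>s \<le> 1\<close>.
    Depth \<open>s\<close> in the unit ball is depth \<open>r * s\<close> in \<open>K\<close>, hence
    the final constant \<open>r * C\<close>.\<close>
  define C where "C = (2 powr Q / r ^ CARD('n)) powr (1 / P) / ?c"
  have C: "0 < C" using r c by (simp add: C_def)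
  have cC: "(?c * C) powr P = 2 powr Q / r ^ CARD('n)"
    using c r PQ by (simp add: C_def powr_powr)
  have "\<forall>\<^sub>F d in at_right 0. C * d powr (2 / (?n + 1)) < 1"
    using n1 by (intro eventually_powr_small) auto
  with eventually_less_at_right_0[OF K0]
  have "\<forall>\<^sub>F d in at_right 0. \<forall>x\<in>frontier K. \<forall>u. norm u = 1 \<longrightarrow> (\<forall>y\<in>K. (y - x) \<bullet> u \<le> 0) \<longrightarrow>
     x - (r * C * d powr (2 / (?n + 1))) *\<^sub>R u \<in> floating_body K d"
  proof eventually_elim
    fix d assume d: "0 < d \<and> d < vol K" and s': "C * d powr (2 / (?n + 1)) < 1"
    define s where "s = C * d powr (2 / (?n + 1))"
    have s: "0 \<le> s" "s \<le> 1" using C s' by (auto simp: s_def)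
    let ?A = "\<lambda>y::real^'n. r *\<^sub>R y"
    have lin: "linear ?A" by (rule linearI) (simp_all add: algebra_simps)
    have det: "det (matrix ?A) = r ^ CARD('n)"
      by (subst det_diagonal) (auto simp: matrix_def axis_def)
    have dv: "d \<le> \<bar>det (matrix ?A)\<bar> * ((?c * s) powr ((?n + 1) / 2) * (1 - s / 2) powr ((?n - 1) / 2))"
    proof -
      have e1: "2 / (?n + 1) * P = 1" using n1 by (simp add: P_def)
      have "(?c * s) powr P = (?c * C) powr P * (d powr (2 / (?n + 1))) powr P"
        using c C by (simp add: s_def powr_mult mult.assoc[symmetric])
      also have "\<dots> = 2 powr Q / r ^ CARD('n) * d" unfolding cC powr_powr e1 using d by simp
      finally have 1: "\<bar>det (matrix ?A)\<bar> * ((?c * s) powr P * (1 - s / 2) powr Q) = (2 powr Q * (1 - s / 2) powr Q) * d"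
        using r by (simp add: det)
      have "1 \<le> (2 * (1 - s / 2)) powr Q" using s PQ by (intro ge_one_powr_ge_zero) auto
      then have "1 \<le> 2 powr Q * (1 - s / 2) powr Q" using s by (simp only: powr_mult)
      then have "1 * d \<le> (2 powr Q * (1 - s / 2) powr Q) * d" using d by (intro mult_right_mono) auto
      then show ?thesis unfolding P_def[symmetric] Q_def[symmetric] 1 by simp
    qed
    show "\<forall>x\<in>frontier K. \<forall>u. norm u = 1 \<longrightarrow> (\<forall>y\<in>K. (y - x) \<bullet> u \<le> 0) \<longrightarrow>
     x - (r * C * d powr (2 / (?n + 1))) *\<^sub>R u \<in> floating_body K d"
    proof (intro ballI allI impI)
      fix x u assume x: "x \<in> frontier K" and u: "norm u = 1" "\<forall>y\<in>K. (y - x) \<bullet> u \<le> 0"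
      have "(\<lambda>y. (x - r *\<^sub>R u) + ?A y) ` cball 0 1 \<subseteq> cball (x - r *\<^sub>R u) r"
        using r by (auto simp: dist_norm mult_left_le)
      also have "\<dots> \<subseteq> K" by (rule r(2)[OF x u])
      finally have "(x - r *\<^sub>R u) + ?A ((1 - s) *\<^sub>R u) \<in> floating_body K d"
        using d s u by (intro ellipsoid_point_in_floating_body[OF K _ _ lin _ s _ dv]) auto
      then show "x - (r * C * d powr (2 / (?n + 1))) *\<^sub>R u \<in> floating_body K d"
        by (simp add: s_def algebra_simps)
    qed
  qed
  then show ?thesis using r C by (intro exI[of _ "r * C"]) auto
qed

section \<open>The limit\<close>

lemma outer_normal_local:
  assumes "C2_boundary K" "x \<in> frontier K"
  shows "\<exists>U g G H. local_C2_defining K x U g G H \<and> outer_normal K x = G x /\<^sub>R norm (G x)"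
  unfolding outer_normal_def
  by (rule someI_ex) (use assms in \<open>unfold C2_boundary_def, blast\<close>)

lemma gauss_curvature_local:
  assumes "C2_boundary K" "x \<in> frontier K"
  shows "\<exists>U g G H. local_C2_defining K x U g G H \<and>
    gauss_curvature K x = det (matrix (shape_ext (G x) (blinfun_apply (H x))))"
  unfolding gauss_curvature_def
  by (rule someI_ex) (use assms in \<open>unfold C2_boundary_def, blast\<close>)

lemma outer_normal_supports:
  fixes K :: "(real^'n) set"
  assumes K: "compact K" "convex K" and C2: "C2_boundary K" and x: "x \<in> frontier K" and y: "y \<in> K"
  shows "(y - x) \<bullet> outer_normal K x \<le> 0"
proof -
  obtain U g G H where l: "local_C2_defining K x U g G H" "outer_normal K x = G x /\<^sub>R norm (G x)"
    using outer_normal_local[OF C2 x] by blast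
  interpret C2_boundary_point K x U g G H using K x l by unfold_locales
  show ?thesis using normal_supports'[OF y] l(2) by (simp add: \<nu>_def)
qed

lemma outer_normal_eqI:
  fixes K :: "(real^'n) set"
  assumes K: "compact K" "convex K" and C2: "C2_boundary K" and x: "x \<in> frontier K"
    and u: "norm u = 1" "\<And>y. y \<in> K \<Longrightarrow> (y - x) \<bullet> u \<le> 0"
  shows "outer_normal K x = u"
proof -
  obtain U g G H where l: "local_C2_defining K x U g G H" "outer_normal K x = G x /\<^sub>R norm (G x)"
    using outer_normal_local[OF C2 x] by blast
  interpret C2_boundary_point K x U g G H using K x l by unfold_locales
  show ?thesis using supporting_unique[OF u] l(2) by (simp add: \<nu>_def)
qed

text \<open>The local data used here are those behind \<open>gauss_curvature\<close>, while
  \<open>outer_normal\<close> may rest on others; both normals equal \<open>u\<close>, the only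
  supporting direction at \<open>x\<close>. A second boundary point with normal \<open>u\<close>
  would lie in the tangent hyperplane at \<open>x\<close>, so \<open>touching_unique\<close>
  resolves the \<open>THE\<close> in \<open>fK\<close>.\<close>

lemma curvature_support_limit:
  fixes K :: "(real^'n) set"
  assumes K: "compact K" "convex K" and C2: "C2_boundary K" and K0: "0 < vol K"
    and curv: "\<forall>x\<in>frontier K. gauss_curvature K x > 0"
    and x: "x \<in> frontier K" and u: "norm u = 1" "\<And>y. y \<in> K \<Longrightarrow> (y - x) \<bullet> u \<le> 0"
  shows "fK K u = 1 / gauss_curvature K x"
    and "((\<lambda>d. cap_const CARD('n) * (x \<bullet> u - supp (floating_body K d) u) / d powr (2 / (real CARD('n) + 1)))
    \<longlongrightarrow> gauss_curvature K x powr (1 / (real CARD('n) + 1))) (at_right 0)"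
proof -
  obtain U g G H where l: "local_C2_defining K x U g G H"
    "gauss_curvature K x = det (matrix (shape_ext (G x) (blinfun_apply (H x))))"
    using gauss_curvature_local[OF C2 x] by blast
  interpret C2_boundary_point K x U g G H using K x l by unfold_locales
  have un: "u = \<nu>" by (rule supporting_unique[OF u])
  have \<kappa>: "0 < gauss_curvature K x" using curv x by blast
  have "(THE x. x \<in> frontier K \<and> outer_normal K x = u) = x"
  proof (rule the_equality)
    show "x \<in> frontier K \<and> outer_normal K x = u" using outer_normal_eqI[OF K C2 x u] x by blast
    fix x' assume x': "x' \<in> frontier K \<and> outer_normal K x' = u"
    then have "x' \<in> K" using K frontier_subset_closed compact_imp_closed by blast
    have "(x - x') \<bullet> u \<le> 0" using outer_normal_supports[OF K C2 _ x_mem] x' by blast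
    then have "(x' - x) \<bullet> \<nu> = 0" using u(2)[OF \<open>x' \<in> K\<close>] un by (simp add: inner_diff_left)
    then show "x' = x" using touching_unique[OF _ \<open>x' \<in> K\<close>] \<kappa> l(2) by simp
  qed
  then show "fK K u = 1 / gauss_curvature K x" by (simp add: fK_def)
  show "((\<lambda>d. cap_const CARD('n) * (x \<bullet> u - supp (floating_body K d) u) / d powr (2 / (real CARD('n) + 1)))
    \<longlongrightarrow> gauss_curvature K x powr (1 / (real CARD('n) + 1))) (at_right 0)"
    unfolding un by (rule supp_floating_body_limit[OF l(2) \<kappa> K0])
qed

text \<open>Splits off the difference \<open>x - y\<close>, which becomes the depth and carries the
  rate of convergence, from a factor that converges and stays bounded.\<close>

lemma inverse_power_diff:
  fixes x y :: real
  assumes "x \<noteq> 0" "y \<noteq> 0"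
  shows "1 / y ^ n - 1 / x ^ n = (x - y) * (\<Sum>i<n. y ^ (n - Suc i) * x ^ i) / (y ^ n * x ^ n)"
proof -
  have "1 / y ^ n - 1 / x ^ n = (x ^ n - y ^ n) / (y ^ n * x ^ n)" using assms by (simp add: field_simps)
  then show ?thesis by (simp only: power_diff_sumr2)
qed

lemma polar_floating_body_limit:
  fixes K :: "(real^'n) set"
  assumes K: "compact K" "convex K" and int0: "0 \<in> interior K" and C2: "C2_boundary K"
    and curv: "\<forall>x\<in>frontier K. gauss_curvature K x > 0"
  shows "((\<lambda>d. cap_const CARD('n) * (vol (polar (floating_body K d)) - vol (polar K)) / d powr (2 / (real CARD('n) + 1)))
     \<longlongrightarrow> integral\<^sup>L sphere_measure
                 (\<lambda>u. 1 / (fK K u powr (1 / (real CARD('n) + 1)) * supp K u ^ (CARD('n) + 1)))) (at_right 0)"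
proof -
  let ?N = "CARD('n)"
  define n where "n = real ?N"
  define a where "a = 2 / (n + 1)"
  define c where "c = cap_const ?N"
  define h where "h = supp K"
  define k where "k d = supp (floating_body K d)" for d
  \<comment> \<open>The division by \<open>n\<close> is that of \<open>vol_polar\<close>, so the
    integral of \<open>F d\<close> over the sphere is the quotient in the claim.\<close>
  define F where "F d u = c / (n * d powr a) * (1 / k d u ^ ?N - 1 / h u ^ ?N)" for d and u :: "real^'n"
  define L where "L u = 1 / (fK K u powr (1 / (n + 1)) * h u ^ (?N + 1))" for u
  have n: "1 \<le> n" by (simp add: n_def Suc_leI)
  have c: "0 < c" unfolding c_def by (rule cap_const_pos) (simp add: Suc_leI)
  have a: "0 < a" using n by (simp add: a_def)
  have Kne: "K \<noteq> {}" using int0 interior_subset by blast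
  have Kb: "bounded K" by (rule compact_imp_bounded[OF K(1)])
  have K0: "0 < vol K" using vol_pos[OF K(1)] int0 by blast
  obtain m where m: "0 < m" "cball 0 m \<subseteq> K" using int0 mem_interior_cball by blast
  obtain R where R: "0 < R" "\<And>x. x \<in> K \<Longrightarrow> norm x \<le> R" using Kb bounded_pos by blast
  have hm: "m \<le> h u" and hR: "h u \<le> R" if u: "norm u = 1" for u
  proof -
    have "m *\<^sub>R u \<in> K" using m u by (intro subsetD[OF m(2)]) simp
    moreover have "u \<bullet> u = 1" using u norm_eq_1 by blast
    ultimately show "m \<le> h u" using supp_ge[OF Kb, of "m *\<^sub>R u" u] by (simp add: h_def)
    show "h u \<le> R" unfolding h_def
    proof (rule supp_le[OF Kne])
      fix x assume "x \<in> K"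
      then show "x \<bullet> u \<le> R" using norm_cauchy_schwarz[of x u] R(2) u by fastforce
    qed
  qed
  have touch: "\<exists>x\<in>frontier K. h u = x \<bullet> u \<and> (\<forall>y\<in>K. (y - x) \<bullet> u \<le> 0)" if u: "norm u = 1" for u
  proof -
    have "u \<noteq> 0" using u by auto
    then obtain x where x: "x \<in> frontier K" "x \<in> K" "\<And>y. y \<in> K \<Longrightarrow> y \<bullet> u \<le> x \<bullet> u"
      using frontier_support_point[OF K(1) Kne] by metis
    then have "h u = x \<bullet> u" unfolding h_def by (intro supp_eqI)
    with x show ?thesis by (intro bexI[of _ x]) (auto simp: inner_diff_left)
  qed
  obtain C where C: "0 < C" "\<forall>\<^sub>F d in at_right 0. \<forall>x\<in>frontier K. \<forall>u. norm u = 1 \<longrightarrow> (\<forall>y\<in>K. (y - x) \<bullet> u \<le> 0) \<longrightarrow>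
     x - (C * d powr a) *\<^sub>R u \<in> floating_body K d"
    using floating_body_depth_uniform[OF K C2 K0] unfolding a_def n_def by blast
  have fb: "bounded (floating_body K d)" for d
    using bounded_subset[OF Kb floating_body_subset] .
  \<comment> \<open>Collects what the estimates below require of \<open>d\<close>, uniformly in
    \<open>u\<close>. The bound by \<open>m / 2\<close> keeps the reciprocal powers of
    \<open>k d u\<close> under control.\<close>
  define E where "E d \<longleftrightarrow> 0 < d \<and> floating_body K d \<noteq> {} \<and>
     (\<forall>u. norm u = 1 \<longrightarrow> m / 2 \<le> k d u \<and> k d u \<le> h u \<and> h u - k d u \<le> C * d powr a)" for d
  have evE: "\<forall>\<^sub>F d in at_right 0. E d"
  proof -
    have "\<forall>\<^sub>F d in at_right 0. C * d powr a < m / 2" using a m by (intro eventually_powr_small) auto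
    moreover have "\<forall>\<^sub>F d in at_right (0::real). 0 < d" by (rule eventually_at_right_less)
    ultimately show ?thesis using C(2)
    proof eventually_elim
      fix d :: real
      assume Cd: "C * d powr a < m / 2" and d: "0 < d"
        and p: "\<forall>x\<in>frontier K. \<forall>u. norm u = 1 \<longrightarrow> (\<forall>y\<in>K. (y - x) \<bullet> u \<le> 0) \<longrightarrow>
         x - (C * d powr a) *\<^sub>R u \<in> floating_body K d"
      have pt: "floating_body K d \<noteq> {} \<and> h u - C * d powr a \<le> k d u" if u: "norm u = 1" for u
      proof -
        obtain x where x: "x \<in> frontier K" "h u = x \<bullet> u" "\<forall>y\<in>K. (y - x) \<bullet> u \<le> 0" using touch[OF u] by blast
        have q: "x - (C * d powr a) *\<^sub>R u \<in> floating_body K d" using p x u by blast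
        have "u \<bullet> u = 1" using u norm_eq_1 by blast
        then have "h u - C * d powr a \<le> k d u"
          using supp_ge[OF fb q, of u] x(2) by (simp add: k_def inner_diff_left)
        then show ?thesis using q by blast
      qed
      obtain u0 :: "real^'n" where "norm u0 = 1" using vector_choose_size[of 1] by auto
      then have ne: "floating_body K d \<noteq> {}" using pt by blast
      have "k d u \<le> h u" for u
        unfolding k_def h_def using floating_body_subset[of K d] by (intro supp_le[OF ne] supp_ge[OF Kb]) auto
      moreover have "m / 2 \<le> k d u" "h u - k d u \<le> C * d powr a" if "norm u = 1" for u
        using pt[OF that] hm[OF that] Cd by linarith+
      ultimately show "E d" unfolding E_def using d ne by blast
    qed
  qed
  have pw: "((\<lambda>d. F d u) \<longlongrightarrow> L u) (at_right 0)" if u: "norm u = 1" for u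
  proof -
    obtain x where x: "x \<in> frontier K" "h u = x \<bullet> u" "\<And>y. y \<in> K \<Longrightarrow> (y - x) \<bullet> u \<le> 0" using touch[OF u] by blast
    define \<kappa> where "\<kappa> = gauss_curvature K x"
    have \<kappa>: "0 < \<kappa>" using curv x by (simp add: \<kappa>_def)
    note cl = curvature_support_limit[OF K C2 K0 curv x(1) u x(3)]
    have f1: "((\<lambda>d. c * (h u - k d u) / d powr a) \<longlongrightarrow> \<kappa> powr (1 / (n + 1))) (at_right 0)"
      using cl(2) by (simp add: c_def k_def a_def n_def \<kappa>_def x(2))
    have h0: "0 < h u" using hm[OF u] m by simp
    note d0 = powr_tendsto_zero_at_right[OF a]
    have ev0: "\<forall>\<^sub>F d in at_right (0::real). 0 < d" by (rule eventually_at_right_less)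
    \<comment> \<open>Multiplying the convergent depth quotient by \<open>d powr a\<close>, which
      tends to 0, yields the convergence of \<open>k d u\<close> to \<open>h u\<close>.\<close>
    have "((\<lambda>d. h u - (c * (h u - k d u) / d powr a) * (d powr a) / c) \<longlongrightarrow> h u - \<kappa> powr (1 / (n + 1)) * 0 / c) (at_right 0)"
      using c by (intro tendsto_intros f1 d0) auto
    moreover have "\<forall>\<^sub>F d in at_right 0. h u - (c * (h u - k d u) / d powr a) * (d powr a) / c = k d u"
      using ev0 by eventually_elim (use c in simp)
    ultimately have kl: "((\<lambda>d. k d u) \<longlongrightarrow> h u) (at_right 0)"
      using tendsto_cong[of _ "\<lambda>d. k d u"] by (simp add: tendsto_cong)
    have "((\<lambda>d. (c * (h u - k d u) / d powr a) * ((\<Sum>i<?N. k d u ^ (?N - Suc i) * h u ^ i) / (k d u ^ ?N * h u ^ ?N)) / n)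
       \<longlongrightarrow> \<kappa> powr (1 / (n + 1)) * ((\<Sum>i<?N. h u ^ (?N - Suc i) * h u ^ i) / (h u ^ ?N * h u ^ ?N)) / n) (at_right 0)"
      using h0 n by (intro tendsto_intros f1 kl) auto
    moreover have "\<forall>\<^sub>F d in at_right 0. (c * (h u - k d u) / d powr a) * ((\<Sum>i<?N. k d u ^ (?N - Suc i) * h u ^ i) / (k d u ^ ?N * h u ^ ?N)) / n = F d u"
      using evE
    proof eventually_elim
      fix d assume E: "E d"
      then have "k d u \<noteq> 0" using u m unfolding E_def by fastforce
      then show "(c * (h u - k d u) / d powr a) * ((\<Sum>i<?N. k d u ^ (?N - Suc i) * h u ^ i) / (k d u ^ ?N * h u ^ ?N)) / n = F d u"
        unfolding F_def using h0 by (subst inverse_power_diff) (auto simp: mult_ac)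
    qed
    ultimately have "((\<lambda>d. F d u) \<longlongrightarrow> \<kappa> powr (1 / (n + 1)) * ((\<Sum>i<?N. h u ^ (?N - Suc i) * h u ^ i) / (h u ^ ?N * h u ^ ?N)) / n) (at_right 0)"
      by (rule Lim_transform_eventually)
    also have "\<kappa> powr (1 / (n + 1)) * ((\<Sum>i<?N. h u ^ (?N - Suc i) * h u ^ i) / (h u ^ ?N * h u ^ ?N)) / n = L u"
    proof -
      \<comment> \<open>In the limit all summands coincide, and their number cancels the division by
        \<open>n\<close>.\<close>
      have "(\<Sum>i<?N. h u ^ (?N - Suc i) * h u ^ i) = (\<Sum>i<?N. h u ^ (?N - 1))"
        by (intro sum.cong) (auto simp: power_add[symmetric])
      also have "\<dots> = n * h u ^ (?N - 1)" by (simp add: n_def)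
      finally have s: "(\<Sum>i<?N. h u ^ (?N - Suc i) * h u ^ i) = n * h u ^ (?N - 1)" .
      have e: "h u ^ ?N = h u * h u ^ (?N - 1)" by (rule power_eq_if[THEN trans]) simp
      have "fK K u = 1 / \<kappa>" using cl(1) by (simp add: \<kappa>_def)
      then have "fK K u powr (1 / (n + 1)) = 1 / \<kappa> powr (1 / (n + 1))"
        using \<kappa> by (simp add: powr_divide)
      then have Lu: "L u = \<kappa> powr (1 / (n + 1)) / (h u ^ ?N * h u)" by (simp add: L_def mult.commute)
      have q: "h u ^ (?N - 1) / (h u ^ ?N * h u ^ ?N) = 1 / (h u ^ ?N * h u)"
        using h0 by (subst (2) e) simp
      have "\<kappa> powr (1 / (n + 1)) * (n * X / D) / n = \<kappa> powr (1 / (n + 1)) * (X / D)" for X D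
        using n by simp
      then show ?thesis unfolding s Lu by (simp only: q) simp
    qed
    finally show ?thesis .
  qed
  \<comment> \<open>Both support functions are at most \<open>R\<close>, and \<open>m / 2\<close>
    and \<open>m\<close> are lower bounds for \<open>k d u\<close> and \<open>h u\<close>. The depth
    is at most \<open>C * d powr a\<close>, whose power of \<open>d\<close> cancels.\<close>
  define W where "W = c * C * R ^ (?N - 1) / ((m / 2) ^ ?N * m ^ ?N)"
  have bound: "\<bar>F d u\<bar> \<le> W" if E: "E d" and u: "norm u = 1" for d u
  proof -
    have d: "0 < d" and k: "m / 2 \<le> k d u" "k d u \<le> h u" "h u - k d u \<le> C * d powr a"
      using E u by (auto simp: E_def)
    have k0: "0 < k d u" and h0: "0 < h u" using k m by linarith+
    let ?s = "\<Sum>i<?N. k d u ^ (?N - Suc i) * h u ^ i"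
    have s0: "0 \<le> ?s" using k0 h0 by (intro sum_nonneg) simp
    have "?s \<le> (\<Sum>i<?N. R ^ (?N - 1))"
    proof (rule sum_mono)
      fix i assume i: "i \<in> {..<?N}"
      have "k d u ^ (?N - Suc i) * h u ^ i \<le> R ^ (?N - Suc i) * R ^ i"
        using k k0 h0 hR[OF u] R by (intro mult_mono power_mono) auto
      also have "\<dots> = R ^ (?N - 1)" using i by (simp add: power_add[symmetric])
      finally show "k d u ^ (?N - Suc i) * h u ^ i \<le> R ^ (?N - 1)" .
    qed
    then have s1: "?s \<le> n * R ^ (?N - 1)" by (simp add: n_def)
    have den: "(m / 2) ^ ?N * m ^ ?N \<le> k d u ^ ?N * h u ^ ?N"
      using k hm[OF u] m h0 k0 by (intro mult_mono power_mono) auto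
    have den0: "0 < (m / 2) ^ ?N * m ^ ?N" using m by simp
    have da: "0 < d powr a" using d by simp
    have Feq: "F d u = (c * (h u - k d u) / d powr a) * (?s / (k d u ^ ?N * h u ^ ?N)) / n"
      unfolding F_def using h0 k0 by (subst inverse_power_diff) (auto simp: mult_ac)
    have "0 \<le> F d u" unfolding Feq using c k s0 k0 h0 n by simp
    moreover have "F d u \<le> (c * C) * (n * R ^ (?N - 1) / ((m / 2) ^ ?N * m ^ ?N)) / n"
      unfolding Feq
    proof (intro divide_right_mono mult_mono)
      show "?s / (k d u ^ ?N * h u ^ ?N) \<le> n * R ^ (?N - 1) / ((m / 2) ^ ?N * m ^ ?N)"
        using s0 s1 den den0 n R by (intro frac_le) auto
      have "c * (h u - k d u) \<le> c * (C * d powr a)" using k c by (intro mult_left_mono) auto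
      then show "c * (h u - k d u) / d powr a \<le> c * C" using da by (simp add: pos_divide_le_eq mult.assoc)
    qed (use s0 s1 den den0 c C n R k0 h0 in auto)
    moreover have "(c * C) * (n * R ^ (?N - 1) / ((m / 2) ^ ?N * m ^ ?N)) / n = W"
      using n by (simp add: W_def)
    ultimately show ?thesis by simp
  qed
  have vol_diff: "c * (vol (polar (floating_body K d)) - vol (polar K)) / d powr a = integral\<^sup>L sphere_measure (F d)"
    if E: "E d" for d
  proof -
    have d: "0 < d" and ne: "floating_body K d \<noteq> {}" using E by (auto simp: E_def)
    have kp: "0 < supp (floating_body K d) u" if "norm u = 1" for u
      using E that m unfolding E_def k_def by fastforce
    have hp: "0 < supp K u" if "norm u = 1" for u using hm[OF that] m by (simp add: h_def)
    note v1 = vol_polar[OF ne fb kp] and v2 = vol_polar[OF Kne Kb hp]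
    have "integral\<^sup>L sphere_measure (F d) = c / (n * d powr a) *
       (integral\<^sup>L sphere_measure (\<lambda>u. 1 / k d u ^ ?N) - integral\<^sup>L sphere_measure (\<lambda>u. 1 / h u ^ ?N))"
      unfolding F_def k_def h_def using v1(1) v2(1)
      by (subst Bochner_Integration.integral_mult_right_zero) (simp only: Bochner_Integration.integral_diff)
    also have "\<dots> = c * (vol (polar (floating_body K d)) - vol (polar K)) / d powr a"
    proof -
      have "integral\<^sup>L sphere_measure (\<lambda>u. 1 / k d u ^ ?N) = n * vol (polar (floating_body K d))"
        "integral\<^sup>L sphere_measure (\<lambda>u. 1 / h u ^ ?N) = n * vol (polar K)"
        using v1(2) v2(2) by (simp_all add: k_def h_def n_def)
      then show ?thesis using n by (simp add: right_diff_distrib[symmetric])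
    qed
    finally show ?thesis by simp
  qed
  have "((\<lambda>d. c * (vol (polar (floating_body K d)) - vol (polar K)) / d powr a) \<longlongrightarrow> integral\<^sup>L sphere_measure L) (at_right 0)"
    unfolding tendsto_at_iff_sequentially
  proof (intro allI impI)
    fix X :: "nat \<Rightarrow> real" assume X: "\<forall>i. X i \<in> {0<..} - {0}" "X \<longlonglongrightarrow> 0"
    have Xpos: "0 < X i" for i using X(1) by auto
    have XF: "filterlim X (at_right 0) sequentially"
      unfolding filterlim_at using X(2) by (auto simp: Xpos less_imp_neq[OF Xpos, symmetric])
    have "\<forall>\<^sub>F i in sequentially. E (X i)" using XF evE unfolding filterlim_iff by blast
    then obtain j where j: "\<And>i. j \<le> i \<Longrightarrow> E (X i)" unfolding eventually_sequentially by blast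
    \<comment> \<open>Dropping finitely many terms makes \<open>E\<close> hold at every index, so
      that measurability, domination and the volume formula apply to the whole sequence.\<close>
    define Y where "Y i = X (i + j)" for i
    have YE: "E (Y i)" for i using j by (simp add: Y_def)
    have YF: "filterlim Y (at_right 0) sequentially"
      unfolding Y_def by (rule filterlim_compose[OF XF filterlim_add_const_nat_at_top])
    have conv: "(\<lambda>i. F (Y i) u) \<longlonglongrightarrow> L u" if "norm u = 1" for u
      using filterlim_compose[OF pw[OF that] YF] .
    have mF: "F (Y i) \<in> borel_measurable sphere_measure" for i
    proof (rule borel_measurable_sphere_measure)
      have ne: "floating_body K (Y i) \<noteq> {}" using YE by (simp add: E_def)
      have [measurable]: "k (Y i) \<in> borel_measurable borel" "h \<in> borel_measurable borel"
        unfolding k_def h_def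
        by (rule borel_measurable_continuous_onI[OF continuous_supp[OF ne fb]],
            rule borel_measurable_continuous_onI[OF continuous_supp[OF Kne Kb]])
      show "F (Y i) \<in> borel_measurable borel" unfolding F_def by measurable
    qed
    \<comment> \<open>\<open>fK\<close> is defined through choice operators, so the measurability of
      \<open>L\<close> is derived from its being, on the sphere, the pointwise limit of the
      measurable functions \<open>F (Y i)\<close>.\<close>
    have mL: "L \<in> borel_measurable sphere_measure"
      by (rule borel_measurable_LIMSEQ_real[where u = "\<lambda>i. F (Y i)", OF _ mF]) (simp add: conv space_sphere_measure)
    interpret finite_measure "sphere_measure :: (real^'n) measure" by (rule finite_sphere_measure)
    have "(\<lambda>i. integral\<^sup>L sphere_measure (F (Y i))) \<longlonglongrightarrow> integral\<^sup>L sphere_measure L"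
    proof (rule integral_dominated_convergence[where w = "\<lambda>_. W"])
      show "AE u in sphere_measure. (\<lambda>i. F (Y i) u) \<longlonglongrightarrow> L u"
        by (rule AE_I2) (simp add: conv space_sphere_measure)
      show "AE u in sphere_measure. norm (F (Y i) u) \<le> W" for i
        by (rule AE_I2) (simp add: bound[OF YE] space_sphere_measure)
    qed (simp_all add: mF mL)
    then have "(\<lambda>i. c * (vol (polar (floating_body K (Y i))) - vol (polar K)) / Y i powr a) \<longlonglongrightarrow> integral\<^sup>L sphere_measure L"
      by (simp add: vol_diff[OF YE])
    then show "((\<lambda>d. c * (vol (polar (floating_body K d)) - vol (polar K)) / d powr a) \<circ> X) \<longlonglongrightarrow> integral\<^sup>L sphere_measure L"
      unfolding Y_def o_def by (rule LIMSEQ_offset)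
  qed
  then show ?thesis by (simp add: c_def a_def n_def L_def[abs_def] h_def)
qed

theorem theorem8:
  fixes K :: "(real ^ 'n) set"
  assumes "CARD('n) \<ge> 2"
    and "convex_body K"
    and "is_santalo_point K 0"
    and "C2_boundary K"
    and "\<forall>x\<in>frontier K. gauss_curvature K x > 0"
  shows "((\<lambda>\<delta>. 2 * (unit_ball_vol (real CARD('n) - 1) / (real CARD('n) + 1)) powr (2 / (real CARD('n) + 1))
              * (vol (polar (floating_body K (\<delta> * vol K))) - vol (polar K))
              / (\<delta> * vol K) powr (2 / (real CARD('n) + 1)))
          \<longlongrightarrow> integral\<^sup>L sphere_measure
                 (\<lambda>u. 1 / (fK K u powr (1 / (real CARD('n) + 1)) * supp K u ^ (CARD('n) + 1))))
         (at_right 0)"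
proof -
  have K: "compact K" "convex K" using assms(2) by (auto simp: convex_body_def)
  have int0: "0 \<in> interior K" using assms(3) by (simp add: is_santalo_point_def)
  have K0: "0 < vol K" using vol_pos[OF K(1)] int0 by blast
  \<comment> \<open>The limit is known in terms of the volume \<open>d\<close> cut off; since
    \<open>vol K\<close> is positive, \<open>d = \<delta> * vol K\<close> tends to 0 from the right
    together with \<open>\<delta>\<close>.\<close>
  have "filterlim (\<lambda>\<delta>. \<delta> * vol K) (at_right 0) (at_right 0)"
    unfolding filterlim_at
  proof
    have "((\<lambda>\<delta>. \<delta> * vol K) \<longlongrightarrow> 0 * vol K) (at_right 0)" by (intro tendsto_intros)
    then show "((\<lambda>\<delta>. \<delta> * vol K) \<longlongrightarrow> 0) (at_right 0)" by simp
    have "\<forall>\<^sub>F \<delta> in at_right (0::real). 0 < \<delta>" by (rule eventually_at_right_less)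
    then show "\<forall>\<^sub>F \<delta> in at_right 0. \<delta> * vol K \<in> {0<..} \<and> \<delta> * vol K \<noteq> 0"
      by eventually_elim (use K0 in auto)
  qed
  from filterlim_compose[OF polar_floating_body_limit[OF K int0 assms(4,5)] this]
  show ?thesis by (simp only: cap_const_def)
qed

end
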